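(* Let $\Omega\subset\mathbb R^n$ be bounded and open and $1<p<\infty$. Let $u_j,u\in C(\Omega)\cap W^{1,p}(\Omega)$ with $u_j\to u$ uniformly and strongly in $W^{1,p}(\Omega)$, and put $E_t=\{u>t\}$ and $E_{j,t}=\{u_j>t\}$ for $t\in\mathbb R$. Then $$\int_{\mathbb R}\|\chi_{E_{j,t}}-\chi_{E_t}\|_{L^1(\Omega)}\,dt=\|u_j-u\|_{L^1(\Omega)}\longrightarrow0,$$ $$\int_{\mathbb R}|P(E_{j,t};\Omega)-P(E_t;\Omega)|\,dt\longrightarrow0.$$ There is a subsequence along which $\chi_{E_{j,t}}\to\chi_{E_t}$ strictly in $BV(\Omega)$ for almost every $t$. These assertions hold with $\Omega$ replaced by any fixed open subset of $\Omega$.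
   Context: For a measurable $E\subset\Omega$, the relative perimeter is $P(E;\Omega)=|D\chi_E|(\Omega)$, the total variation of the distributional gradient of the characteristic function $\chi_E$ in $\Omega$. Strict convergence in $BV(\Omega)$ means convergence in $L^1(\Omega)$ together with convergence of the total variations $|D\cdot|(\Omega)$. *)

theory Defs
  imports "HOL-Analysis.Analysis"
begin

text \<open>
  A function on an open set \<open>\<Omega>\<close> is represented by a total function of which only the values on \<open>\<Omega>\<close>
  matter; integrals over \<open>\<Omega>\<close> are taken with respect to Lebesgue measure on \<open>\<Omega>\<close>.
\<close>

section \<open>Test functions\<close>

primrec C_k :: "nat \<Rightarrow> ('a::euclidean_space \<Rightarrow> 'b::real_normed_vector) \<Rightarrow> bool" where
  "C_k 0 f \<longleftrightarrow> continuous_on UNIV f"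
| "C_k (Suc k) f \<longleftrightarrow>
     (\<forall>x. f differentiable (at x)) \<and>
     (\<forall>b\<in>Basis. C_k k (\<lambda>x. frechet_derivative f (at x) b))"

definition test_functions ::
  "'a::euclidean_space set \<Rightarrow> ('a \<Rightarrow> 'b::real_normed_vector) set" where
  "test_functions \<Omega> = {\<phi>. (\<forall>k. C_k k \<phi>) \<and>
     compact (closure {x. \<phi> x \<noteq> 0}) \<and> closure {x. \<phi> x \<noteq> 0} \<subseteq> \<Omega>}"

definition gradient :: "('a::euclidean_space \<Rightarrow> real) \<Rightarrow> 'a \<Rightarrow> 'a" where
  "gradient \<phi> x = (\<Sum>b\<in>Basis. frechet_derivative \<phi> (at x) b *\<^sub>R b)"

definition divergence :: "('a::euclidean_space \<Rightarrow> 'a) \<Rightarrow> 'a \<Rightarrow> real" where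
  "divergence \<phi> x = (\<Sum>b\<in>Basis. frechet_derivative \<phi> (at x) b \<bullet> b)"

section \<open>Lebesgue and Sobolev spaces\<close>

definition Lp_space ::
  "real \<Rightarrow> 'a::euclidean_space set \<Rightarrow> ('a \<Rightarrow> 'b::euclidean_space) set" where
  "Lp_space p \<Omega> = {f. f \<in> borel_measurable (lebesgue_on \<Omega>) \<and>
     integrable (lebesgue_on \<Omega>) (\<lambda>x. norm (f x) powr p)}"

definition Lp_norm ::
  "real \<Rightarrow> 'a::euclidean_space set \<Rightarrow> ('a \<Rightarrow> 'b::euclidean_space) \<Rightarrow> real" where
  "Lp_norm p \<Omega> f = (LINT x|lebesgue_on \<Omega>. norm (f x) powr p) powr (1 / p)"

definition locally_integrable ::
  "'a::euclidean_space set \<Rightarrow> ('a \<Rightarrow> 'b::euclidean_space) \<Rightarrow> bool" where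
  "locally_integrable \<Omega> f \<longleftrightarrow> (\<forall>K. compact K \<and> K \<subseteq> \<Omega> \<longrightarrow> integrable (lebesgue_on K) f)"

definition has_weak_gradient ::
  "'a::euclidean_space set \<Rightarrow> ('a \<Rightarrow> real) \<Rightarrow> ('a \<Rightarrow> 'a) \<Rightarrow> bool" where
  "has_weak_gradient \<Omega> f g \<longleftrightarrow> locally_integrable \<Omega> f \<and> locally_integrable \<Omega> g \<and>
     (\<forall>\<phi>\<in>test_functions \<Omega>.
        (LINT x|lebesgue_on \<Omega>. f x *\<^sub>R gradient \<phi> x) = - (LINT x|lebesgue_on \<Omega>. \<phi> x *\<^sub>R g x))"

text \<open>A representative of the weak gradient, which is unique up to null sets if \<open>\<Omega>\<close> is open.\<close>

definition weak_gradient :: "'a::euclidean_space set \<Rightarrow> ('a \<Rightarrow> real) \<Rightarrow> 'a \<Rightarrow> 'a" where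
  "weak_gradient \<Omega> f = (SOME g. has_weak_gradient \<Omega> f g)"

definition W1p_space :: "real \<Rightarrow> 'a::euclidean_space set \<Rightarrow> ('a \<Rightarrow> real) set" where
  "W1p_space p \<Omega> = {f. f \<in> Lp_space p \<Omega> \<and> (\<exists>g. has_weak_gradient \<Omega> f g \<and> g \<in> Lp_space p \<Omega>)}"

definition W1p_norm :: "real \<Rightarrow> 'a::euclidean_space set \<Rightarrow> ('a \<Rightarrow> real) \<Rightarrow> real" where
  "W1p_norm p \<Omega> f =
     (Lp_norm p \<Omega> f powr p + Lp_norm p \<Omega> (weak_gradient \<Omega> f) powr p) powr (1 / p)"

section \<open>Total variation, perimeter and strict convergence\<close>

definition distributional_gradient ::
  "'a::euclidean_space set \<Rightarrow> ('a \<Rightarrow> real) \<Rightarrow> ('a \<Rightarrow> 'a) \<Rightarrow> real" where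
  "distributional_gradient \<Omega> f \<phi> = - (LINT x|lebesgue_on \<Omega>. f x * divergence \<phi> x)"

text \<open>
  The total variation \<open>|Df|(\<Omega>)\<close>; it is infinite if \<open>Df\<close> is not a finite vector measure on \<open>\<Omega>\<close>.
\<close>

definition total_variation :: "'a::euclidean_space set \<Rightarrow> ('a \<Rightarrow> real) \<Rightarrow> ereal" where
  "total_variation \<Omega> f =
     (SUP \<phi>\<in>{\<phi>\<in>test_functions \<Omega>. \<forall>x. norm (\<phi> x) \<le> 1}. ereal (distributional_gradient \<Omega> f \<phi>))"

definition perimeter :: "'a::euclidean_space set \<Rightarrow> 'a set \<Rightarrow> ereal" where
  "perimeter E \<Omega> = total_variation \<Omega> (indicator E)"

definition BV_space :: "'a::euclidean_space set \<Rightarrow> ('a \<Rightarrow> real) set" where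
  "BV_space \<Omega> = {f. f \<in> Lp_space 1 \<Omega> \<and> total_variation \<Omega> f < \<infinity>}"

definition BV_strict_limit ::
  "'a::euclidean_space set \<Rightarrow> (nat \<Rightarrow> 'a \<Rightarrow> real) \<Rightarrow> ('a \<Rightarrow> real) \<Rightarrow> bool" where
  "BV_strict_limit \<Omega> f g \<longleftrightarrow> (\<forall>k. f k \<in> BV_space \<Omega>) \<and> g \<in> BV_space \<Omega> \<and>
     (\<lambda>k. Lp_norm 1 \<Omega> (\<lambda>x. f k x - g x)) \<longlonglongrightarrow> 0 \<and>
     (\<lambda>k. total_variation \<Omega> (f k)) \<longlonglongrightarrow> total_variation \<Omega> g"

definition superlevel :: "'a set \<Rightarrow> ('a \<Rightarrow> real) \<Rightarrow> real \<Rightarrow> 'a set" where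
  "superlevel \<Omega> u t = {x\<in>\<Omega>. u x > t}"

text \<open>
  \<open>perimeter_distance \<Omega> V u v\<close> is the integral over all real \<open>t\<close> of
  \<open>|P({u > t}; V) - P({v > t}; V)|\<close>. Perimeters are extended reals and \<open>\<infinity> - \<infinity> = \<infinity>\<close> in
  \<^typ>\<open>ereal\<close>, so levels at which both perimeters are infinite are not discounted.
\<close>

definition perimeter_distance ::
  "'a::euclidean_space set \<Rightarrow> 'a set \<Rightarrow> ('a \<Rightarrow> real) \<Rightarrow> ('a \<Rightarrow> real) \<Rightarrow> ennreal" where
  "perimeter_distance \<Omega> V u v =
     (\<integral>\<^sup>+t. e2ennreal \<bar>perimeter (superlevel \<Omega> u t) V - perimeter (superlevel \<Omega> v t) V\<bar> \<partial>lborel)"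

end

theory Submission
  imports Defs "HOL-Probability.Sinc_Integral"
begin

text \<open>
  The coarea formula identifies \<open>\<integral> P({u > t}; V) dt\<close> with \<open>\<integral>\<^sub>V \<bar>\<nabla>u\<bar>\<close>. For all but a null set of
  levels the set \<open>{u = t}\<close> is negligible, hence the superlevel sets of \<open>u\<^sub>j\<close> converge in \<open>L\<^sup>1\<close> and
  \<open>P({u > t}; V) \<le> liminf P({u\<^sub>j > t}; V)\<close>; since moreover the integrals over \<open>t\<close> converge, a Scheffe
  argument gives convergence of the perimeters in \<open>L\<^sup>1\<close>.

  The lower bound in the coarea formula is the layer cake formula tested with smooth fields that
  approximate \<open>\<nabla>u / \<bar>\<nabla>u\<bar>\<close>. For the upper bound, \<open>\<chi>\<close> of \<open>{u > t}\<close> is the limit of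
  \<open>\<eta>\<^sub>n(u - t)\<close> for steep smooth steps \<open>\<eta>\<^sub>n\<close>; the chain rule bounds the variation of the latter by
  \<open>\<integral> \<eta>\<^sub>n'(u - t) \<bar>\<nabla>u\<bar>\<close>, and Fatou's lemma and Tonelli's theorem in \<open>t\<close> conclude.
\<close>

section \<open>A smooth bump function\<close>

text \<open>A total variation is a supremum over smooth fields only, while the arguments produce
  fields that are merely continuous or measurable, such as \<open>\<eta>'(u) \<phi>\<close> or the
  direction of the gradient. These have to be smoothed without leaving the open set, so everything
  rests on one compactly supported smooth mollifier. Further obstacles shape the proof.
  \<open>weak_gradient\<close> is a \<open>SOME\<close> choice, so the Sobolev norm speaks of an
  unknown representative, and uniqueness almost everywhere must come before any comparison of norms.
  The perimeter is a supremum over an uncountable family, so its measurability in the level needs an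
  argument. Perimeters may be infinite on a null set of levels, so finiteness is read off from the
  coarea formula before real-valued integration takes over. Boundedness of \<Omega> gives finite
  measure and turns L^p convergence of gradients into L^1 convergence; continuity of
  \<open>u\<close> permits a Tietze extension in the chain rule; uniform convergence supplies the
  pointwise limits behind the superlevel sets.\<close>

definition flat_exp :: "nat \<Rightarrow> real \<Rightarrow> real" where
  "flat_exp k s = (if s > 0 then exp (- (1 / s)) / s ^ k else 0)"

lemma flat_exp_nonneg: "0 \<le> flat_exp k s"
  by (simp add: flat_exp_def)

text \<open>For \<open>s > 0\<close> the single term of index \<open>k + 2\<close> of the
  exponential series at \<open>1 / s\<close> is at most \<open>exp (1 / s)\<close>, so
  \<open>exp (- (1 / s)) \<le> fact (k + 2) * s ^ (k + 2)\<close>. After division by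
  \<open>s ^ k\<close> two powers of \<open>s\<close> remain, enough for differentiability at
  0.\<close>

lemma flat_exp_le: "\<bar>flat_exp k s\<bar> \<le> fact (k + 2) * s\<^sup>2"
proof (cases "s > 0")
  case True
  have "(\<lambda>n. (1 / s) ^ n /\<^sub>R fact n) sums exp (1 / s)"
    by (rule exp_converges)
  then have "(\<Sum>n\<in>{k + 2}. (1 / s) ^ n /\<^sub>R fact n) \<le> exp (1 / s)"
    using True sum_le_suminf[OF sums_summable, of "\<lambda>n. (1 / s) ^ n /\<^sub>R fact n" "exp (1 / s)" "{k + 2}"]
    by (simp add: sums_unique[symmetric] del: fact_Suc power_Suc power_add)
  then have "1 / (fact (k + 2) * s ^ (k + 2)) \<le> exp (1 / s)"
    by (simp add: power_divide divide_inverse power_inverse mult_ac)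
  then have "1 \<le> exp (1 / s) * (fact (k + 2) * s ^ (k + 2))"
    using True by (simp add: divide_le_eq zero_less_mult_iff)
  then have "exp (- (1 / s)) \<le> fact (k + 2) * s ^ (k + 2)"
    by (simp add: exp_minus divide_simps mult.commute)
  then show ?thesis
    using True by (simp add: flat_exp_def divide_le_eq power_add mult_ac del: fact_Suc add_2_eq_Suc')
qed (simp add: flat_exp_def)

text \<open>The power of \<open>1 / s\<close> is carried as an index because the family is then
  closed under differentiation. At \<open>s = 0\<close> the quadratic bound makes the difference
  quotient vanish.\<close>

lemma flat_exp_has_field_derivative:
  "(flat_exp k has_field_derivative flat_exp (k + 2) s - real k * flat_exp (k + 1) s) (at s)"
proof -
  consider "s < 0" | "s = 0" | "s > 0" by linarith
  then show ?thesis
  proof cases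
    case 1
    have "((\<lambda>_. 0) has_field_derivative 0) (at s)" by simp
    then have "(flat_exp k has_field_derivative 0) (at s)"
      by (rule has_field_derivative_transform_within[where d = "- s"])
         (use 1 in \<open>auto simp: flat_exp_def dist_real_def\<close>)
    then show ?thesis using 1 by (simp add: flat_exp_def)
  next
    case 2
    have "(\<lambda>h. flat_exp k h / h) \<midarrow>0\<rightarrow> 0"
    proof (rule Lim_null_comparison)
      have "norm (flat_exp k h / h) \<le> fact (k + 2) * \<bar>h\<bar>" if "h \<noteq> 0" for h
      proof -
        have "\<bar>flat_exp k h\<bar> \<le> fact (k + 2) * \<bar>h\<bar> * \<bar>h\<bar>"
          using flat_exp_le[of k h] by (simp only: power2_eq_square mult.assoc abs_mult_self_eq)
        then show ?thesis
          using that by (simp add: divide_le_eq del: fact_Suc add_2_eq_Suc')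
      qed
      then show "\<forall>\<^sub>F h in at 0. norm (flat_exp k h / h) \<le> fact (k + 2) * \<bar>h\<bar>"
        by (auto simp: eventually_at intro!: exI[of _ 1])
      show "(\<lambda>h. fact (k + 2) * \<bar>h\<bar>) \<midarrow>0\<rightarrow> (0::real)"
        by (auto intro!: tendsto_eq_intros)
    qed
    then show ?thesis using 2 by (simp add: DERIV_def flat_exp_def)
  next
    case 3
    have "((\<lambda>s. exp (- (1 / s)) * (1 / s) ^ k) has_field_derivative
        (exp (- (1 / s)) * (1 / s)\<^sup>2 * (1 / s) ^ k
          - exp (- (1 / s)) * (real k * (1 / s) ^ (k - 1) * (1 / s)\<^sup>2))) (at s)"
      using 3 by (auto intro!: derivative_eq_intros simp: power2_eq_square)
    \<comment> \<open>For \<open>k = 0\<close> the truncated exponent \<open>k - 1\<close> is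
      harmless because of the factor \<open>real k\<close>.\<close>
    moreover have "real k * (1 / s) ^ (k - 1) * (1 / s)\<^sup>2 = real k * (1 / s) ^ (k + 1)"
      by (cases k) (simp_all add: power2_eq_square)
    ultimately have "((\<lambda>s. exp (- (1 / s)) * (1 / s) ^ k) has_field_derivative
        (exp (- (1 / s)) * (1 / s)\<^sup>2 * (1 / s) ^ k
          - exp (- (1 / s)) * (real k * (1 / s) ^ (k + 1)))) (at s)"
      by (simp only:)
    then have "((\<lambda>s. exp (- (1 / s)) / s ^ k) has_field_derivative
        (exp (- (1 / s)) / s ^ (k + 2) - real k * (exp (- (1 / s)) / s ^ (k + 1)))) (at s)"
      by (simp add: power_divide power_add power2_eq_square mult_ac)
    then have "(flat_exp k has_field_derivative
        (exp (- (1 / s)) / s ^ (k + 2) - real k * (exp (- (1 / s)) / s ^ (k + 1)))) (at s)"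
      by (rule has_field_derivative_transform_within[where d = s])
         (use 3 in \<open>auto simp: flat_exp_def dist_real_def\<close>)
    then show ?thesis using 3 by (simp add: flat_exp_def)
  qed
qed

text \<open>An algebra of functions that contains the bump functions and is closed under directional derivatives.\<close>

inductive bump_algebra :: "real \<Rightarrow> ('a::euclidean_space \<Rightarrow> real) \<Rightarrow> bool" for e where
  const: "bump_algebra e (\<lambda>x. c)"
| inner: "bump_algebra e (\<lambda>x. x \<bullet> b)"
| flat: "bump_algebra e (\<lambda>x. flat_exp k (e\<^sup>2 - x \<bullet> x))"
| add: "bump_algebra e f \<Longrightarrow> bump_algebra e g \<Longrightarrow> bump_algebra e (\<lambda>x. f x + g x)"
| mult: "bump_algebra e f \<Longrightarrow> bump_algebra e g \<Longrightarrow> bump_algebra e (\<lambda>x. f x * g x)"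

lemma bump_algebra_has_derivative:
  assumes "bump_algebra e f"
  shows "\<exists>f'. (\<forall>x. (f has_derivative f' x) (at x)) \<and> (\<forall>b. bump_algebra e (\<lambda>x. f' x b))"
  using assms
proof induction
  case (const c)
  then show ?case by (intro exI[of _ "\<lambda>x b. 0"]) (auto intro: bump_algebra.const)
next
  case (inner b)
  then show ?case
    by (intro exI[of _ "\<lambda>x h. h \<bullet> b"]) (auto intro: bump_algebra.const intro!: derivative_eq_intros)
next
  case (flat k)
  have "((\<lambda>x::'a. flat_exp k (e\<^sup>2 - x \<bullet> x)) has_derivative
     (\<lambda>h. (-2 * (x \<bullet> h)) * (flat_exp (k + 2) (e\<^sup>2 - x \<bullet> x) + - real k * flat_exp (k + 1) (e\<^sup>2 - x \<bullet> x))))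
     (at x)" for x
    by (rule has_derivative_eq_rhs,
        rule DERIV_compose_FDERIV[OF flat_exp_has_field_derivative, where g = "\<lambda>x. e\<^sup>2 - x \<bullet> x"])
       (auto intro!: derivative_eq_intros simp: inner_commute algebra_simps)
  then have 1: "\<forall>x::'a. ((\<lambda>x. flat_exp k (e\<^sup>2 - x \<bullet> x)) has_derivative
     (\<lambda>h. (-2 * (x \<bullet> h)) * (flat_exp (k + 2) (e\<^sup>2 - x \<bullet> x) + - real k * flat_exp (k + 1) (e\<^sup>2 - x \<bullet> x))))
     (at x)" ..
  have 2: "\<forall>b::'a. bump_algebra e (\<lambda>x. (-2 * (x \<bullet> b)) *
      (flat_exp (k + 2) (e\<^sup>2 - x \<bullet> x) + - real k * flat_exp (k + 1) (e\<^sup>2 - x \<bullet> x)))"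
    by (intro allI
        bump_algebra.mult[OF bump_algebra.mult[OF bump_algebra.const bump_algebra.inner]
            bump_algebra.add[OF bump_algebra.flat
              bump_algebra.mult[OF bump_algebra.const bump_algebra.flat]]])
  show ?case
    by (rule exI) (rule conjI[OF 1 2])
next
  case (add f g)
  then obtain f' g' where "\<And>x. (f has_derivative f' x) (at x)" "\<And>b. bump_algebra e (\<lambda>x. f' x b)"
    "\<And>x. (g has_derivative g' x) (at x)" "\<And>b. bump_algebra e (\<lambda>x. g' x b)"
    by blast
  then have "\<forall>x. ((\<lambda>x. f x + g x) has_derivative (\<lambda>b. f' x b + g' x b)) (at x)"
    "\<forall>b. bump_algebra e (\<lambda>x. f' x b + g' x b)"
    by (intro allI has_derivative_add, simp_all) (intro allI bump_algebra.add, simp_all)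
  then show ?case by (intro exI conjI)
next
  case (mult f g)
  then obtain f' g' where "\<And>x. (f has_derivative f' x) (at x)" "\<And>b. bump_algebra e (\<lambda>x. f' x b)"
    "\<And>x. (g has_derivative g' x) (at x)" "\<And>b. bump_algebra e (\<lambda>x. g' x b)"
    by blast
  then have "\<forall>x. ((\<lambda>x. f x * g x) has_derivative (\<lambda>b. f x * g' x b + f' x b * g x)) (at x)"
    "\<forall>b. bump_algebra e (\<lambda>x. f x * g' x b + f' x b * g x)"
    using mult.hyps by (intro allI has_derivative_mult, simp_all)
      (intro allI bump_algebra.add bump_algebra.mult; simp)
  then show ?case by (intro exI conjI)
qed

text \<open>The recursion in \<open>C_k\<close> looks at one derivative at a time, so closure of the
  algebra under directional derivatives gives smoothness by induction, without any formula for
  higher derivatives.\<close>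

lemma bump_algebra_C_k: "bump_algebra e f \<Longrightarrow> C_k k f"
proof (induction k arbitrary: f)
  case 0
  obtain f' where f': "\<And>x. (f has_derivative f' x) (at x)"
    using bump_algebra_has_derivative[OF 0] by blast
  have "continuous (at x) f" for x by (rule has_derivative_continuous[OF f'])
  then show ?case by (simp add: continuous_on_eq_continuous_at)
next
  case (Suc k)
  obtain f' where f': "\<And>x. (f has_derivative f' x) (at x)" "\<And>b. bump_algebra e (\<lambda>x. f' x b)"
    using bump_algebra_has_derivative[OF Suc.prems] by blast
  have "frechet_derivative f (at x) = f' x" for x
    using frechet_derivative_at[OF f'(1)] by simp
  moreover have "f differentiable (at x)" for x
    using f'(1) unfolding differentiable_def by blast
  ultimately show ?case
    using Suc.IH[OF f'(2)] by simp
qed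

definition smooth :: "('a::euclidean_space \<Rightarrow> 'b::real_normed_vector) \<Rightarrow> bool" where
  "smooth f \<longleftrightarrow> (\<forall>k. C_k k f)"

lemma smooth_continuous: "smooth f \<Longrightarrow> continuous_on UNIV f"
  unfolding smooth_def by (metis C_k.simps(1))

lemma smooth_has_derivative:
  "smooth f \<Longrightarrow> (f has_derivative frechet_derivative f (at x)) (at x)"
  unfolding smooth_def by (metis C_k.simps(2) frechet_derivative_works)

lemma smooth_frechet_derivative:
  "smooth f \<Longrightarrow> b \<in> Basis \<Longrightarrow> smooth (\<lambda>x. frechet_derivative f (at x) b)"
  unfolding smooth_def by (metis C_k.simps(2))

lemma frechet_derivative_expand:
  assumes "(f has_derivative f') (at x)"
  shows "f' h = (\<Sum>b\<in>Basis. (h \<bullet> b) *\<^sub>R f' b)"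
proof -
  interpret f': bounded_linear f' using assms by (rule has_derivative_bounded_linear)
  have "f' h = f' (\<Sum>b\<in>Basis. (h \<bullet> b) *\<^sub>R b)" by (simp add: euclidean_representation)
  then show ?thesis by (simp add: f'.sum f'.scaleR)
qed

section \<open>Mollification\<close>

text \<open>The kernel is a parameter rather than a fixed mollifier because differentiation replaces
  it by its partial derivatives.\<close>

definition mollify :: "('a::euclidean_space \<Rightarrow> real) \<Rightarrow> ('a \<Rightarrow> 'b::euclidean_space) \<Rightarrow> 'a \<Rightarrow> 'b" where
  "mollify \<rho> \<psi> x = (LINT y|lborel. \<rho> (x - y) *\<^sub>R \<psi> y)"

lemma
  fixes f :: "'a::euclidean_space \<Rightarrow> 'b::euclidean_space"
  assumes cont: "continuous_on UNIV f" and zero: "\<And>x. x \<notin> cbox a b \<Longrightarrow> f x = 0"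
  shows integrable_continuous_support: "integrable lborel f"
    and integral_continuous_support: "(LINT x|lborel. f x) = integral (cbox a b) f"
proof -
  have eq: "(\<lambda>x. indicator (cbox a b) x *\<^sub>R f x) = f"
    using zero by (auto simp: indicator_def fun_eq_iff)
  have "integrable lborel (\<lambda>x. indicator (cbox a b) x *\<^sub>R f x)"
    by (rule borel_integrable_compact) (use cont continuous_on_subset in auto)
  then have "set_integrable lborel (cbox a b) f"
    by (simp add: set_integrable_def)
  from set_borel_integral_eq_integral(2)[OF this] show "(LINT x|lborel. f x) = integral (cbox a b) f"
    by (simp add: set_lebesgue_integral_def eq)
  show "integrable lborel f"
    using \<open>set_integrable lborel (cbox a b) f\<close> by (simp add: set_integrable_def eq)
qed

lemma compact_support_cbox:
  fixes f :: "'a::euclidean_space \<Rightarrow> 'b::zero"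
  assumes "bounded {x. f x \<noteq> 0}"
  obtains a b where "\<And>x. x \<notin> cbox a b \<Longrightarrow> f x = 0"
proof -
  obtain a where "{x. f x \<noteq> 0} \<subseteq> cbox (- a) a"
    using bounded_subset_cbox_symmetric[OF assms] by metis
  then show ?thesis by (intro that[of "- a" a]) auto
qed

text \<open>Differentiation under the integral sign, over a box that contains the support of
  \<open>\<psi>\<close>. The derivative falls on the kernel, so continuity of \<open>\<psi>\<close>
  suffices.\<close>

lemma mollify_has_derivative:
  fixes \<psi> :: "'a::euclidean_space \<Rightarrow> 'b::euclidean_space"
  assumes \<rho>: "smooth \<rho>" and \<psi>: "continuous_on UNIV \<psi>" "bounded {x. \<psi> x \<noteq> 0}"
  shows "(mollify \<rho> \<psi> has_derivative
    (\<lambda>h. \<Sum>b\<in>Basis. (h \<bullet> b) *\<^sub>R mollify (\<lambda>x. frechet_derivative \<rho> (at x) b) \<psi> x)) (at x)"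
proof -
  obtain l u where lu: "\<And>x. x \<notin> cbox l u \<Longrightarrow> \<psi> x = 0"
    using compact_support_cbox[OF \<psi>(2)] by blast
  define D where "D = (\<lambda>b x. frechet_derivative \<rho> (at x) b)"
  have D: "continuous_on UNIV (D b)" if "b \<in> Basis" for b
    unfolding D_def using smooth_continuous[OF smooth_frechet_derivative[OF \<rho> that]] .
  have \<rho>': "continuous_on UNIV \<rho>" using \<rho> by (rule smooth_continuous)
  note [continuous_intros] = continuous_on_compose2[OF D] continuous_on_compose2[OF \<rho>']
    continuous_on_compose2[OF \<psi>(1)] bounded_linear.continuous_on[OF bounded_linear_blinfun_scaleR_left]
    bounded_bilinear.continuous_on[OF bounded_bilinear_blinfun_compose]
  \<comment> \<open>\<open>leibniz_rule\<close> wants the derivative of the integrand as a bounded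
    linear map that is continuous in both variables. Writing it through partial derivatives reduces
    this to continuity of the \<open>D b\<close>.\<close>
  define F where "F = (\<lambda>x y. \<Sum>b\<in>Basis. blinfun_scaleR_left (D b (x - y) *\<^sub>R \<psi> y) o\<^sub>L blinfun_inner_left b)"
  have F: "blinfun_apply (F x y) h = (\<Sum>b\<in>Basis. (h \<bullet> b) *\<^sub>R D b (x - y) *\<^sub>R \<psi> y)" for x y h
    unfolding F_def by (simp add: blinfun.sum_left)
  have mol: "mollify r \<psi> x = integral (cbox l u) (\<lambda>y. r (x - y) *\<^sub>R \<psi> y)"
    if "continuous_on UNIV r" for r x
    unfolding mollify_def
    by (rule integral_continuous_support)
       (use that lu in \<open>auto intro!: continuous_intros continuous_on_compose2[OF that]\<close>)
  have "((\<lambda>x. integral (cbox l u) (\<lambda>y. \<rho> (x - y) *\<^sub>R \<psi> y)) has_derivative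
     integral (cbox l u) (F x)) (at x within UNIV)"
  proof (rule leibniz_rule)
    fix x y
    have "((\<lambda>x. \<rho> (x - y)) has_derivative frechet_derivative \<rho> (at (x - y))) (at x)"
      by (rule has_derivative_eq_rhs,
          rule has_derivative_compose[where f="\<lambda>x. x - y" and g = \<rho>, OF _ smooth_has_derivative[OF \<rho>]])
         (auto intro!: derivative_eq_intros)
    then have "((\<lambda>x. \<rho> (x - y) *\<^sub>R \<psi> y) has_derivative (\<lambda>h. frechet_derivative \<rho> (at (x - y)) h *\<^sub>R \<psi> y)) (at x)"
      by (rule has_derivative_scaleR_left)
    also have "(\<lambda>h. frechet_derivative \<rho> (at (x - y)) h *\<^sub>R \<psi> y) = blinfun_apply (F x y)"
      unfolding F D_def
      by (subst frechet_derivative_expand[OF smooth_has_derivative[OF \<rho>]])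
         (simp add: scaleR_sum_left fun_eq_iff)
    finally show "((\<lambda>x. \<rho> (x - y) *\<^sub>R \<psi> y) has_derivative blinfun_apply (F x y)) (at x within UNIV)"
      by simp
  next
    fix x show "(\<lambda>y. \<rho> (x - y) *\<^sub>R \<psi> y) integrable_on cbox l u"
      by (rule integrable_continuous) (intro continuous_intros; simp)
  next
    show "continuous_on (UNIV \<times> cbox l u) (\<lambda>(x, y). F x y)"
      unfolding F_def split_beta by (intro continuous_intros; simp)
  qed auto
  moreover have "blinfun_apply (integral (cbox l u) (F x)) =
      (\<lambda>h. \<Sum>b\<in>Basis. (h \<bullet> b) *\<^sub>R mollify (D b) \<psi> x)"
  proof
    fix h
    have "blinfun_apply (integral (cbox l u) (F x)) h = integral (cbox l u) (\<lambda>y. blinfun_apply (F x y) h)"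
      by (rule blinfun_apply_integral)
         (auto intro!: integrable_continuous continuous_intros simp: F_def)
    also have "\<dots> = (\<Sum>b\<in>Basis. integral (cbox l u) (\<lambda>y. (h \<bullet> b) *\<^sub>R D b (x - y) *\<^sub>R \<psi> y))"
      unfolding F by (rule integral_sum) (auto intro!: integrable_continuous continuous_intros)
    finally show "blinfun_apply (integral (cbox l u) (F x)) h =
        (\<Sum>b\<in>Basis. (h \<bullet> b) *\<^sub>R mollify (D b) \<psi> x)"
      by (simp only: integral_cmul) (simp add: mol D)
  qed
  moreover have "mollify \<rho> \<psi> = (\<lambda>x. integral (cbox l u) (\<lambda>y. \<rho> (x - y) *\<^sub>R \<psi> y))"
    using mol[OF \<rho>'] by blast
  ultimately show ?thesis by (simp add: D_def)
qed

lemma frechet_derivative_mollify: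
  fixes \<psi> :: "'a::euclidean_space \<Rightarrow> 'b::euclidean_space"
  assumes "smooth \<rho>" and "continuous_on UNIV \<psi>" "bounded {x. \<psi> x \<noteq> 0}" and b: "b \<in> Basis"
  shows "frechet_derivative (mollify \<rho> \<psi>) (at x) b = mollify (\<lambda>x. frechet_derivative \<rho> (at x) b) \<psi> x"
proof -
  have "frechet_derivative (mollify \<rho> \<psi>) (at x) =
      (\<lambda>h. \<Sum>c\<in>Basis. (h \<bullet> c) *\<^sub>R mollify (\<lambda>x. frechet_derivative \<rho> (at x) c) \<psi> x)"
    using frechet_derivative_at[OF mollify_has_derivative[OF assms(1-3)]] by simp
  then have "frechet_derivative (mollify \<rho> \<psi>) (at x) b =
      (\<Sum>c\<in>Basis. (b \<bullet> c) *\<^sub>R mollify (\<lambda>x. frechet_derivative \<rho> (at x) c) \<psi> x)"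
    by simp
  also have "\<dots> = (\<Sum>c\<in>Basis. if c = b then mollify (\<lambda>x. frechet_derivative \<rho> (at x) b) \<psi> x else 0)"
    using b by (intro sum.cong) (auto simp: inner_Basis)
  finally show ?thesis using b by simp
qed

text \<open>Induction with the kernel generalised: each partial derivative is again a mollification
  of the same \<open>\<psi>\<close>, by a differentiated kernel.\<close>

lemma smooth_mollify:
  fixes \<psi> :: "'a::euclidean_space \<Rightarrow> 'b::euclidean_space"
  assumes "smooth \<rho>" and \<psi>: "continuous_on UNIV \<psi>" "bounded {x. \<psi> x \<noteq> 0}"
  shows "smooth (mollify \<rho> \<psi>)"
proof -
  have "C_k k (mollify \<rho> \<psi>)" for k
    using \<open>smooth \<rho>\<close>
  proof (induction k arbitrary: \<rho>)
    case 0
    have "continuous (at x) (mollify \<rho> \<psi>)" for x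
      by (rule has_derivative_continuous[OF mollify_has_derivative[OF 0 \<psi>]])
    then show ?case by (simp add: continuous_on_eq_continuous_at)
  next
    case (Suc k)
    have "mollify \<rho> \<psi> differentiable (at x)" for x
      using mollify_has_derivative[OF Suc.prems \<psi>] unfolding differentiable_def by blast
    moreover have "C_k k (\<lambda>x. frechet_derivative (mollify \<rho> \<psi>) (at x) b)" if "b \<in> Basis" for b
      unfolding frechet_derivative_mollify[OF Suc.prems \<psi> that]
      using Suc.IH[OF smooth_frechet_derivative[OF Suc.prems that]] .
    ultimately show ?case by simp
  qed
  then show ?thesis by (simp add: smooth_def)
qed

section \<open>Test functions\<close>

lemma lborel_integral_reflect:
  fixes f :: "'a::euclidean_space \<Rightarrow> 'b::{banach, second_countable_topology}"
  assumes [measurable]: "f \<in> borel_measurable borel"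
  shows "(LINT y|lborel. f (x - y)) = (LINT y|lborel. f y)"
proof -
  have "lborel = distr lborel borel (\<lambda>y::'a. x - y)"
    using lborel_affine[of "-1" x] by (simp add: density_1)
  then have "(LINT y|lborel. f y) = (LINT y|distr lborel borel (\<lambda>y. x - y). f y)"
    by (rule arg_cong)
  then show ?thesis
    by (simp add: integral_distr)
qed

lemma lborel_integral_translate:
  fixes f :: "'a::euclidean_space \<Rightarrow> 'b::{banach, second_countable_topology}"
  assumes [measurable]: "f \<in> borel_measurable borel"
  shows "(LINT y|lborel. f (y + x)) = (LINT y|lborel. f y)"
proof -
  have "(LINT y|lborel. f y) = (LINT y|distr lborel borel ((+) x). f y)"
    by (rule arg_cong) (rule lborel_distr_plus[symmetric])
  then show ?thesis
    by (simp add: integral_distr add.commute)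
qed

lemma integral_directional_derivative_zero:
  fixes F :: "'a::euclidean_space \<Rightarrow> 'b::euclidean_space"
  assumes der: "\<And>x. (F has_derivative F' x) (at x)" and cont: "continuous_on UNIV (\<lambda>x. F' x b)"
    and supp: "bounded {x. F x \<noteq> 0}"
  shows "(LINT x|lborel. F' x b) = 0"
proof -
  have contF: "continuous_on UNIV F"
    using der by (auto simp: continuous_on_eq_continuous_at intro: has_derivative_continuous)
  obtain R where R: "\<And>x. F x \<noteq> 0 \<Longrightarrow> norm x \<le> R"
    using supp unfolding bounded_iff by auto
  \<comment> \<open>The margin \<open>norm b\<close> keeps the supports of all translates with
    \<open>t\<close> in \<open>{-1..1}\<close> inside one box.\<close>
  obtain l u where lu: "cball (0::'a) (R + norm b) \<subseteq> cbox l u"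
    using bounded_subset_cbox_symmetric[OF bounded_cball] by metis
  have zero: "F (x + t *\<^sub>R b) = 0" if "x \<notin> cbox l u" "t \<in> {-1..1}" for x and t :: real
  proof (rule ccontr)
    assume "F (x + t *\<^sub>R b) \<noteq> 0"
    then have "norm (x + t *\<^sub>R b) \<le> R" by (rule R)
    moreover have "norm (t *\<^sub>R b) \<le> norm b"
      using that(2) by (simp add: mult_left_le_one_le abs_le_iff)
    moreover have "norm x \<le> norm (x + t *\<^sub>R b) + norm (t *\<^sub>R b)"
      using norm_triangle_ineq4[of "x + t *\<^sub>R b" "t *\<^sub>R b"] by simp
    ultimately have "norm x \<le> R + norm b" by linarith
    then have "x \<in> cball 0 (R + norm b)" by simp
    then show False using that(1) lu by blast
  qed
  have F'0: "F' x b = 0" if "x \<notin> cbox l u" for x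
  proof -
    have "((\<lambda>_. 0) has_derivative (\<lambda>_. 0)) (at x)" by simp
    then have "(F has_derivative (\<lambda>_. 0)) (at x)"
      by (rule has_derivative_transform_within_open[where s = "- cbox l u"])
         (use that zero[of _ 0] in auto)
    then show ?thesis using has_derivative_unique[OF der] by metis
  qed
  note [continuous_intros] = continuous_on_compose2[OF contF] continuous_on_compose2[OF cont]
  have "((\<lambda>t. integral (cbox l u) (\<lambda>x. F (x + t *\<^sub>R b))) has_vector_derivative
      integral (cbox l u) (\<lambda>x. F' (x + 0 *\<^sub>R b) b)) (at 0 within {-1..1})"
  proof (rule leibniz_rule_vector_derivative)
    fix t :: real and x
    have "((\<lambda>t. F (x + t *\<^sub>R b)) has_derivative (\<lambda>s. F' (x + t *\<^sub>R b) (s *\<^sub>R b))) (at t within {-1..1})"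
      by (rule has_derivative_compose[OF _ der]) (auto intro!: derivative_eq_intros)
    then show "((\<lambda>t. F (x + t *\<^sub>R b)) has_vector_derivative F' (x + t *\<^sub>R b) b) (at t within {-1..1})"
      unfolding has_vector_derivative_def
      by (simp add: bounded_linear.linear[OF has_derivative_bounded_linear[OF der]] linear_cmul)
  next
    fix t :: real show "(\<lambda>x. F (x + t *\<^sub>R b)) integrable_on cbox l u"
      by (rule integrable_continuous) (intro continuous_intros; simp)
  next
    show "continuous_on ({-1..1} \<times> cbox l u) (\<lambda>(t, x). F' (x + t *\<^sub>R b) b)"
      unfolding split_beta by (intro continuous_intros; simp)
  qed auto
  moreover have "integral (cbox l u) (\<lambda>x. F (x + t *\<^sub>R b)) = (LINT x|lborel. F x)" if "t \<in> {-1..1}" for t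
  proof -
    have "(LINT x|lborel. F (x + t *\<^sub>R b)) = integral (cbox l u) (\<lambda>x. F (x + t *\<^sub>R b))"
      by (rule integral_continuous_support) (use zero that in \<open>auto intro!: continuous_intros\<close>)
    moreover have "F \<in> borel_measurable borel"
      using contF by (rule borel_measurable_continuous_onI)
    ultimately show ?thesis by (simp add: lborel_integral_translate)
  qed
  then have "((\<lambda>t. integral (cbox l u) (\<lambda>x. F (x + t *\<^sub>R b))) has_vector_derivative 0) (at 0 within {-1..1})"
    by (intro has_vector_derivative_transform[OF _ _ has_vector_derivative_const]) auto
  ultimately have "integral (cbox l u) (\<lambda>x. F' (x + 0 *\<^sub>R b) b) = 0"
    by (intro vector_derivative_unique_within[of 0 "{-1..1::real}"]) (auto simp: at_within_Icc_at)
  then show ?thesis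
    using integral_continuous_support[OF cont F'0] by simp
qed

section \<open>Components, gradients and divergences of test functions\<close>

lemma in_test_functions_iff:
  "\<phi> \<in> test_functions V \<longleftrightarrow>
    smooth \<phi> \<and> compact (closure {x. \<phi> x \<noteq> 0}) \<and> closure {x. \<phi> x \<noteq> 0} \<subseteq> V"
  by (simp add: test_functions_def smooth_def)

lemma test_functions_mono: "V \<subseteq> W \<Longrightarrow> test_functions V \<subseteq> test_functions W"
  unfolding in_test_functions_iff subset_iff by blast

lemma
  assumes "\<phi> \<in> test_functions V"
  shows test_function_smooth: "smooth \<phi>"
    and test_function_bounded_support: "bounded {x. \<phi> x \<noteq> 0}"
    and test_function_compact_support: "compact (closure {x. \<phi> x \<noteq> 0})"
    and test_function_closure_support: "closure {x. \<phi> x \<noteq> 0} \<subseteq> V"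
    and test_function_zero: "x \<notin> V \<Longrightarrow> \<phi> x = 0"
  using assms closure_subset[of "{x. \<phi> x \<noteq> 0}"]
  by (auto simp: in_test_functions_iff intro: bounded_subset compact_imp_bounded)

lemma smooth_bounded_linear:
  assumes "bounded_linear L" "smooth f"
  shows "smooth (\<lambda>x. L (f x))"
proof -
  interpret L: bounded_linear L by fact
  have "C_k k (\<lambda>x. L (f x))" for k
    using \<open>smooth f\<close>
  proof (induction k arbitrary: f)
    case 0
    then show ?case by (auto intro: L.continuous_on smooth_continuous)
  next
    case (Suc k)
    have der: "((\<lambda>x. L (f x)) has_derivative (\<lambda>h. L (frechet_derivative f (at x) h))) (at x)" for x
      by (rule L.has_derivative[OF smooth_has_derivative[OF Suc.prems]])
    have eq: "frechet_derivative (\<lambda>x. L (f x)) (at x) = (\<lambda>h. L (frechet_derivative f (at x) h))" for x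
      using frechet_derivative_at[OF der] by simp
    have "(\<lambda>x. L (f x)) differentiable (at x)" for x
      using der unfolding differentiable_def by blast
    then show ?case
      using Suc.IH[OF smooth_frechet_derivative[OF Suc.prems]] by (simp add: eq)
  qed
  then show ?thesis by (simp add: smooth_def)
qed

lemma frechet_derivative_zero_outside_support:
  assumes "x \<notin> closure {x. f x \<noteq> 0}"
  shows "frechet_derivative f (at x) = (\<lambda>_. 0)"
proof -
  have "((\<lambda>_. 0) has_derivative (\<lambda>_. 0)) (at x)" by simp
  then have "(f has_derivative (\<lambda>_. 0)) (at x)"
    by (rule has_derivative_transform_within_open[where s = "- closure {x. f x \<noteq> 0}"])
       (use assms closure_subset[of "{x. f x \<noteq> 0}"] in auto)
  then show ?thesis using frechet_derivative_at by metis
qed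

lemma test_function_component:
  fixes \<phi> :: "'a::euclidean_space \<Rightarrow> 'b::euclidean_space"
  assumes "\<phi> \<in> test_functions V"
  shows "(\<lambda>x. \<phi> x \<bullet> c) \<in> test_functions V"
proof -
  have sub: "closure {x. \<phi> x \<bullet> c \<noteq> 0} \<subseteq> closure {x. \<phi> x \<noteq> 0}"
    by (rule closure_mono) auto
  then have "compact (closure {x. \<phi> x \<bullet> c \<noteq> 0})"
    using test_function_compact_support[OF assms]
    by (metis closed_closure closure_closure compact_Int_closed inf.absorb2 inf.commute)
  then show ?thesis
    using sub test_function_closure_support[OF assms]
      smooth_bounded_linear[OF bounded_linear_inner_left test_function_smooth[OF assms]]
    by (auto simp: in_test_functions_iff)
qed

lemma frechet_derivative_component:
  fixes \<phi> :: "'a::euclidean_space \<Rightarrow> 'b::euclidean_space"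
  assumes "smooth \<phi>"
  shows "frechet_derivative (\<lambda>x. \<phi> x \<bullet> c) (at x) h = frechet_derivative \<phi> (at x) h \<bullet> c"
  using frechet_derivative_at[OF has_derivative_inner_left[OF smooth_has_derivative[OF assms]]]
  by (metis (no_types, lifting))

lemma divergence_eq_gradient:
  fixes \<phi> :: "'a::euclidean_space \<Rightarrow> 'a"
  assumes "smooth \<phi>"
  shows "divergence \<phi> x = (\<Sum>b\<in>Basis. gradient (\<lambda>x. \<phi> x \<bullet> b) x \<bullet> b)"
  unfolding divergence_def gradient_def frechet_derivative_component[OF assms]
  by (rule sum.cong) (auto simp: inner_sum_left inner_Basis if_distrib sum.delta cong: if_cong)

lemma
  assumes "\<phi> \<in> test_functions V"
  shows continuous_on_gradient: "continuous_on UNIV (gradient \<phi>)"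
    and gradient_zero: "x \<notin> closure {x. \<phi> x \<noteq> 0} \<Longrightarrow> gradient \<phi> x = 0"
  unfolding gradient_def
  using smooth_continuous[OF smooth_frechet_derivative[OF test_function_smooth[OF assms]]]
  by (auto intro!: continuous_intros simp: frechet_derivative_zero_outside_support)

lemma
  assumes "\<phi> \<in> test_functions V"
  shows continuous_on_divergence: "continuous_on UNIV (divergence \<phi>)"
    and divergence_zero: "x \<notin> closure {x. \<phi> x \<noteq> 0} \<Longrightarrow> divergence \<phi> x = 0"
  unfolding divergence_def
  using smooth_continuous[OF smooth_frechet_derivative[OF test_function_smooth[OF assms]]]
  by (auto intro!: continuous_intros simp: frechet_derivative_zero_outside_support)

text \<open>Serves \<open>coarea_ge\<close>: adding a constant to a function does not change its
  pairing with the divergence of a test field.\<close>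

lemma integral_divergence_zero:
  assumes "\<phi> \<in> test_functions V"
  shows "(LINT x|lborel. divergence \<phi> x) = 0"
proof -
  have sm: "smooth \<phi>" and bd: "bounded {x. \<phi> x \<noteq> 0}"
    using assms by (auto intro: test_function_smooth test_function_bounded_support)
  have D: "((\<lambda>x. \<phi> x \<bullet> b) has_derivative (\<lambda>h. frechet_derivative \<phi> (at x) h \<bullet> b)) (at x)" for x b
    by (rule has_derivative_inner_left[OF smooth_has_derivative[OF sm]])
  have cont: "continuous_on UNIV (\<lambda>x. frechet_derivative \<phi> (at x) b \<bullet> b)" if "b \<in> Basis" for b
    using smooth_continuous[OF smooth_frechet_derivative[OF sm that]] by (intro continuous_intros)
  have "bounded (closure {x. \<phi> x \<noteq> 0})" using bd by (rule bounded_closure)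
  then obtain a where a: "closure {x. \<phi> x \<noteq> 0} \<subseteq> cbox (-a) a"
    using bounded_subset_cbox_symmetric by metis
  have "(LINT x|lborel. divergence \<phi> x) = (\<Sum>b\<in>Basis. LINT x|lborel. frechet_derivative \<phi> (at x) b \<bullet> b)"
    unfolding divergence_def
    by (rule Bochner_Integration.integral_sum, rule integrable_continuous_support[where a = "-a" and b = a], rule cont)
       (use a frechet_derivative_zero_outside_support[of _ \<phi>] in \<open>force+\<close>)
  also have "\<dots> = (\<Sum>b\<in>(Basis::'a set). 0)"
  proof (rule sum.cong[OF refl])
    fix b :: 'a assume "b \<in> Basis"
    show "(LINT x|lborel. frechet_derivative \<phi> (at x) b \<bullet> b) = 0"
      by (rule integral_directional_derivative_zero[OF D cont[OF \<open>b \<in> Basis\<close>]])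
         (rule bounded_subset[OF bd], auto)
  qed
  finally show ?thesis by simp
qed

section \<open>Approximation by test functions\<close>

text \<open>Using \<open>e\<^sup>2 - x \<bullet> x\<close> with a normalising factor for each
  \<open>e\<close>, instead of rescaling one profile, keeps the function inside
  \<open>bump_algebra e\<close>.\<close>

definition mollifier :: "real \<Rightarrow> 'a::euclidean_space \<Rightarrow> real" where
  "mollifier e x = flat_exp 0 (e\<^sup>2 - x \<bullet> x) * inverse (LINT y|lborel. flat_exp 0 (e\<^sup>2 - (y::'a) \<bullet> y))"

lemma smooth_mollifier: "smooth (mollifier e)"
  unfolding smooth_def mollifier_def
  by (intro allI bump_algebra_C_k[OF bump_algebra.mult[OF bump_algebra.flat bump_algebra.const]])

lemma mollifier_nonneg: "0 \<le> mollifier e x"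
  unfolding mollifier_def by (simp add: flat_exp_nonneg)

lemma mollifier_minus: "mollifier e (- x) = mollifier e x"
  by (simp add: mollifier_def)

lemma mollifier_zero:
  assumes "0 < e" "e \<le> norm x" shows "mollifier e x = 0"
proof -
  have "e\<^sup>2 \<le> x \<bullet> x"
    using assms by (simp add: dot_square_norm power_mono)
  then show ?thesis by (simp add: mollifier_def flat_exp_def)
qed

lemma integral_mollifier:
  assumes "0 < e" shows "(LINT x|lborel. mollifier e (x::'a::euclidean_space)) = 1"
proof -
  let ?f = "\<lambda>x::'a. flat_exp 0 (e\<^sup>2 - x \<bullet> x)"
  have f0: "?f x = 0 \<longleftrightarrow> e \<le> norm x" for x
  proof -
    have "e\<^sup>2 \<le> (norm x)\<^sup>2 \<longleftrightarrow> e \<le> norm x"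
      using assms abs_le_square_iff[of e "norm x"] by simp
    then show ?thesis by (auto simp: flat_exp_def dot_square_norm)
  qed
  have sm: "smooth ?f"
    unfolding smooth_def by (intro allI bump_algebra_C_k[OF bump_algebra.flat])
  obtain a where a: "cball (0::'a) e \<subseteq> cbox (- a) a"
    using bounded_subset_cbox_symmetric[OF bounded_cball] by metis
  have int: "integrable lborel ?f"
  proof (rule integrable_continuous_support[OF smooth_continuous[OF sm]])
    fix x assume "x \<notin> cbox (- a) a"
    then have "x \<notin> cball 0 e" using a by blast
    then show "?f x = 0" by (simp only: f0) simp
  qed
  \<comment> \<open>The normalising factor is an \<open>inverse\<close>, and
    \<open>inverse 0 = 0\<close>, so the integral must not vanish. Otherwise the bump would be zero
    almost everywhere on a ball where it is nonzero.\<close>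
  have "(LINT x|lborel. ?f x) \<noteq> 0"
  proof
    assume "(LINT x|lborel. ?f x) = 0"
    then have "AE x in lborel. ?f x = 0"
      using integral_nonneg_eq_0_iff_AE[OF int] by (simp add: flat_exp_nonneg)
    then have "AE x in lebesgue. ?f x = 0"
      by (rule AE_completion)
    then have "AE x in lebesgue. x \<notin> ball (0::'a) e"
      by (simp only: f0) (simp add: not_less)
    then have "negligible (ball (0::'a) e)"
      by (simp add: negligible_iff_null_sets AE_iff_null_sets)
    then show False
      using open_not_negligible[OF open_ball, of "0::'a" e] assms by simp
  qed
  then show ?thesis
    unfolding mollifier_def by simp
qed

lemma borel_measurable_mollifier [measurable]: "mollifier e \<in> borel_measurable borel"
  by (rule borel_measurable_continuous_onI[OF smooth_continuous[OF smooth_mollifier]])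

text \<open>A mollification is an average of \<open>\<psi>\<close> over a ball of radius
  \<open>e\<close>, with nonnegative weights of total mass 1. With \<open>a = 0\<close> this bounds
  size and support, with \<open>a = \<psi> x\<close> it gives uniform convergence, and a general
  \<open>a\<close> handles fields that vary along a sequence.\<close>

lemma mollify_close:
  fixes \<psi> :: "'a::euclidean_space \<Rightarrow> 'b::euclidean_space"
  assumes e: "0 < e" and \<psi>: "continuous_on UNIV \<psi>" "bounded {x. \<psi> x \<noteq> 0}"
    and d: "\<And>y. dist x y < e \<Longrightarrow> norm (\<psi> y - a) \<le> d"
  shows "norm (mollify (mollifier e) \<psi> x - a) \<le> d"
proof -
  have "0 \<le> d" using d[of x] e norm_ge_zero order_trans by (metis dist_self)
  obtain c where c: "cball x e \<subseteq> cbox (- c) c"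
    using bounded_subset_cbox_symmetric[OF bounded_cball] by metis
  have int1: "integrable lborel (\<lambda>y. mollifier e (x - y))"
  proof (rule integrable_continuous_support)
    show "continuous_on UNIV (\<lambda>y. mollifier e (x - y))"
      by (intro continuous_on_compose2[OF smooth_continuous[OF smooth_mollifier]] continuous_intros) auto
    fix y assume "y \<notin> cbox (- c) c"
    then have "y \<notin> cball x e" using c by blast
    then show "mollifier e (x - y) = 0" by (intro mollifier_zero e) (simp add: dist_norm)
  qed
  have one: "(LINT y|lborel. mollifier e (x - y)) = 1"
    by (subst lborel_integral_reflect) (auto simp: integral_mollifier e)
  obtain l u where lu: "\<And>x. x \<notin> cbox l u \<Longrightarrow> \<psi> x = 0"
    using compact_support_cbox[OF \<psi>(2)] by blast
  have int2: "integrable lborel (\<lambda>y. mollifier e (x - y) *\<^sub>R \<psi> y)"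
    by (rule integrable_continuous_support[where a = l and b = u])
       (use lu in \<open>auto intro!: continuous_intros continuous_on_compose2[OF smooth_continuous[OF smooth_mollifier]] \<psi>\<close>)
  have int3: "integrable lborel (\<lambda>y. mollifier e (x - y) *\<^sub>R a)"
    using int1 by simp
  have "mollify (mollifier e) \<psi> x - a = (LINT y|lborel. mollifier e (x - y) *\<^sub>R (\<psi> y - a))"
    unfolding mollify_def scaleR_diff_right
    by (subst Bochner_Integration.integral_diff[OF int2 int3]) (simp add: one int1)
  also have "norm \<dots> \<le> (LINT y|lborel. mollifier e (x - y) * d)"
  proof (rule Bochner_Integration.integral_norm_bound_integral)
    show "integrable lborel (\<lambda>y. mollifier e (x - y) *\<^sub>R (\<psi> y - a))"
      unfolding scaleR_diff_right by (intro Bochner_Integration.integrable_diff int2 int3)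
    show "integrable lborel (\<lambda>y. mollifier e (x - y) * d)" using int1 by simp
    fix y
    show "norm (mollifier e (x - y) *\<^sub>R (\<psi> y - a)) \<le> mollifier e (x - y) * d"
    proof (cases "dist x y < e")
      case True
      then show ?thesis using d[OF True] by (simp add: mollifier_nonneg mult_left_mono)
    next
      case False
      then have "mollifier e (x - y) = 0" by (intro mollifier_zero e) (simp add: dist_norm)
      then show ?thesis by simp
    qed
  qed
  also have "\<dots> = d" using one by simp
  finally show ?thesis .
qed

text \<open>Outside the compact sum of \<open>K\<close> and the closed ball of radius
  \<open>e\<close> the average meets only zeros of \<open>\<psi>\<close>; this is
  \<open>mollify_close\<close> with \<open>a = 0\<close> and \<open>d = 0\<close>.\<close>

lemma mollify_in_test_functions:
  fixes \<psi> :: "'a::euclidean_space \<Rightarrow> 'b::euclidean_space"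
  assumes e: "0 < e" and \<psi>: "continuous_on UNIV \<psi>" and K: "compact K" "\<And>x. x \<notin> K \<Longrightarrow> \<psi> x = 0"
    and V: "(\<Union>x\<in>K. cball x e) \<subseteq> V"
  shows "mollify (mollifier e) \<psi> \<in> test_functions V"
proof -
  have bd: "bounded {x. \<psi> x \<noteq> 0}"
    by (rule bounded_subset[OF compact_imp_bounded[OF K(1)]]) (use K(2) in auto)
  define T where "T = (\<Union>x\<in>K. \<Union>y\<in>cball 0 e. {x + y})"
  have "compact T" unfolding T_def by (intro compact_sums' K compact_cball)
  have TV: "T \<subseteq> V"
  proof
    fix z assume "z \<in> T"
    then obtain x y where "x \<in> K" "norm y \<le> e" "z = x + y" by (auto simp: T_def)
    then have "z \<in> cball x e" by (simp add: dist_norm)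
    then show "z \<in> V" using V \<open>x \<in> K\<close> by blast
  qed
  have "mollify (mollifier e) \<psi> x = 0" if "x \<notin> T" for x
  proof -
    have "norm (mollify (mollifier e) \<psi> x - 0) \<le> 0"
    proof (rule mollify_close[OF e \<psi> bd])
      fix y assume "dist x y < e"
      have "y \<notin> K"
      proof
        assume "y \<in> K"
        moreover have "x - y \<in> cball 0 e"
          using \<open>dist x y < e\<close> by (simp add: dist_norm norm_minus_commute)
        ultimately have "y + (x - y) \<in> T" unfolding T_def by blast
        then show False using that by simp
      qed
      then show "norm (\<psi> y - 0) \<le> 0" using K(2) by simp
    qed
    then show ?thesis by simp
  qed
  then have "closure {x. mollify (mollifier e) \<psi> x \<noteq> 0} \<subseteq> T"
    by (intro closure_minimal compact_imp_closed \<open>compact T\<close>) auto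
  moreover from this have "compact (closure {x. mollify (mollifier e) \<psi> x \<noteq> 0})"
    using \<open>compact T\<close> by (metis closed_closure compact_Int_closed inf.absorb2)
  ultimately show ?thesis
    using TV smooth_mollify[OF smooth_mollifier \<psi> bd] unfolding in_test_functions_iff by blast
qed

lemma uniformly_continuous_compact_support:
  fixes \<psi> :: "'a::euclidean_space \<Rightarrow> 'b::real_normed_vector"
  assumes \<psi>: "continuous_on UNIV \<psi>" "bounded {x. \<psi> x \<noteq> 0}"
  shows "uniformly_continuous_on UNIV \<psi>"
proof -
  obtain R where R: "\<And>x. \<psi> x \<noteq> 0 \<Longrightarrow> norm x \<le> R"
    using \<psi>(2) unfolding bounded_iff by auto
  have uc: "uniformly_continuous_on (cball 0 (R + 1)) \<psi>"
    by (intro compact_uniformly_continuous compact_cball continuous_on_subset[OF \<psi>(1)]) auto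
  show ?thesis
    unfolding uniformly_continuous_on_def
  proof (intro allI impI)
    fix d :: real assume "0 < d"
    then obtain \<delta> where \<delta>: "\<delta> > 0"
      "\<And>x y. x \<in> cball 0 (R + 1) \<Longrightarrow> y \<in> cball 0 (R + 1) \<Longrightarrow> dist y x < \<delta> \<Longrightarrow> dist (\<psi> y) (\<psi> x) < d"
      using uc unfolding uniformly_continuous_on_def by metis
    \<comment> \<open>If one of two points at distance below 1 lies outside the ball of radius
      \<open>R + 1\<close>, then both lie outside the ball of radius \<open>R\<close>, where
      \<open>\<psi>\<close> vanishes; hence the \<open>min \<delta> 1\<close>.\<close>
    have "dist (\<psi> y) (\<psi> x) < d" if "dist y x < min \<delta> 1" for x y
    proof (cases "x \<in> cball 0 (R + 1) \<and> y \<in> cball 0 (R + 1)")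
      case True
      then show ?thesis using \<delta>(2) that by simp
    next
      case False
      have "norm x \<le> norm y + 1" "norm y \<le> norm x + 1"
        using that norm_triangle_ineq2[of x y] norm_triangle_ineq3[of x y] by (auto simp: dist_norm norm_minus_commute)
      then have "\<psi> x = 0" "\<psi> y = 0" using False R[of x] R[of y] by force+
      then show ?thesis using \<open>0 < d\<close> by simp
    qed
    then show "\<exists>\<delta>>0. \<forall>x\<in>UNIV. \<forall>y\<in>UNIV. dist y x < \<delta> \<longrightarrow> dist (\<psi> y) (\<psi> x) < d"
      using \<delta>(1) by (intro exI[of _ "min \<delta> 1"]) auto
  qed
qed

lemma mollify_uniformly_close:
  fixes \<psi> :: "'a::euclidean_space \<Rightarrow> 'b::euclidean_space"
  assumes \<psi>: "continuous_on UNIV \<psi>" "bounded {x. \<psi> x \<noteq> 0}" and "0 < d"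
  obtains e0 where "0 < e0"
    "\<And>e x. 0 < e \<Longrightarrow> e \<le> e0 \<Longrightarrow> norm (mollify (mollifier e) \<psi> x - \<psi> x) \<le> d"
proof -
  obtain e0 where e0: "0 < e0" "\<And>x y. dist y x < e0 \<Longrightarrow> dist (\<psi> y) (\<psi> x) < d"
    using uniformly_continuous_compact_support[OF \<psi>] \<open>0 < d\<close>
    unfolding uniformly_continuous_on_def by (metis UNIV_I)
  show ?thesis
  proof (rule that[OF e0(1)])
    fix e x assume e: "0 < e" "e \<le> e0"
    show "norm (mollify (mollifier e) \<psi> x - \<psi> x) \<le> d"
      by (rule mollify_close[OF e(1) \<psi>])
         (use e e0(2) in \<open>auto simp: dist_norm norm_minus_commute intro!: less_imp_le\<close>)
  qed
qed

section \<open>Test fields and uniqueness of weak gradients\<close>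

lemma integral_lebesgue_on_eq_lborel:
  fixes f :: "'a::euclidean_space \<Rightarrow> 'b::{banach, second_countable_topology}"
  assumes "open V" "f \<in> borel_measurable borel" "\<And>x. x \<notin> V \<Longrightarrow> f x = 0"
  shows "(LINT x|lebesgue_on V. f x) = (LINT x|lborel. f x)"
proof -
  have "(\<lambda>x. indicator V x *\<^sub>R f x) = f"
    using assms(3) by (auto simp: indicator_def fun_eq_iff)
  then show ?thesis
    using assms by (simp add: integral_restrict_space integral_completion)
qed

lemma integral_lebesgue_on_subset:
  fixes f :: "'a::euclidean_space \<Rightarrow> 'b::{banach, second_countable_topology}"
  assumes "open V" "open W" "V \<subseteq> W" "\<And>x. x \<in> W - V \<Longrightarrow> f x = 0"
  shows "(LINT x|lebesgue_on W. f x) = (LINT x|lebesgue_on V. f x)"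
proof -
  have eq: "indicator W x *\<^sub>R f x = indicator V x *\<^sub>R f x" for x
    using assms(3,4) by (auto simp: indicator_def)
  have "(LINT x|lebesgue_on W. f x) = (LINT x|lebesgue. indicator W x *\<^sub>R f x)"
    "(LINT x|lebesgue_on V. f x) = (LINT x|lebesgue. indicator V x *\<^sub>R f x)"
    using assms(1,2) by (simp_all add: integral_restrict_space)
  then show ?thesis by (simp only: eq)
qed

lemma integrable_lebesgue_on_subset:
  fixes f :: "'a::euclidean_space \<Rightarrow> 'b::{banach, second_countable_topology}"
  assumes "integrable (lebesgue_on W) f" "V \<subseteq> W" "V \<in> sets lebesgue" "W \<in> sets lebesgue"
  shows "integrable (lebesgue_on V) f"
proof -
  have "integrable lebesgue (\<lambda>x. indicator W x *\<^sub>R f x)"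
    using assms(1,4) by (simp add: integrable_restrict_space)
  from integrable_mult_indicator[OF assms(3) this]
  have "integrable lebesgue (\<lambda>x. indicator V x *\<^sub>R (indicator W x *\<^sub>R f x))" .
  moreover have "(\<lambda>x. indicator V x *\<^sub>R (indicator W x *\<^sub>R f x)) = (\<lambda>x. indicator V x *\<^sub>R f x)"
    using assms(2) by (auto simp: indicator_def fun_eq_iff)
  ultimately show ?thesis using assms(3) by (simp add: integrable_restrict_space)
qed

lemma borel_measurable_lebesgue_on:
  "f \<in> borel_measurable borel \<Longrightarrow> f \<in> borel_measurable (lebesgue_on V)"
  by (intro measurable_restrict_space1 measurable_completion) simp

lemma AE_lebesgue_on_not_negligible:
  assumes "negligible N" "V \<in> sets lebesgue"
  shows "AE x in lebesgue_on V. x \<notin> N"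
proof -
  have "N \<in> null_sets lebesgue" using assms(1) by (simp add: negligible_iff_null_sets)
  then have "AE x in lebesgue. x \<notin> N" by (rule AE_not_in)
  then show ?thesis
    using assms(2) by (subst AE_restrict_space_iff) auto
qed

lemma integrable_inner_bounded:
  fixes f G :: "'a::euclidean_space \<Rightarrow> 'b::euclidean_space"
  assumes "f \<in> borel_measurable (lebesgue_on V)" "integrable (lebesgue_on V) G"
    and "\<And>x. x \<in> V \<Longrightarrow> norm (f x) \<le> B"
  shows "integrable (lebesgue_on V) (\<lambda>x. f x \<bullet> G x)"
proof (rule Bochner_Integration.integrable_bound)
  show "integrable (lebesgue_on V) (\<lambda>x. B * norm (G x))" using assms(2) by simp
  show "(\<lambda>x. f x \<bullet> G x) \<in> borel_measurable (lebesgue_on V)"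
    using assms by (intro borel_measurable_inner) auto
  have "norm (f x \<bullet> G x) \<le> norm (B * norm (G x))" if "x \<in> V" for x
  proof -
    have "norm (f x \<bullet> G x) \<le> norm (f x) * norm (G x)" by (simp add: Cauchy_Schwarz_ineq2)
    also have "\<dots> \<le> B * norm (G x)" by (rule mult_right_mono) (use assms(3) that in auto)
    finally show ?thesis by simp
  qed
  then show "AE x in lebesgue_on V. norm (f x \<bullet> G x) \<le> norm (B * norm (G x))"
    by (intro AE_I2) simp
qed

lemma cutoff_sequence:
  fixes V :: "'a::euclidean_space set"
  assumes "open V" "bounded V"
  obtains \<kappa> :: "nat \<Rightarrow> 'a \<Rightarrow> real" and K where "\<And>n. continuous_on UNIV (\<kappa> n)"
    "\<And>n x. 0 \<le> \<kappa> n x" "\<And>n x. \<kappa> n x \<le> 1" "\<And>n. compact (K n)" "\<And>n. K n \<subseteq> V"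
    "\<And>n x. x \<notin> K n \<Longrightarrow> \<kappa> n x = 0" "\<And>x. x \<in> V \<Longrightarrow> (\<lambda>n. \<kappa> n x) \<longlonglongrightarrow> 1"
proof -
  \<comment> \<open>\<open>infdist\<close> to the empty set is 0, so the complement must be
    nonempty; boundedness of \<open>V\<close> ensures it.\<close>
  have ne: "- V \<noteq> {}" using assms(2) not_bounded_UNIV by (metis Compl_empty_eq double_complement)
  \<comment> \<open>The \<open>- 1\<close> makes \<open>\<kappa> n\<close> vanish already where the
    distance to the complement is below \<open>1 / n\<close>, so that it is supported in the compact
    \<open>K n\<close>. For \<open>n = 0\<close> this set is empty.\<close>
  define \<kappa> where "\<kappa> = (\<lambda>n x. min 1 (max 0 (real n * infdist x (- V) - 1)))"
  define K where "K = (\<lambda>n. {x. 1 \<le> real n * infdist x (- V)})"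
  show ?thesis
  proof (rule that[of \<kappa> K])
    show "K n \<subseteq> V" for n
    proof
      fix x assume "x \<in> K n"
      then show "x \<in> V" using infdist_zero[of x "- V"] by (cases "x \<in> V") (auto simp: K_def)
    qed
    then show "compact (K n)" for n
      unfolding compact_eq_bounded_closed
      by (auto simp: K_def intro!: closed_Collect_le continuous_intros intro: bounded_subset[OF assms(2)])
    show "(\<lambda>n. \<kappa> n x) \<longlonglongrightarrow> 1" if "x \<in> V" for x
    proof -
      have "0 < infdist x (- V)"
        using that assms(1) ne by (metis ComplD closed_Compl in_closed_iff_infdist_zero infdist_nonneg order_le_less)
      then obtain N where N: "2 < real N * infdist x (- V)" using reals_Archimedean3 by blast
      have "\<kappa> n x = 1" if "N \<le> n" for n
      proof -
        have "real N * infdist x (- V) \<le> real n * infdist x (- V)"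
          using that by (intro mult_right_mono) (auto simp: infdist_nonneg)
        then show ?thesis using N by (simp add: \<kappa>_def)
      qed
      then show ?thesis
        by (intro tendsto_eventually) (auto simp: eventually_sequentially)
    qed
  qed (auto simp: \<kappa>_def K_def intro!: continuous_intros)
qed

text \<open>Test fields approximate the direction field of \<open>G\<close> almost everywhere.\<close>

lemma integral_norm_le_test_functions:
  fixes G :: "'a::euclidean_space \<Rightarrow> 'b::euclidean_space"
  assumes V: "open V" "bounded V" and G: "integrable (lebesgue_on V) G"
    and C: "\<And>\<phi>. \<phi> \<in> test_functions V \<Longrightarrow> (\<And>x. norm (\<phi> x) \<le> 1) \<Longrightarrow> (LINT x|lebesgue_on V. \<phi> x \<bullet> G x) \<le> C"
  shows "(LINT x|lebesgue_on V. norm (G x)) \<le> C"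
proof -
  have VL [simp]: "V \<in> sets lebesgue" using V(1) by simp
  have [measurable]: "G \<in> borel_measurable (lebesgue_on V)" using G by simp
  \<comment> \<open>Since \<open>inverse 0 = 0\<close>, the field is 0 on the zeros of
    \<open>G\<close>, and \<open>s x \<bullet> G x = norm (G x)\<close> holds everywhere.\<close>
  define s where "s = (\<lambda>x. inverse (norm (G x)) *\<^sub>R G x)"
  have "s \<in> borel_measurable (lebesgue_on V)" unfolding s_def by measurable
  then have "s measurable_on V"
    using measurable_on_iff_borel_measurable[OF VL] by blast
  \<comment> \<open>\<open>measurable_on\<close> means being an almost everywhere limit of functions
    continuous on the whole space; these are the raw approximating fields.\<close>
  then obtain N \<psi> where N: "negligible N" and \<psi>: "\<And>n. continuous_on UNIV (\<psi> n)"
    and lim: "\<And>x. x \<notin> N \<Longrightarrow> (\<lambda>n. \<psi> n x) \<longlonglongrightarrow> (if x \<in> V then s x else 0)"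
    unfolding measurable_on_def by blast
  obtain \<kappa> :: "nat \<Rightarrow> 'a \<Rightarrow> real" and K where \<kappa>: "\<And>n. continuous_on UNIV (\<kappa> n)"
    "\<And>n x. 0 \<le> \<kappa> n x" "\<And>n x. \<kappa> n x \<le> 1" and K: "\<And>n. compact (K n)" "\<And>n. K n \<subseteq> V"
    and \<kappa>K: "\<And>n x. x \<notin> K n \<Longrightarrow> \<kappa> n x = 0" and \<kappa>1: "\<And>x. x \<in> V \<Longrightarrow> (\<lambda>n. \<kappa> n x) \<longlonglongrightarrow> 1"
    using cutoff_sequence[OF V] by metis
  \<comment> \<open>Dividing by \<open>max 1\<close> of the norm retracts onto the unit ball. The
    limit is not disturbed, because \<open>s\<close> takes its values there.\<close>
  define \<theta> where "\<theta> = (\<lambda>n x. \<kappa> n x *\<^sub>R inverse (max 1 (norm (\<psi> n x))) *\<^sub>R \<psi> n x)"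
  have \<theta>_cont: "continuous_on UNIV (\<theta> n)" for n
    unfolding \<theta>_def by (intro continuous_intros \<kappa> \<psi>) (auto simp: max_def)
  have \<theta>_le: "norm (\<theta> n x) \<le> 1" for n x
  proof -
    have "norm (inverse (max 1 (norm (\<psi> n x))) *\<^sub>R \<psi> n x) \<le> 1"
      by (auto simp: max_def divide_simps)
    then have "\<kappa> n x * norm (inverse (max 1 (norm (\<psi> n x))) *\<^sub>R \<psi> n x) \<le> 1"
      using \<kappa>(2,3) by (intro mult_le_one) auto
    then show ?thesis unfolding \<theta>_def using \<kappa>(2) by (simp add: abs_of_nonneg mult.assoc)
  qed
  have \<theta>K: "\<theta> n x = 0" if "x \<notin> K n" for n x using \<kappa>K[OF that] by (simp add: \<theta>_def)
  have \<theta>_bd: "bounded {x. \<theta> n x \<noteq> 0}" for n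
    by (rule bounded_subset[OF compact_imp_bounded[OF K(1)[of n]]]) (use \<theta>K in auto)
  \<comment> \<open>One radius per index does both jobs: the mollified field stays supported in
    \<open>V\<close>, and its uniform error tends to 0, so the pointwise limit is unchanged.\<close>
  have "\<exists>e>0. (\<Union>x\<in>K n. cball x e) \<subseteq> V \<and>
      (\<forall>x. norm (mollify (mollifier e) (\<theta> n) x - \<theta> n x) \<le> 1 / real (Suc n))" for n
  proof -
    obtain e1 where e1: "0 < e1" "(\<Union>x\<in>K n. cball x e1) \<subseteq> V"
      using compact_subset_open_imp_cball_epsilon_subset[OF K(1) V(1) K(2)] by metis
    obtain e2 where e2: "0 < e2" "\<And>e x. 0 < e \<Longrightarrow> e \<le> e2 \<Longrightarrow>
        norm (mollify (mollifier e) (\<theta> n) x - \<theta> n x) \<le> 1 / real (Suc n)"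
      using mollify_uniformly_close[OF \<theta>_cont \<theta>_bd, of "1 / real (Suc n)"] by (metis of_nat_0_less_iff zero_less_Suc zero_less_divide_1_iff)
    have "(\<Union>x\<in>K n. cball x (min e1 e2)) \<subseteq> (\<Union>x\<in>K n. cball x e1)" by auto
    then show ?thesis using e1 e2 by (intro exI[of _ "min e1 e2"]) auto
  qed
  then obtain e where e: "\<And>n. 0 < e n" "\<And>n. (\<Union>x\<in>K n. cball x (e n)) \<subseteq> V"
    "\<And>n x. norm (mollify (mollifier (e n)) (\<theta> n) x - \<theta> n x) \<le> 1 / real (Suc n)"
    by metis
  define \<phi> where "\<phi> = (\<lambda>n. mollify (mollifier (e n)) (\<theta> n))"
  have \<phi>: "\<phi> n \<in> test_functions V" for n
    unfolding \<phi>_def by (rule mollify_in_test_functions[OF e(1) \<theta>_cont K(1) \<theta>K e(2)])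
  have \<phi>_le: "norm (\<phi> n x) \<le> 1" for n x
    using mollify_close[OF e(1) \<theta>_cont \<theta>_bd, where a = 0 and d = 1] \<theta>_le by (simp add: \<phi>_def)
  have \<phi>_lim: "(\<lambda>n. \<phi> n x) \<longlonglongrightarrow> s x" if "x \<in> V" "x \<notin> N" for x
  proof -
    have "(\<lambda>n. \<psi> n x) \<longlonglongrightarrow> s x" using lim[OF that(2)] that(1) by simp
    then have "(\<lambda>n. \<theta> n x) \<longlonglongrightarrow> 1 *\<^sub>R inverse (max 1 (norm (s x))) *\<^sub>R s x"
      unfolding \<theta>_def by (intro tendsto_intros \<kappa>1 that) (auto simp: max_def)
    moreover have "norm (s x) \<le> 1" by (cases "G x = 0") (simp_all add: s_def)
    ultimately have "(\<lambda>n. \<theta> n x) \<longlonglongrightarrow> s x" by (simp add: max_absorb1)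
    moreover have "(\<lambda>n. \<phi> n x - \<theta> n x) \<longlonglongrightarrow> 0"
      by (rule Lim_null_comparison[OF _ LIMSEQ_inverse_real_of_nat])
         (use e(3) in \<open>auto simp: \<phi>_def inverse_eq_divide\<close>)
    ultimately have "(\<lambda>n. (\<phi> n x - \<theta> n x) + \<theta> n x) \<longlonglongrightarrow> 0 + s x" by (intro tendsto_add)
    then show ?thesis by simp
  qed
  have "(\<lambda>n. LINT x|lebesgue_on V. \<phi> n x \<bullet> G x) \<longlonglongrightarrow> (LINT x|lebesgue_on V. norm (G x))"
  proof (rule integral_dominated_convergence)
    show "(\<lambda>x. norm (G x)) \<in> borel_measurable (lebesgue_on V)" by measurable
    show "integrable (lebesgue_on V) (\<lambda>x. norm (G x))" using G by simp
    show "(\<lambda>x. \<phi> n x \<bullet> G x) \<in> borel_measurable (lebesgue_on V)" for n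
      using borel_measurable_lebesgue_on[OF borel_measurable_continuous_onI[OF smooth_continuous[OF test_function_smooth[OF \<phi>]]]]
      by (intro borel_measurable_inner) auto
    have pw: "(\<lambda>n. \<phi> n x \<bullet> G x) \<longlonglongrightarrow> norm (G x)" if "x \<in> V" "x \<notin> N" for x
    proof -
      have "s x \<bullet> G x = norm (G x)"
        by (cases "G x = 0") (auto simp: s_def dot_square_norm power2_eq_square)
      then show ?thesis using tendsto_inner[OF \<phi>_lim[OF that] tendsto_const[of "G x"]] by simp
    qed
    show "AE x in lebesgue_on V. (\<lambda>n. \<phi> n x \<bullet> G x) \<longlonglongrightarrow> norm (G x)"
      using AE_lebesgue_on_not_negligible[OF N VL] AE_space by eventually_elim (simp add: pw)
    have "norm (\<phi> n x \<bullet> G x) \<le> norm (G x)" for n x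
      using Cauchy_Schwarz_ineq2[of "\<phi> n x" "G x"] \<phi>_le[of n x] mult_right_mono[OF \<phi>_le[of n x] norm_ge_zero[of "G x"]]
      by simp
    then show "AE x in lebesgue_on V. norm (\<phi> n x \<bullet> G x) \<le> norm (G x)" for n by simp
  qed
  then show ?thesis
    by (rule LIMSEQ_le_const2) (use C[OF \<phi> \<phi>_le] in auto)
qed

lemma continuous_bounded_support_bounded:
  fixes f :: "'a::euclidean_space \<Rightarrow> 'b::real_normed_vector"
  assumes "continuous_on UNIV f" "bounded {x. f x \<noteq> 0}"
  obtains B where "\<And>x. norm (f x) \<le> B"
proof -
  have "compact (f ` closure {x. f x \<noteq> 0})"
    using assms by (intro compact_continuous_image) (auto intro: continuous_on_subset simp: compact_closure)
  then have "\<exists>B. \<forall>y\<in>f ` closure {x. f x \<noteq> 0}. norm y \<le> B"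
    by (intro bounded_iff[THEN iffD1] compact_imp_bounded)
  then obtain B where B: "\<And>y. y \<in> f ` closure {x. f x \<noteq> 0} \<Longrightarrow> norm y \<le> B"
    by blast
  have "norm (f x) \<le> max B 0" for x
    using B[of "f x"] closure_subset[of "{x. f x \<noteq> 0}"] by (cases "f x = 0") auto
  then show ?thesis by (rule that)
qed

lemma gradient_bounded_support:
  assumes "\<phi> \<in> test_functions V"
  shows "bounded {x. gradient \<phi> x \<noteq> 0}"
  by (rule bounded_subset[OF compact_imp_bounded[OF test_function_compact_support[OF assms]]])
     (use gradient_zero[OF assms] in auto)

lemma divergence_bounded_support:
  assumes "\<phi> \<in> test_functions V"
  shows "bounded {x. divergence \<phi> x \<noteq> 0}"
  by (rule bounded_subset[OF compact_imp_bounded[OF test_function_compact_support[OF assms]]])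
     (use divergence_zero[OF assms] in auto)

lemma integrable_continuous_scaleR:
  fixes f :: "'a::euclidean_space \<Rightarrow> real" and G :: "'a \<Rightarrow> 'b::euclidean_space"
  assumes "continuous_on UNIV f" "bounded {x. f x \<noteq> 0}" "integrable (lebesgue_on V) G"
  shows "integrable (lebesgue_on V) (\<lambda>x. f x *\<^sub>R G x)"
proof -
  obtain B where B: "\<And>x. norm (f x) \<le> B"
    using continuous_bounded_support_bounded[OF assms(1,2)] by metis
  then have "0 \<le> B" using norm_ge_zero order_trans by blast
  show ?thesis
  proof (rule Bochner_Integration.integrable_bound)
    show "integrable (lebesgue_on V) (\<lambda>x. B * norm (G x))" using assms(3) by simp
    show "(\<lambda>x. f x *\<^sub>R G x) \<in> borel_measurable (lebesgue_on V)"
      using assms(3) borel_measurable_lebesgue_on[OF borel_measurable_continuous_onI[OF assms(1)]]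
      by (intro borel_measurable_scaleR) auto
    have "norm (f x *\<^sub>R G x) \<le> norm (B * norm (G x))" for x
      using mult_right_mono[OF B[of x] norm_ge_zero[of "G x"]] \<open>0 \<le> B\<close>
      by (simp add: abs_mult)
    then show "AE x in lebesgue_on V. norm (f x *\<^sub>R G x) \<le> norm (B * norm (G x))" by simp
  qed
qed

lemma integrable_scaleR_continuous:
  fixes f :: "'a::euclidean_space \<Rightarrow> 'b::euclidean_space" and G :: "'a \<Rightarrow> real"
  assumes "continuous_on UNIV f" "bounded {x. f x \<noteq> 0}" "integrable (lebesgue_on V) G"
  shows "integrable (lebesgue_on V) (\<lambda>x. G x *\<^sub>R f x)"
proof -
  obtain B where B: "\<And>x. norm (f x) \<le> B"
    using continuous_bounded_support_bounded[OF assms(1,2)] by metis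
  then have "0 \<le> B" using norm_ge_zero order_trans by blast
  show ?thesis
  proof (rule Bochner_Integration.integrable_bound)
    show "integrable (lebesgue_on V) (\<lambda>x. B * norm (G x))" using assms(3) by simp
    show "(\<lambda>x. G x *\<^sub>R f x) \<in> borel_measurable (lebesgue_on V)"
      using assms(3) borel_measurable_lebesgue_on[OF borel_measurable_continuous_onI[OF assms(1)]]
      by (intro borel_measurable_scaleR) auto
    have "norm (G x *\<^sub>R f x) \<le> norm (B * norm (G x))" for x
      using mult_right_mono[OF B[of x] norm_ge_zero[of "G x"]] \<open>0 \<le> B\<close>
      by (simp add: abs_mult mult.commute)
    then show "AE x in lebesgue_on V. norm (G x *\<^sub>R f x) \<le> norm (B * norm (G x))" by simp
  qed
qed

text \<open>\<open>has_weak_gradient\<close> tests with scalar functions,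
  \<open>total_variation\<close> with vector fields. Each component of \<open>\<phi>\<close> is a
  scalar test function, and of its vector identity only the matching coordinate is kept. Passing
  from \<open>\<Omega>\<close> to \<open>V\<close> is free since all integrands vanish off
  \<open>V\<close>.\<close>

lemma weak_gradient_test_field:
  assumes V: "open V" "open \<Omega>" "V \<subseteq> \<Omega>" and w: "has_weak_gradient \<Omega> f g"
    and f: "integrable (lebesgue_on V) f" and g: "integrable (lebesgue_on V) g"
    and \<phi>: "\<phi> \<in> test_functions V"
  shows "(LINT x|lebesgue_on V. f x * divergence \<phi> x) = - (LINT x|lebesgue_on V. \<phi> x \<bullet> g x)"
proof -
  define c where "c = (\<lambda>b x. \<phi> x \<bullet> b)"
  have c: "c b \<in> test_functions V" for b
    unfolding c_def by (rule test_function_component[OF \<phi>])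
  have i1: "integrable (lebesgue_on V) (\<lambda>x. f x *\<^sub>R gradient (c b) x)" for b
    by (rule integrable_scaleR_continuous[OF continuous_on_gradient[OF c] gradient_bounded_support[OF c] f])
  have i2: "integrable (lebesgue_on V) (\<lambda>x. c b x *\<^sub>R g x)" for b
    by (rule integrable_continuous_scaleR[OF smooth_continuous[OF test_function_smooth[OF c]]
        test_function_bounded_support[OF c] g])
  have eq: "(LINT x|lebesgue_on V. f x *\<^sub>R gradient (c b) x) = - (LINT x|lebesgue_on V. c b x *\<^sub>R g x)" for b
  proof -
    have "gradient (c b) x = 0" if "x \<in> \<Omega> - V" for x
      using gradient_zero[OF c] test_function_closure_support[OF c] that by blast
    then have "(LINT x|lebesgue_on \<Omega>. f x *\<^sub>R gradient (c b) x) = (LINT x|lebesgue_on V. f x *\<^sub>R gradient (c b) x)"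
      by (intro integral_lebesgue_on_subset V) auto
    moreover have "(LINT x|lebesgue_on \<Omega>. c b x *\<^sub>R g x) = (LINT x|lebesgue_on V. c b x *\<^sub>R g x)"
      using test_function_zero[OF c] by (intro integral_lebesgue_on_subset V) auto
    moreover have "c b \<in> test_functions \<Omega>" using c test_functions_mono[OF V(3)] by blast
    ultimately show ?thesis using w unfolding has_weak_gradient_def by metis
  qed
  have "(LINT x|lebesgue_on V. f x * divergence \<phi> x)
      = (LINT x|lebesgue_on V. (\<Sum>b\<in>Basis. (f x *\<^sub>R gradient (c b) x) \<bullet> b))"
    by (simp add: divergence_eq_gradient[OF test_function_smooth[OF \<phi>]] c_def sum_distrib_left)
  also have "\<dots> = (\<Sum>b\<in>Basis. (LINT x|lebesgue_on V. (f x *\<^sub>R gradient (c b) x)) \<bullet> b)"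
    by (subst Bochner_Integration.integral_sum)
       (auto intro!: sum.cong integrable_inner_left i1 simp del: inner_scaleR_left simp: i1)
  also have "\<dots> = - (\<Sum>b\<in>Basis. (LINT x|lebesgue_on V. (c b x *\<^sub>R g x)) \<bullet> b)"
    by (simp add: eq sum_negf)
  also have "(\<Sum>b\<in>Basis. (LINT x|lebesgue_on V. (c b x *\<^sub>R g x)) \<bullet> b)
      = (LINT x|lebesgue_on V. (\<Sum>b\<in>Basis. (c b x *\<^sub>R g x) \<bullet> b))"
    by (subst Bochner_Integration.integral_sum)
       (auto intro!: sum.cong integrable_inner_left i2 simp del: inner_scaleR_left simp: i2)
  also have "(\<lambda>x. \<Sum>b\<in>Basis. (c b x *\<^sub>R g x) \<bullet> b) = (\<lambda>x. \<phi> x \<bullet> g x)"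
    unfolding c_def by (simp add: euclidean_inner[of "\<phi> _" "g _"])
  finally show ?thesis .
qed

text \<open>Frees later statements from the \<open>SOME\<close> choice in
  \<open>weak_gradient\<close>. Locally, the difference of two gradients pairs to 0 with every test
  field, and \<open>integral_norm_le_test_functions\<close> with bound 0 makes it vanish almost
  everywhere.\<close>

lemma weak_gradient_unique:
  assumes \<Omega>: "open \<Omega>" "bounded \<Omega>" and g1: "has_weak_gradient \<Omega> f g1" and g2: "has_weak_gradient \<Omega> f g2"
  shows "AE x in lebesgue_on \<Omega>. g1 x = g2 x"
proof -
  have ne: "- \<Omega> \<noteq> {}" using \<Omega>(2) not_bounded_UNIV by (metis Compl_empty_eq double_complement)
  \<comment> \<open>Local integrability concerns compact sets while test fields live on open ones,
    so \<open>\<Omega>\<close> is exhausted by open \<open>V n\<close> contained in compact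
    \<open>K n\<close>.\<close>
  define V where "V = (\<lambda>n. {x. 1 / real (Suc n) < infdist x (- \<Omega>)})"
  define K where "K = (\<lambda>n. {x. 1 / real (Suc n) \<le> infdist x (- \<Omega>)})"
  have V: "open (V n)" for n unfolding V_def by (intro open_Collect_less continuous_intros)
  have VK: "V n \<subseteq> K n" for n by (auto simp: V_def K_def)
  have K\<Omega>: "K n \<subseteq> \<Omega>" for n
  proof
    fix x assume "x \<in> K n"
    then show "x \<in> \<Omega>" using infdist_zero[of x "- \<Omega>"] by (cases "x \<in> \<Omega>") (auto simp: K_def divide_simps)
  qed
  have cK: "compact (K n)" for n
    using K\<Omega> bounded_subset[OF \<Omega>(2)] unfolding compact_eq_bounded_closed
    by (auto simp: K_def intro!: closed_Collect_le continuous_intros)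
  have cover: "\<exists>n. x \<in> V n" if "x \<in> \<Omega>" for x
  proof -
    have "0 < infdist x (- \<Omega>)"
      using that \<Omega>(1) ne by (metis ComplD closed_Compl in_closed_iff_infdist_zero infdist_nonneg order_le_less)
    then show ?thesis unfolding V_def using nat_approx_posE by auto
  qed
  have int: "integrable (lebesgue_on (V n)) f" "integrable (lebesgue_on (V n)) g1" "integrable (lebesgue_on (V n)) g2" for n
  proof -
    have "integrable (lebesgue_on (K n)) f" "integrable (lebesgue_on (K n)) g1" "integrable (lebesgue_on (K n)) g2"
      using g1 g2 K\<Omega>[of n] cK[of n] by (simp_all add: has_weak_gradient_def locally_integrable_def)
    moreover have "V n \<in> sets lebesgue" "K n \<in> sets lebesgue"
      using V cK by (simp_all add: borel_compact)
    ultimately show "integrable (lebesgue_on (V n)) f" "integrable (lebesgue_on (V n)) g1"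
      "integrable (lebesgue_on (V n)) g2"
      using integrable_lebesgue_on_subset[OF _ VK] by blast+
  qed
  have ae: "AE x in lebesgue_on (V n). g1 x - g2 x = 0" for n
  proof -
    let ?G = "\<lambda>x. g1 x - g2 x"
    have "(LINT x|lebesgue_on (V n). norm (?G x)) \<le> 0"
    proof (rule integral_norm_le_test_functions[OF V])
      show "bounded (V n)" using VK K\<Omega> bounded_subset[OF \<Omega>(2)] by blast
      show "integrable (lebesgue_on (V n)) ?G" using int by simp
      fix \<phi> :: "'a \<Rightarrow> 'a" assume \<phi>: "\<phi> \<in> test_functions (V n)" and le: "\<And>x. norm (\<phi> x) \<le> 1"
      have "integrable (lebesgue_on (V n)) (\<lambda>x. \<phi> x \<bullet> g1 x)" "integrable (lebesgue_on (V n)) (\<lambda>x. \<phi> x \<bullet> g2 x)"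
        using borel_measurable_lebesgue_on[OF borel_measurable_continuous_onI[OF smooth_continuous[OF test_function_smooth[OF \<phi>]]]] le
        by (intro integrable_inner_bounded[where B = 1] int; simp)+
      moreover have "(LINT x|lebesgue_on (V n). \<phi> x \<bullet> g1 x) = (LINT x|lebesgue_on (V n). \<phi> x \<bullet> g2 x)"
        using weak_gradient_test_field[OF V \<Omega>(1) order_trans[OF VK K\<Omega>] g1 int(1,2) \<phi>]
          weak_gradient_test_field[OF V \<Omega>(1) order_trans[OF VK K\<Omega>] g2 int(1,3) \<phi>] by simp
      ultimately show "(LINT x|lebesgue_on (V n). \<phi> x \<bullet> ?G x) \<le> 0"
        by (simp add: inner_diff_right)
    qed
    then have "(LINT x|lebesgue_on (V n). norm (?G x)) = 0"
      by (intro antisym integral_nonneg_AE) auto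
    then have "AE x in lebesgue_on (V n). norm (?G x) = 0"
      using int by (subst (asm) integral_nonneg_eq_0_iff_AE) auto
    then show ?thesis by simp
  qed
  have "AE x in lebesgue. x \<in> V n \<longrightarrow> g1 x - g2 x = 0" for n
    using ae[of n] V[of n] by (subst (asm) AE_restrict_space_iff) auto
  then have "AE x in lebesgue. \<forall>n. x \<in> V n \<longrightarrow> g1 x - g2 x = 0"
    unfolding AE_all_countable by blast
  then have "AE x in lebesgue. x \<in> \<Omega> \<longrightarrow> g1 x = g2 x"
    by eventually_elim (use cover in fastforce)
  then show ?thesis
    using \<Omega>(1) by (subst AE_restrict_space_iff) auto
qed

section \<open>The chain rule for weak gradients\<close>

lemma integrable_continuous_bounded_support:
  fixes f :: "'a::euclidean_space \<Rightarrow> 'b::euclidean_space"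
  assumes "continuous_on UNIV f" "bounded {x. f x \<noteq> 0}"
  shows "integrable lborel f"
proof -
  obtain a b where "\<And>x. x \<notin> cbox a b \<Longrightarrow> f x = 0"
    using compact_support_cbox[OF assms(2)] by metis
  then show ?thesis by (rule integrable_continuous_support[OF assms(1)])
qed

text \<open>For each basis vector \<open>b\<close> the derivative of
  \<open>\<eta> (W x) * (\<phi> x \<bullet> b)\<close> along \<open>b\<close> integrates to 0, and
  the product rule splits it into the two sides.\<close>

lemma integral_chain_rule_smooth:
  fixes W :: "'a::euclidean_space \<Rightarrow> real"
  assumes W: "smooth W" and \<phi>: "\<phi> \<in> test_functions V"
    and \<eta>: "\<And>s. (\<eta> has_real_derivative \<eta>' s) (at s)" and \<eta>': "continuous_on UNIV \<eta>'"
  shows "(LINT x|lborel. \<eta> (W x) * divergence \<phi> x)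
    = - (LINT x|lborel. (\<Sum>b\<in>Basis. (\<eta>' (W x) *\<^sub>R \<phi> x) \<bullet> b * frechet_derivative W (at x) b))"
proof -
  have \<eta>c: "continuous_on UNIV \<eta>"
    using \<eta> by (auto simp: continuous_on_eq_continuous_at intro: DERIV_isCont)
  have sm: "smooth \<phi>" and bd: "bounded {x. \<phi> x \<noteq> 0}"
    using \<phi> by (auto intro: test_function_smooth test_function_bounded_support)
  have DW: "continuous_on UNIV (\<lambda>x. frechet_derivative W (at x) b)" if "b \<in> Basis" for b
    by (rule smooth_continuous[OF smooth_frechet_derivative[OF W that]])
  have D\<phi>: "continuous_on UNIV (\<lambda>x. frechet_derivative \<phi> (at x) b)" if "b \<in> Basis" for b
    by (rule smooth_continuous[OF smooth_frechet_derivative[OF sm that]])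
  note [continuous_intros] = continuous_on_compose2[OF \<eta>c] continuous_on_compose2[OF \<eta>']
    DW D\<phi> smooth_continuous[OF W] smooth_continuous[OF sm]
  have bd1: "bounded {x. h x * (frechet_derivative \<phi> (at x) b \<bullet> b) \<noteq> 0}" for h and b :: 'a
    by (rule bounded_subset[OF compact_imp_bounded[OF test_function_compact_support[OF \<phi>]]])
       (use frechet_derivative_zero_outside_support[of _ \<phi>] in fastforce)
  have bd2: "bounded {x. (h x *\<^sub>R \<phi> x) \<bullet> b * k x \<noteq> 0}" for h b k
    by (rule bounded_subset[OF bd]) auto
  have i1: "integrable lborel (\<lambda>x. \<eta> (W x) * (frechet_derivative \<phi> (at x) b \<bullet> b))" if "b \<in> Basis" for b
    by (rule integrable_continuous_bounded_support[OF _ bd1]) (intro continuous_intros that; simp)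
  have i2: "integrable lborel (\<lambda>x. (\<eta>' (W x) *\<^sub>R \<phi> x) \<bullet> b * frechet_derivative W (at x) b)" if "b \<in> Basis" for b
    by (rule integrable_continuous_bounded_support[OF _ bd2]) (intro continuous_intros that; simp)
  have "(LINT x|lborel. \<eta> (W x) * (frechet_derivative \<phi> (at x) b \<bullet> b))
      + (LINT x|lborel. (\<eta>' (W x) *\<^sub>R \<phi> x) \<bullet> b * frechet_derivative W (at x) b) = 0" if b: "b \<in> Basis" for b
  proof -
    define F' where "F' = (\<lambda>x h. \<eta> (W x) * (frechet_derivative \<phi> (at x) h \<bullet> b)
      + (frechet_derivative W (at x) h * \<eta>' (W x)) * (\<phi> x \<bullet> b))"
    have F'b: "F' x b = \<eta> (W x) * (frechet_derivative \<phi> (at x) b \<bullet> b)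
        + (\<eta>' (W x) *\<^sub>R \<phi> x) \<bullet> b * frechet_derivative W (at x) b" for x
      by (simp add: F'_def)
    have "(LINT x|lborel. F' x b) = 0"
    proof (rule integral_directional_derivative_zero[where F = "\<lambda>x. \<eta> (W x) * (\<phi> x \<bullet> b)"])
      show "((\<lambda>x. \<eta> (W x) * (\<phi> x \<bullet> b)) has_derivative F' x) (at x)" for x
        unfolding F'_def
        by (intro has_derivative_mult DERIV_compose_FDERIV[OF \<eta>] has_derivative_inner_left
            smooth_has_derivative sm W)
      show "continuous_on UNIV (\<lambda>x. F' x b)"
        unfolding F'b by (intro continuous_intros b; simp)
      show "bounded {x. \<eta> (W x) * (\<phi> x \<bullet> b) \<noteq> 0}"
        by (rule bounded_subset[OF bd]) auto
    qed
    then show ?thesis unfolding F'b using i1[OF b] i2[OF b] by simp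
  qed
  then have "(\<Sum>b\<in>Basis. LINT x|lborel. \<eta> (W x) * (frechet_derivative \<phi> (at x) b \<bullet> b))
      = (\<Sum>b\<in>Basis. - (LINT x|lborel. (\<eta>' (W x) *\<^sub>R \<phi> x) \<bullet> b * frechet_derivative W (at x) b))"
    by (intro sum.cong) (auto simp: add_eq_0_iff)
  then show ?thesis
    unfolding divergence_def sum_distrib_left
    by (simp add: Bochner_Integration.integral_sum i1 i2 sum_negf del: inner_scaleR_left)
qed

text \<open>The mollifier is even, so its derivatives are odd; this is the source of the sign in
  \<open>mollify_adjoint\<close>.\<close>

lemma frechet_derivative_mollifier_minus:
  "frechet_derivative (mollifier e) (at (- x)) b = - frechet_derivative (mollifier e) (at x) b"
proof -
  have "((\<lambda>x. mollifier e (- x)) has_derivative (\<lambda>h. frechet_derivative (mollifier e) (at (- x)) (- h))) (at x)"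
    by (rule has_derivative_compose[OF _ smooth_has_derivative[OF smooth_mollifier]])
       (auto intro!: derivative_eq_intros)
  then have "(mollifier e has_derivative (\<lambda>h. frechet_derivative (mollifier e) (at (- x)) (- h))) (at x)"
    by (simp add: mollifier_minus)
  then have "frechet_derivative (mollifier e) (at x) b = frechet_derivative (mollifier e) (at (- x)) (- b)"
    by (metis frechet_derivative_at)
  also have "\<dots> = - frechet_derivative (mollifier e) (at (- x)) b"
    by (rule linear_neg[OF bounded_linear.linear[OF has_derivative_bounded_linear[OF smooth_has_derivative[OF smooth_mollifier]]]])
  finally show ?thesis by simp
qed

text \<open>Swapping the two integrals of the kernel \<open>H\<close> moves mollification and
  derivative from \<open>w\<close> to \<open>\<theta>\<close>. It is an integration by parts in
  which neither \<open>w\<close> nor \<open>\<theta>\<close> is differentiated, only the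
  mollifier.\<close>

lemma mollify_adjoint:
  fixes w :: "'a::euclidean_space \<Rightarrow> real" and \<theta> :: "'a \<Rightarrow> 'a"
  assumes w: "continuous_on UNIV w" "bounded {x. w x \<noteq> 0}"
    and \<theta>: "continuous_on UNIV \<theta>" "bounded {x. \<theta> x \<noteq> 0}"
  shows "(LINT x|lborel. (\<Sum>b\<in>Basis. \<theta> x \<bullet> b * frechet_derivative (mollify (mollifier e) w) (at x) b))
    = - (LINT y|lborel. w y * divergence (mollify (mollifier e) \<theta>) y)"
proof -
  define D where "D = (\<lambda>b x. frechet_derivative (mollifier e) (at (x::'a)) b)"
  have smD: "smooth (D b)" if "b \<in> Basis" for b
    unfolding D_def by (rule smooth_frechet_derivative[OF smooth_mollifier that])
  note [continuous_intros] = continuous_on_compose2[OF smooth_continuous[OF smD]]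
    continuous_on_compose2[OF w(1)] continuous_on_compose2[OF \<theta>(1)]
  obtain l u where lu: "\<And>x. x \<notin> cbox l u \<Longrightarrow> w x = 0"
    using compact_support_cbox[OF w(2)] by metis
  obtain l' u' where lu': "\<And>x. x \<notin> cbox l' u' \<Longrightarrow> \<theta> x = 0"
    using compact_support_cbox[OF \<theta>(2)] by metis
  define H where "H = (\<lambda>b x y. (\<theta> x \<bullet> b) * (D b (x - y) * w y))"
  have intH: "integrable (lborel \<Otimes>\<^sub>M lborel) (\<lambda>(x, y). H b x y)" if b: "b \<in> Basis" for b
    unfolding lborel_prod
  proof (rule integrable_continuous_support[where a = "(l', l)" and b = "(u', u)"])
    show "continuous_on UNIV (\<lambda>(x, y). H b x y)"
      unfolding H_def split_beta by (intro continuous_intros b; simp)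
    show "(case z of (x, y) \<Rightarrow> H b x y) = 0" if "z \<notin> cbox (l', l) (u', u)" for z
      using that lu lu' by (cases z) (auto simp: H_def cbox_Pair_eq)
  qed
  have inner: "(LINT y|lborel. H b x y) = \<theta> x \<bullet> b * mollify (D b) w x" for b x
    by (simp add: H_def mollify_def)
  have inner': "(LINT x|lborel. H b x y) = - (w y * (mollify (D b) \<theta> y \<bullet> b))" if b: "b \<in> Basis" for b y
  proof -
    have "D b (x - y) = - D b (y - x)" for x
      using frechet_derivative_mollifier_minus[of e "y - x" b] by (simp add: D_def)
    then have "(LINT x|lborel. H b x y) = (LINT x|lborel. - (w y * ((D b (y - x) *\<^sub>R \<theta> x) \<bullet> b)))"
      by (simp add: H_def mult_ac)
    moreover have "integrable lborel (\<lambda>x. D b (y - x) *\<^sub>R \<theta> x)"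
      by (rule integrable_continuous_bounded_support, (intro continuous_intros b; simp))
         (rule bounded_subset[OF \<theta>(2)], auto)
    ultimately show ?thesis by (simp add: mollify_def del: inner_scaleR_left)
  qed
  have iL: "integrable lborel (\<lambda>x. \<theta> x \<bullet> b * mollify (D b) w x)" if b: "b \<in> Basis" for b
    using lborel_pair.integrable_fst[OF intH[OF b]] by (simp add: inner)
  have iR: "integrable lborel (\<lambda>y. w y * (mollify (D b) \<theta> y \<bullet> b))" if b: "b \<in> Basis" for b
    using lborel_pair.integrable_snd[OF intH[OF b]] by (simp add: inner'[OF b])
  have "(LINT x|lborel. (\<Sum>b\<in>Basis. \<theta> x \<bullet> b * frechet_derivative (mollify (mollifier e) w) (at x) b))
      = (LINT x|lborel. (\<Sum>b\<in>Basis. \<theta> x \<bullet> b * mollify (D b) w x))"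
    by (simp add: frechet_derivative_mollify[OF smooth_mollifier w] D_def)
  also have "\<dots> = (\<Sum>b\<in>Basis. LINT x|lborel. \<theta> x \<bullet> b * mollify (D b) w x)"
    by (rule Bochner_Integration.integral_sum[OF iL])
  also have "\<dots> = (\<Sum>b\<in>Basis. LINT x|lborel. (LINT y|lborel. H b x y))"
    by (simp add: inner)
  also have "\<dots> = (\<Sum>b\<in>Basis. LINT y|lborel. (LINT x|lborel. H b x y))"
    by (rule sum.cong) (auto simp: lborel_pair.Fubini_integral[OF intH])
  also have "\<dots> = - (\<Sum>b\<in>Basis. LINT y|lborel. w y * (mollify (D b) \<theta> y \<bullet> b))"
    by (simp add: inner' sum_negf)
  also have "(\<Sum>b\<in>Basis. LINT y|lborel. w y * (mollify (D b) \<theta> y \<bullet> b))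
      = (LINT y|lborel. (\<Sum>b\<in>Basis. w y * (mollify (D b) \<theta> y \<bullet> b)))"
    by (rule Bochner_Integration.integral_sum[OF iR, symmetric])
  also have "\<dots> = (LINT y|lborel. w y * divergence (mollify (mollifier e) \<theta>) y)"
    unfolding divergence_def sum_distrib_left
    by (simp add: frechet_derivative_mollify[OF smooth_mollifier \<theta>] D_def)
  finally show ?thesis .
qed

text \<open>
  For a continuous cutoff \<open>w\<close> of \<open>u\<close> with mollification \<open>w\<^sub>e\<close>, the classical chain rule produces the
  field \<open>\<eta>'(w\<^sub>e) \<phi>\<close>, which is only continuous. Moving the mollification from \<open>w\<close> to this field turns it
  into a test field for the weak gradient of \<open>u\<close>, and all factors then converge uniformly.
\<close>

lemma weak_chain_rule:
  fixes u :: "'a::euclidean_space \<Rightarrow> real" and g :: "'a \<Rightarrow> 'a"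
  assumes V: "open V" and u: "continuous_on V u" and g: "integrable (lebesgue_on V) g"
    and ibp: "\<And>\<phi>. \<phi> \<in> test_functions V \<Longrightarrow>
      (LINT x|lebesgue_on V. u x * divergence \<phi> x) = - (LINT x|lebesgue_on V. \<phi> x \<bullet> g x)"
    and \<eta>: "\<And>s. (\<eta> has_real_derivative \<eta>' s) (at s)" and \<eta>': "continuous_on UNIV \<eta>'"
    and \<phi>: "\<phi> \<in> test_functions V"
  shows "(LINT x|lebesgue_on V. \<eta> (u x) * divergence \<phi> x)
    = - (LINT x|lebesgue_on V. \<eta>' (u x) * (\<phi> x \<bullet> g x))"
proof -
  have \<eta>c: "continuous_on UNIV \<eta>"
    using \<eta> by (auto simp: continuous_on_eq_continuous_at intro: DERIV_isCont)
  define K where "K = closure {x. \<phi> x \<noteq> 0}"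
  have K: "compact K" "K \<subseteq> V"
    using test_function_compact_support[OF \<phi>] test_function_closure_support[OF \<phi>] by (auto simp: K_def)
  have sm: "smooth \<phi>" and bd: "bounded {x. \<phi> x \<noteq> 0}"
    using \<phi> by (auto intro: test_function_smooth test_function_bounded_support)
  have \<phi>K: "\<phi> x = 0" if "x \<notin> K" for x
    using that closure_subset[of "{x. \<phi> x \<noteq> 0}"] by (auto simp: K_def)
  obtain r where r: "0 < r" "(\<Union>x\<in>K. cball x r) \<subseteq> V"
    using compact_subset_open_imp_cball_epsilon_subset[OF K(1) V K(2)] by metis
  \<comment> \<open>Two neighbourhoods of the support: the compact \<open>K'\<close>, from which
    \<open>u\<close> can be extended continuously, and inside it the open \<open>V'\<close>, which
    will contain the supports of the mollified fields.\<close>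
  define V' where "V' = (\<Union>x\<in>K. ball x r)"
  define K' where "K' = (\<Union>x\<in>K. \<Union>y\<in>cball 0 r. {x + y})"
  have "compact K'" unfolding K'_def by (intro compact_sums' K compact_cball)
  have V': "open V'" "V' \<subseteq> V" unfolding V'_def
    by (simp add: open_UN, rule order_trans[OF UN_mono[OF order_refl ball_subset_cball] r(2)])
  have "V' \<subseteq> K'"
  proof
    fix z assume "z \<in> V'"
    then obtain x where "x \<in> K" "dist x z < r" by (auto simp: V'_def)
    then have "z - x \<in> cball 0 r" "z = x + (z - x)" by (auto simp: dist_norm norm_minus_commute)
    then show "z \<in> K'" unfolding K'_def using \<open>x \<in> K\<close> by blast
  qed
  have "K' \<subseteq> V"
  proof
    fix z assume "z \<in> K'"
    then obtain x y where "x \<in> K" "norm y \<le> r" "z = x + y" by (auto simp: K'_def)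
    then have "z \<in> cball x r" by (simp add: dist_norm)
    then show "z \<in> V" using r(2) \<open>x \<in> K\<close> by blast
  qed
  have KV': "K \<subseteq> V'" using r(1) by (auto simp: V'_def)
  obtain h :: "'a \<Rightarrow> real" where h: "continuous_on UNIV h" "\<And>x. x \<in> K' \<Longrightarrow> h x = u x"
  proof (rule Tietze_unbounded[of K' u UNIV])
    show "continuous_on K' u" using u \<open>K' \<subseteq> V\<close> continuous_on_subset by blast
    show "closedin (top_of_set UNIV) K'" using \<open>compact K'\<close> by (simp add: compact_imp_closed)
  qed auto
  obtain R where R: "\<And>x. x \<in> K' \<Longrightarrow> norm x \<le> R"
    using compact_imp_bounded[OF \<open>compact K'\<close>] unfolding bounded_iff by auto
  \<comment> \<open>The first factor is 1 on \<open>K'\<close> and 0 outside the ball of radius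
    \<open>R + 1\<close>, so \<open>w\<close> has bounded support and still agrees with
    \<open>u\<close> on \<open>V'\<close>.\<close>
  define w where "w = (\<lambda>x. max 0 (min 1 (R + 1 - norm x)) * h x)"
  have w: "continuous_on UNIV w" unfolding w_def by (intro continuous_intros h)
  have wbd: "bounded {x. w x \<noteq> 0}"
    by (rule bounded_subset[OF bounded_cball[of 0 "R + 1"]]) (auto simp: w_def)
  have wu: "w x = u x" if "x \<in> V'" for x
    using that h(2)[of x] R[of x] \<open>V' \<subseteq> K'\<close> by (auto simp: w_def)
  obtain M where M: "\<And>x. norm (w x) \<le> M"
    using continuous_bounded_support_bounded[OF w wbd] by metis
  have cM: "compact {-M..M}" by simp
  have "bounded (\<eta> ` {-M..M})" "bounded (\<eta>' ` {-M..M})"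
    by (intro compact_imp_bounded compact_continuous_image cM continuous_on_subset[OF \<eta>c] continuous_on_subset[OF \<eta>'] subset_UNIV)+
  then obtain B B' where "\<forall>y\<in>\<eta> ` {-M..M}. norm y \<le> B" "\<forall>y\<in>\<eta>' ` {-M..M}. norm y \<le> B'"
    unfolding bounded_iff by metis
  then have B: "\<bar>\<eta> s\<bar> \<le> B" and B': "\<bar>\<eta>' s\<bar> \<le> B'" if "\<bar>s\<bar> \<le> M" for s
    using that by (simp_all add: abs_le_iff)
  obtain C where C: "\<And>x. norm (\<phi> x) \<le> C"
    using continuous_bounded_support_bounded[OF smooth_continuous[OF sm] bd] by metis
  have "0 \<le> C" using C norm_ge_zero order_trans by blast
  have "0 \<le> B'" using B'[of "w undefined"] M[of undefined] by auto
  \<comment> \<open>\<open>Suc (Suc n)\<close> makes every radius at most \<open>r / 2\<close>,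
    hence strictly below \<open>r\<close> already for \<open>n = 0\<close>.\<close>
  define e where "e = (\<lambda>n. r * inverse (real (Suc (Suc n))))"
  have e: "0 < e n" "e n < r" for n
    using r(1) by (auto simp: e_def divide_simps)
  have e0: "e \<longlonglongrightarrow> 0"
    unfolding e_def using LIMSEQ_Suc[OF LIMSEQ_inverse_real_of_nat] by (rule tendsto_mult_right_zero)
  define W where "W = (\<lambda>n. mollify (mollifier (e n)) w)"
  have smW: "smooth (W n)" for n
    unfolding W_def by (rule smooth_mollify[OF smooth_mollifier w wbd])
  have WM: "\<bar>W n x\<bar> \<le> M" for n x
    using mollify_close[OF e(1) w wbd, where a = 0 and d = M] M by (simp add: W_def)
  have Wunif: "eventually (\<lambda>n. \<forall>x. \<bar>W n x - w x\<bar> \<le> d) sequentially" if "0 < d" for d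
  proof -
    obtain e' where e': "0 < e'" "\<And>e x. 0 < e \<Longrightarrow> e \<le> e' \<Longrightarrow> norm (mollify (mollifier e) w x - w x) \<le> d"
      using mollify_uniformly_close[OF w wbd \<open>0 < d\<close>] by metis
    have "eventually (\<lambda>n. e n < e') sequentially" using order_tendstoD(2)[OF e0 e'(1)] .
    then show ?thesis by eventually_elim (use e' e in \<open>auto simp: W_def\<close>)
  qed
  have Wlim: "(\<lambda>n. W n x) \<longlonglongrightarrow> w x" for x
  proof (rule tendstoI)
    fix d :: real assume "0 < d"
    then have "eventually (\<lambda>n. \<forall>x. \<bar>W n x - w x\<bar> \<le> d / 2) sequentially"
      by (intro Wunif) simp
    then show "eventually (\<lambda>n. dist (W n x) (w x) < d) sequentially"
    proof eventually_elim
      case (elim n)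
      then have "\<bar>W n x - w x\<bar> \<le> d / 2" ..
      then show ?case using \<open>0 < d\<close> unfolding dist_real_def by linarith
    qed
  qed
  define \<theta> where "\<theta> = (\<lambda>n x. \<eta>' (W n x) *\<^sub>R \<phi> x)"
  define \<theta>0 where "\<theta>0 = (\<lambda>x. \<eta>' (w x) *\<^sub>R \<phi> x)"
  note [continuous_intros] = continuous_on_compose2[OF \<eta>c] continuous_on_compose2[OF \<eta>']
    smooth_continuous[OF smW] smooth_continuous[OF sm] w
  have \<theta>c: "continuous_on UNIV (\<theta> n)" for n unfolding \<theta>_def by (intro continuous_intros; simp)
  have \<theta>0c: "continuous_on UNIV \<theta>0" unfolding \<theta>0_def by (intro continuous_intros; simp)
  have \<theta>K: "\<theta> n x = 0" if "x \<notin> K" for n x using \<phi>K[OF that] by (simp add: \<theta>_def)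
  have \<theta>bd: "bounded {x. \<theta> n x \<noteq> 0}" for n
    by (rule bounded_subset[OF bd]) (auto simp: \<theta>_def)
  define T where "T = (\<lambda>n. mollify (mollifier (e n)) (\<theta> n))"
  have "cball x (e n) \<subseteq> ball x r" for x :: 'a and n using e(2)[of n] by auto
  then have "(\<Union>x\<in>K. cball x (e n)) \<subseteq> V'" for n unfolding V'_def by (intro UN_mono) auto
  then have TV': "T n \<in> test_functions V'" for n
    unfolding T_def by (intro mollify_in_test_functions[OF e(1) \<theta>c K(1) \<theta>K])
  then have TV: "T n \<in> test_functions V" for n using test_functions_mono[OF V'(2)] by blast
  have T_le: "norm (T n x) \<le> B' * C" for n x
  proof -
    have "norm (\<theta> n y) \<le> B' * C" for y
      unfolding \<theta>_def using B'[OF WM] C \<open>0 \<le> B'\<close> by (simp add: mult_mono)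
    then show ?thesis
      using mollify_close[OF e(1) \<theta>c \<theta>bd, where a = 0 and d = "B' * C"] by (simp add: T_def)
  qed
  \<comment> \<open>The field being mollified varies with \<open>n\<close>, so the error is split:
    \<open>\<theta> n\<close> is uniformly near \<open>\<theta>0\<close> because
    \<open>\<eta>'\<close> is uniformly continuous on \<open>{-M..M}\<close>, and
    \<open>\<theta>0\<close> is continuous at \<open>x\<close>. The denominator \<open>C + 1\<close>
    avoids division by 0.\<close>
  have Tlim: "(\<lambda>n. T n x) \<longlonglongrightarrow> \<theta>0 x" for x
  proof (rule tendstoI)
    fix d :: real assume "0 < d"
    then have d2: "0 < d / 4" by simp
    have "isCont \<theta>0 x" using \<theta>0c by (simp add: continuous_on_eq_continuous_at)
    then obtain \<rho> where \<rho>: "0 < \<rho>" "\<And>y. dist y x < \<rho> \<Longrightarrow> dist (\<theta>0 y) (\<theta>0 x) < d / 4"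
      using d2 unfolding continuous_at_eps_delta by metis
    have "uniformly_continuous_on {-M..M} \<eta>'"
      by (intro compact_uniformly_continuous cM continuous_on_subset[OF \<eta>'] subset_UNIV)
    moreover have "0 < d / 4 / (C + 1)" using d2 \<open>0 \<le> C\<close> by simp
    ultimately obtain \<delta> where \<delta>: "0 < \<delta>"
      "\<And>s t. s \<in> {-M..M} \<Longrightarrow> t \<in> {-M..M} \<Longrightarrow> dist t s < \<delta> \<Longrightarrow> dist (\<eta>' t) (\<eta>' s) < d / 4 / (C + 1)"
      unfolding uniformly_continuous_on_def by metis
    have "eventually (\<lambda>n. e n < \<rho>) sequentially" using order_tendstoD(2)[OF e0 \<rho>(1)] .
    moreover have "eventually (\<lambda>n. \<forall>y. \<bar>W n y - w y\<bar> \<le> \<delta> / 2) sequentially"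
      using Wunif[of "\<delta> / 2"] \<delta>(1) by simp
    ultimately show "eventually (\<lambda>n. dist (T n x) (\<theta>0 x) < d) sequentially"
    proof eventually_elim
      case (elim n)
      have close: "norm (\<theta> n y - \<theta>0 y) \<le> d / 4" for y
      proof -
        have "dist (W n y) (w y) < \<delta>" using elim(2)[rule_format, of y] \<delta>(1) unfolding dist_real_def by linarith
        then have "\<bar>\<eta>' (W n y) - \<eta>' (w y)\<bar> \<le> d / 4 / (C + 1)"
          using \<delta>(2)[of "w y" "W n y"] WM[of n y] M[of y] by (auto simp: dist_real_def abs_le_iff)
        then have "\<bar>\<eta>' (W n y) - \<eta>' (w y)\<bar> * norm (\<phi> y) \<le> d / 4 / (C + 1) * (C + 1)"
          using C[of y] \<open>0 \<le> C\<close> d2 by (intro mult_mono) auto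
        also have "\<dots> = d / 4" using \<open>0 \<le> C\<close> by (simp add: field_simps)
        finally show ?thesis
          by (simp add: \<theta>_def \<theta>0_def flip: scaleR_diff_left)
      qed
      have "norm (T n x - \<theta>0 x) \<le> d / 2"
        unfolding T_def
      proof (rule mollify_close[OF e(1) \<theta>c \<theta>bd])
        fix y assume "dist x y < e n"
        then have "dist y x < \<rho>" using elim(1) by (simp add: dist_commute)
        from \<rho>(2)[OF this] have "norm (\<theta>0 y - \<theta>0 x) < d / 4" by (simp add: dist_norm)
        moreover have "norm (\<theta> n y - \<theta>0 x) \<le> norm (\<theta> n y - \<theta>0 y) + norm (\<theta>0 y - \<theta>0 x)"
          using norm_triangle_ineq[of "\<theta> n y - \<theta>0 y" "\<theta>0 y - \<theta>0 x"] by simp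
        ultimately show "norm (\<theta> n y - \<theta>0 x) \<le> d / 2" using close[of y] by linarith
      qed
      then show ?case using \<open>0 < d\<close> by (simp add: dist_norm)
    qed
  qed
  have div0: "divergence \<phi> x = 0" if "x \<notin> K" for x
    using divergence_zero[OF \<phi>] that by (simp add: K_def)
  have eq: "(LINT x|lborel. \<eta> (W n x) * divergence \<phi> x) = - (LINT x|lebesgue_on V. T n x \<bullet> g x)" for n
  proof -
    have divT0: "divergence (T n) x = 0" if "x \<notin> V'" for x
      using divergence_zero[OF TV'] test_function_closure_support[OF TV', of n] that by blast
    have "(LINT x|lborel. \<eta> (W n x) * divergence \<phi> x) = (LINT y|lborel. w y * divergence (T n) y)"
      using integral_chain_rule_smooth[OF smW \<phi> \<eta> \<eta>'] mollify_adjoint[OF w wbd \<theta>c \<theta>bd, of n "e n"]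
      by (simp add: T_def \<theta>_def W_def)
    also have "\<dots> = (LINT y|lebesgue_on V. w y * divergence (T n) y)"
      using V'(2) divT0 V
      by (intro integral_lebesgue_on_eq_lborel[symmetric] borel_measurable_continuous_onI
          continuous_intros continuous_on_divergence[OF TV]) auto
    \<comment> \<open>The divergence of \<open>T n\<close> vanishes off \<open>V'\<close>, and on
      \<open>V'\<close> the functions \<open>w\<close> and \<open>u\<close> coincide.\<close>
    also have "\<dots> = (LINT y|lebesgue_on V. u y * divergence (T n) y)"
      using wu divT0 by (intro Bochner_Integration.integral_cong refl) (metis mult_zero_right)
    finally show ?thesis using ibp[OF TV] by simp
  qed
  have "(\<lambda>n. LINT x|lborel. \<eta> (W n x) * divergence \<phi> x) \<longlonglongrightarrow> (LINT x|lborel. \<eta> (w x) * divergence \<phi> x)"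
  proof (rule integral_dominated_convergence)
    show "(\<lambda>x. \<eta> (w x) * divergence \<phi> x) \<in> borel_measurable lborel"
      "(\<lambda>x. \<eta> (W n x) * divergence \<phi> x) \<in> borel_measurable lborel" for n
      by (simp only: measurable_lborel2, intro borel_measurable_continuous_onI continuous_intros
          continuous_on_divergence[OF \<phi>]; simp)+
    show "integrable lborel (\<lambda>x. B * norm (divergence \<phi> x))"
      using integrable_continuous_bounded_support[OF continuous_on_divergence[OF \<phi>] divergence_bounded_support[OF \<phi>]] by simp
    have "(\<lambda>n. \<eta> (W n x)) \<longlonglongrightarrow> \<eta> (w x)" for x
      using isCont_tendsto_compose[OF DERIV_isCont[OF \<eta>] Wlim] .
    then show "AE x in lborel. (\<lambda>n. \<eta> (W n x) * divergence \<phi> x) \<longlonglongrightarrow> \<eta> (w x) * divergence \<phi> x"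
      by (intro AE_I2 tendsto_mult tendsto_const)
    show "AE x in lborel. norm (\<eta> (W n x) * divergence \<phi> x) \<le> B * norm (divergence \<phi> x)" for n
      using B[OF WM] by (intro AE_I2) (simp add: abs_mult mult_right_mono)
  qed
  moreover have "(\<lambda>n. - (LINT x|lebesgue_on V. T n x \<bullet> g x)) \<longlonglongrightarrow> - (LINT x|lebesgue_on V. \<theta>0 x \<bullet> g x)"
  proof (intro tendsto_minus integral_dominated_convergence)
    show "(\<lambda>x. \<theta>0 x \<bullet> g x) \<in> borel_measurable (lebesgue_on V)"
      using g borel_measurable_lebesgue_on[OF borel_measurable_continuous_onI[OF \<theta>0c]] by (intro borel_measurable_inner) auto
    show "(\<lambda>x. T n x \<bullet> g x) \<in> borel_measurable (lebesgue_on V)" for n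
      using g borel_measurable_lebesgue_on[OF borel_measurable_continuous_onI[OF smooth_continuous[OF test_function_smooth[OF TV]]]]
      by (intro borel_measurable_inner) auto
    show "integrable (lebesgue_on V) (\<lambda>x. B' * C * norm (g x))" using g by simp
    show "AE x in lebesgue_on V. (\<lambda>n. T n x \<bullet> g x) \<longlonglongrightarrow> \<theta>0 x \<bullet> g x"
      by (intro AE_I2 tendsto_inner Tlim tendsto_const)
    have "norm (T n x \<bullet> g x) \<le> B' * C * norm (g x)" for n x
      using Cauchy_Schwarz_ineq2[of "T n x" "g x"] mult_right_mono[OF T_le[of n x] norm_ge_zero[of "g x"]]
      by (simp del: abs_mult) 
    then show "AE x in lebesgue_on V. norm (T n x \<bullet> g x) \<le> B' * C * norm (g x)" for n by simp
  qed
  ultimately have "(LINT x|lborel. \<eta> (w x) * divergence \<phi> x) = - (LINT x|lebesgue_on V. \<theta>0 x \<bullet> g x)"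
    unfolding eq by (rule LIMSEQ_unique)
  moreover have "(LINT x|lebesgue_on V. \<eta> (u x) * divergence \<phi> x) = (LINT x|lborel. \<eta> (w x) * divergence \<phi> x)"
  proof -
    have "(LINT x|lebesgue_on V. \<eta> (u x) * divergence \<phi> x) = (LINT x|lebesgue_on V. \<eta> (w x) * divergence \<phi> x)"
      using wu div0 KV' by (intro Bochner_Integration.integral_cong refl) (metis mult_zero_right subsetD)
    also have "\<dots> = (LINT x|lborel. \<eta> (w x) * divergence \<phi> x)"
      using div0 K(2) V
      by (intro integral_lebesgue_on_eq_lborel borel_measurable_continuous_onI
          continuous_intros continuous_on_divergence[OF \<phi>]) auto
    finally show ?thesis .
  qed
  moreover have "(LINT x|lebesgue_on V. \<theta>0 x \<bullet> g x) = (LINT x|lebesgue_on V. \<eta>' (u x) * (\<phi> x \<bullet> g x))"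
    using wu \<phi>K KV' unfolding \<theta>0_def
    by (intro Bochner_Integration.integral_cong refl) (metis inner_scaleR_left inner_zero_left mult_zero_right subsetD)
  ultimately show ?thesis by simp
qed

section \<open>Total variation of superlevel sets\<close>

text \<open>Dropping the restriction to \<Omega> changes nothing on
  \<open>V \<subseteq> \<Omega>\<close> and leaves a step function of \<open>t\<close> and
  \<open>u x\<close> alone, the form used for layer cake integrals.\<close>

definition level_fun :: "('a \<Rightarrow> real) \<Rightarrow> real \<Rightarrow> 'a \<Rightarrow> real" where
  "level_fun u t x = (if t < u x then 1 else 0)"

lemma total_variation_cong:
  assumes "\<And>x. x \<in> V \<Longrightarrow> f x = f' x"
  shows "total_variation V f = total_variation V f'"
proof -
  have "distributional_gradient V f \<phi> = distributional_gradient V f' \<phi>" for \<phi>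
    unfolding distributional_gradient_def
    by (intro arg_cong[where f = uminus] Bochner_Integration.integral_cong refl) (use assms in auto)
  then show ?thesis by (simp add: total_variation_def)
qed

lemma perimeter_superlevel:
  assumes "V \<subseteq> \<Omega>"
  shows "perimeter (superlevel \<Omega> u t) V = total_variation V (level_fun u t)"
  unfolding perimeter_def
  by (rule total_variation_cong) (use assms in \<open>auto simp: superlevel_def level_fun_def indicator_def\<close>)

lemma zero_test_function: "(\<lambda>_. 0) \<in> test_functions V"
proof -
  have "C_k k (\<lambda>_::'a. 0 :: 'b)" for k
    by (induction k) (auto simp: frechet_derivative_const)
  then show ?thesis by (simp add: test_functions_def)
qed

lemma total_variation_upper:
  "\<phi> \<in> test_functions V \<Longrightarrow> (\<And>x. norm (\<phi> x) \<le> 1) \<Longrightarrow> ereal (distributional_gradient V f \<phi>) \<le> total_variation V f"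
  unfolding total_variation_def by (rule SUP_upper) auto

lemma total_variation_nonneg: "0 \<le> total_variation V f"
proof -
  have "distributional_gradient V f (\<lambda>_. 0) = 0"
    by (simp add: distributional_gradient_def divergence_def frechet_derivative_const)
  then show ?thesis
    using total_variation_upper[OF zero_test_function, of V f] by (simp add: zero_ereal_def)
qed

lemma integrable_mult_divergence:
  fixes f :: "'a::euclidean_space \<Rightarrow> real"
  assumes "open V" "f \<in> borel_measurable (lebesgue_on V)" "\<And>x. \<bar>f x\<bar> \<le> B" "\<phi> \<in> test_functions V"
  shows "integrable (lebesgue_on V) (\<lambda>x. f x * divergence \<phi> x)"
    and "integrable (lebesgue_on V) (divergence \<phi>)"
proof -
  have "integrable lborel (divergence \<phi>)"
    by (rule integrable_continuous_bounded_support[OF continuous_on_divergence[OF assms(4)] divergence_bounded_support[OF assms(4)]])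
  then have "integrable lebesgue (divergence \<phi>)"
    by (subst integrable_completion) auto
  then have "integrable (lebesgue_on UNIV) (divergence \<phi>)" by (simp add: lebesgue_on_UNIV_eq)
  then show i: "integrable (lebesgue_on V) (divergence \<phi>)"
    using assms(1) by (elim integrable_lebesgue_on_subset) auto
  show "integrable (lebesgue_on V) (\<lambda>x. f x * divergence \<phi> x)"
    using integrable_inner_bounded[of f V "divergence \<phi>" B] assms(2,3) i by simp
qed

lemma tendsto_distributional_gradient:
  assumes "open V" "\<phi> \<in> test_functions V"
    and "\<And>n. f n \<in> borel_measurable (lebesgue_on V)" "f' \<in> borel_measurable (lebesgue_on V)"
    and "\<And>n x. \<bar>f n x\<bar> \<le> 1" "AE x in lebesgue_on V. (\<lambda>n. f n x) \<longlonglongrightarrow> f' x"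
  shows "(\<lambda>n. distributional_gradient V (f n) \<phi>) \<longlonglongrightarrow> distributional_gradient V f' \<phi>"
  unfolding distributional_gradient_def
proof (intro tendsto_minus integral_dominated_convergence)
  have [measurable]: "divergence \<phi> \<in> borel_measurable (lebesgue_on V)"
    using integrable_mult_divergence(2)[OF assms(1) assms(3) assms(5) assms(2)] by simp
  show "(\<lambda>x. f' x * divergence \<phi> x) \<in> borel_measurable (lebesgue_on V)"
    "(\<lambda>x. f n x * divergence \<phi> x) \<in> borel_measurable (lebesgue_on V)" for n
    using assms(3,4) by (intro borel_measurable_times; simp)+
  show "integrable (lebesgue_on V) (\<lambda>x. norm (divergence \<phi> x))"
    using integrable_mult_divergence(2)[OF assms(1) assms(3) assms(5) assms(2)] by simp
  show "AE x in lebesgue_on V. (\<lambda>n. f n x * divergence \<phi> x) \<longlonglongrightarrow> f' x * divergence \<phi> x"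
    using assms(6) by eventually_elim (intro tendsto_intros)
  show "AE x in lebesgue_on V. norm (f n x * divergence \<phi> x) \<le> norm (divergence \<phi> x)" for n
    using assms(5) by (intro AE_I2) (simp add: abs_mult mult_left_le_one_le)
qed

text \<open>The pairing with a fixed field is continuous under bounded almost everywhere
  convergence, and a supremum of such functionals is lower semicontinuous.\<close>

lemma total_variation_lsc:
  fixes V :: "'a::euclidean_space set"
  assumes "open V"
    and "\<And>n. f n \<in> borel_measurable (lebesgue_on V)" "f' \<in> borel_measurable (lebesgue_on V)"
    and "\<And>n x. \<bar>f n x\<bar> \<le> 1" "AE x in lebesgue_on V. (\<lambda>n. f n x) \<longlonglongrightarrow> f' x"
  shows "total_variation V f' \<le> liminf (\<lambda>n. total_variation V (f n))"
  unfolding total_variation_def[of V f']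
proof (rule SUP_least)
  fix \<phi> :: "'a \<Rightarrow> 'a" assume "\<phi> \<in> {\<phi> \<in> test_functions V. \<forall>x. norm (\<phi> x) \<le> 1}"
  then have \<phi>: "\<phi> \<in> test_functions V" "\<And>x. norm (\<phi> x) \<le> 1" by auto
  have "(\<lambda>n. ereal (distributional_gradient V (f n) \<phi>)) \<longlonglongrightarrow> ereal (distributional_gradient V f' \<phi>)"
    using tendsto_distributional_gradient[OF assms(1) \<phi>(1) assms(2-5)] by simp
  then have "ereal (distributional_gradient V f' \<phi>) = liminf (\<lambda>n. ereal (distributional_gradient V (f n) \<phi>))"
    by (metis lim_imp_Liminf trivial_limit_sequentially)
  also have "\<dots> \<le> liminf (\<lambda>n. total_variation V (f n))"
    by (intro Liminf_mono always_eventually allI total_variation_upper \<phi>)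
  finally show "ereal (distributional_gradient V f' \<phi>) \<le> liminf (\<lambda>n. total_variation V (f n))" .
qed

text \<open>Every point of \<open>A\<close> that is not interior is the left end point of an interval in \<open>A\<close>;
  these intervals are disjoint, hence there are only countably many of them.\<close>

lemma right_open_imp_borel:
  fixes A :: "real set"
  assumes "\<And>t. t \<in> A \<Longrightarrow> \<exists>d>0. {t..<t + d} \<subseteq> A"
  shows "A \<in> sets borel"
proof -
  obtain d where d: "\<And>t. t \<in> A \<Longrightarrow> d t > 0" "\<And>t. t \<in> A \<Longrightarrow> {t..<t + d t} \<subseteq> A"
    using assms by metis
  have "\<exists>q. t < of_rat q \<and> of_rat q < t + d t" if "t \<in> A" for t
    using of_rat_dense[of t "t + d t"] d(1)[OF that] by auto
  then obtain q where q: "\<And>t. t \<in> A \<Longrightarrow> t < of_rat (q t)" "\<And>t. t \<in> A \<Longrightarrow> of_rat (q t) < t + d t"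
    by metis
  have int: "{t<..<t + d t} \<subseteq> interior A" if "t \<in> A" for t
    by (rule interior_maximal) (use d(2)[OF that] in auto)
  have less: "\<not> s < t" if "s \<in> A" "t \<in> A - interior A" "q s = q t" for s t
  proof
    assume "s < t"
    then have "t \<in> {s<..<s + d s}"
      using q(1)[of t] q(2)[of s] that by auto
    then show False using int[OF that(1)] that(2) by blast
  qed
  have "inj_on q (A - interior A)"
    by (intro inj_onI) (metis DiffD1 less linorder_neqE_linordered_idom)
  then have "countable (A - interior A)"
    by (rule countableI')
  then have "A - interior A \<in> sets borel" by (rule sets.countable[rotated]) auto
  then have "interior A \<union> (A - interior A) \<in> sets borel"
    by (rule sets.Un[OF borel_open[OF open_interior]])
  moreover have "interior A \<union> (A - interior A) = A"
    using interior_subset[of A] by (rule Un_Diff_cancel[THEN trans, OF Un_absorb1])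
  ultimately show ?thesis by simp
qed

section \<open>Measurability of the perimeter as a function of the level\<close>

lemma borel_measurable_level_fun:
  "u \<in> borel_measurable (lebesgue_on V) \<Longrightarrow> level_fun u t \<in> borel_measurable (lebesgue_on V)"
  unfolding level_fun_def by measurable

lemma tendsto_level_fun_right:
  assumes "\<And>n. t < S n" "S \<longlonglongrightarrow> t"
  shows "(\<lambda>n. level_fun u (S n) x) \<longlonglongrightarrow> level_fun u t x"
proof (cases "t < u x")
  case True
  have "eventually (\<lambda>n. S n < u x) sequentially" using order_tendstoD(2)[OF assms(2) True] .
  then have "eventually (\<lambda>n. level_fun u (S n) x = level_fun u t x) sequentially"
    by eventually_elim (use True in \<open>simp add: level_fun_def\<close>)
  then show ?thesis by (rule tendsto_eventually)
next
  case False
  then have "level_fun u (S n) x = level_fun u t x" for n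
    using assms(1)[of n] by (simp add: level_fun_def)
  then show ?thesis by simp
qed

text \<open>A supremum over uncountably many fields need not be measurable. Here each pairing is
  right continuous in \<open>t\<close>, because \<open>level_fun\<close> is defined by a strict
  inequality; a field that witnesses \<open>c <\<close> at \<open>t\<close> therefore still does so
  slightly to the right, and \<open>right_open_imp_borel\<close> applies.\<close>

lemma borel_measurable_total_variation_level_fun:
  fixes u :: "'a::euclidean_space \<Rightarrow> real"
  assumes "open V" "u \<in> borel_measurable (lebesgue_on V)"
  shows "(\<lambda>t. total_variation V (level_fun u t)) \<in> borel_measurable borel"
proof (rule borel_measurableI_greater)
  fix c :: ereal
  let ?A = "{t. c < total_variation V (level_fun u t)}"
  have "?A \<in> sets borel"
  proof (rule right_open_imp_borel)
    fix t assume "t \<in> ?A"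
    then obtain \<phi> where \<phi>: "\<phi> \<in> test_functions V" "\<And>x. norm (\<phi> x) \<le> 1"
      "c < ereal (distributional_gradient V (level_fun u t) \<phi>)"
      unfolding total_variation_def less_SUP_iff by auto
    have "((\<lambda>s. distributional_gradient V (level_fun u s) \<phi>) \<longlongrightarrow> distributional_gradient V (level_fun u t) \<phi>) (at_right t)"
    proof (rule tendsto_at_right_sequentially[where b = "t + 1"])
      fix S :: "nat \<Rightarrow> real" assume "\<And>n. t < S n" "S \<longlonglongrightarrow> t"
      then show "(\<lambda>n. distributional_gradient V (level_fun u (S n)) \<phi>) \<longlonglongrightarrow> distributional_gradient V (level_fun u t) \<phi>"
        by (intro tendsto_distributional_gradient assms(1) \<phi> borel_measurable_level_fun assms(2) AE_I2 tendsto_level_fun_right)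
           (auto simp: level_fun_def)
    qed simp
    then have "((\<lambda>s. ereal (distributional_gradient V (level_fun u s) \<phi>)) \<longlongrightarrow> ereal (distributional_gradient V (level_fun u t) \<phi>)) (at_right t)"
      by simp
    then have "eventually (\<lambda>s. c < ereal (distributional_gradient V (level_fun u s) \<phi>)) (at_right t)"
      using \<phi>(3) by (rule order_tendstoD(1))
    then obtain b where b: "t < b" "\<And>s. t < s \<Longrightarrow> s < b \<Longrightarrow> c < ereal (distributional_gradient V (level_fun u s) \<phi>)"
      unfolding eventually_at_right_field by auto
    have "c < total_variation V (level_fun u s)" if "s \<in> {t..<b}" for s
      using that b(2)[of s] \<phi>(3) total_variation_upper[OF \<phi>(1,2)]
      by (cases "s = t") (auto intro: less_le_trans)
    then show "\<exists>d>0. {t..<t + d} \<subseteq> ?A"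
      using b(1) by (intro exI[of _ "b - t"]) auto
  qed
  then show "{t \<in> space borel. c < total_variation V (level_fun u t)} \<in> sets borel" by simp
qed

text \<open>The difference of two steps is a signed indicator of the interval between
  \<open>a\<close> and \<open>b\<close>. A difference is used because a single step is not
  integrable over all levels.\<close>

lemma has_bochner_integral_level_difference:
  fixes a b :: real
  shows "has_bochner_integral lborel (\<lambda>t. (if t < a then 1 else 0) - (if t < b then 1 else 0 :: real)) (a - b)"
    and "has_bochner_integral lborel (\<lambda>t. \<bar>(if t < a then 1 else 0) - (if t < b then 1 else 0 :: real)\<bar>) \<bar>a - b\<bar>"
proof -
  have i: "has_bochner_integral lborel (indicator {c..<d} :: real \<Rightarrow> real) (d - c)" if "c \<le> d" for c d :: real
    using has_bochner_integral_real_indicator[of "{c..<d}" lborel] that by simp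
  show "has_bochner_integral lborel (\<lambda>t. (if t < a then 1 else 0) - (if t < b then 1 else 0 :: real)) (a - b)"
  proof (cases "b \<le> a")
    case True
    then have "(\<lambda>t. (if t < a then 1 else 0) - (if t < b then 1 else 0 :: real)) = indicator {b..<a}"
      by (auto simp: indicator_def fun_eq_iff)
    then show ?thesis using i[OF True] by simp
  next
    case False
    then have "(\<lambda>t. (if t < a then 1 else 0) - (if t < b then 1 else 0 :: real)) = (\<lambda>t. - indicator {a..<b} t)"
      by (auto simp: indicator_def fun_eq_iff)
    then show ?thesis using has_bochner_integral_minus[OF i[of a b]] False by simp
  qed
  have "(\<lambda>t. \<bar>(if t < a then 1 else 0) - (if t < b then 1 else 0 :: real)\<bar>) = indicator {min a b..<max a b}"
    by (auto simp: indicator_def fun_eq_iff)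
  moreover have "\<bar>a - b\<bar> = max a b - min a b" by auto
  ultimately show "has_bochner_integral lborel (\<lambda>t. \<bar>(if t < a then 1 else 0) - (if t < b then 1 else 0 :: real)\<bar>) \<bar>a - b\<bar>"
    using i[of "min a b" "max a b"] by simp
qed

section \<open>The coarea formula\<close>

lemma pair_sigma_finite_lebesgue_on:
  fixes V :: "'a::euclidean_space set"
  assumes "open V" "bounded V"
  shows "pair_sigma_finite (lebesgue_on V) (lborel :: real measure)"
proof -
  interpret V: finite_measure "lebesgue_on V"
    by (rule finite_measure_lebesgue_on[OF lmeasurable_open[OF assms(2,1)]])
  show ?thesis ..
qed

lemma measurable_pair_level:
  fixes u :: "'a::euclidean_space \<Rightarrow> real"
  assumes "u \<in> borel_measurable (lebesgue_on V)"
  shows "(\<lambda>z. if snd z < u (fst z) then 1 else 0 :: real) \<in> borel_measurable (lebesgue_on V \<Otimes>\<^sub>M lborel)"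
proof -
  have "(\<lambda>z. u (fst z)) \<in> borel_measurable (lebesgue_on V \<Otimes>\<^sub>M lborel)"
    by (rule measurable_compose[OF measurable_fst assms])
  moreover have "snd \<in> borel_measurable (lebesgue_on V \<Otimes>\<^sub>M lborel)"
    using measurable_snd[of "lebesgue_on V" "lborel :: real measure"] by simp
  ultimately have "{z \<in> space (lebesgue_on V \<Otimes>\<^sub>M lborel). snd z < u (fst z)} \<in> sets (lebesgue_on V \<Otimes>\<^sub>M lborel)"
    using borel_measurable_less[of snd "lebesgue_on V \<Otimes>\<^sub>M lborel" "\<lambda>z. u (fst z)"] by (simp add: pred_def)
  then show ?thesis
    by (intro measurable_If borel_measurable_const)
qed

lemma coarea_ge:
  fixes u :: "'a::euclidean_space \<Rightarrow> real" and g :: "'a \<Rightarrow> 'a"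
  assumes V: "open V" "bounded V" and u: "integrable (lebesgue_on V) u" and g: "integrable (lebesgue_on V) g"
    and ibp: "\<And>\<phi>. \<phi> \<in> test_functions V \<Longrightarrow>
      (LINT x|lebesgue_on V. u x * divergence \<phi> x) = - (LINT x|lebesgue_on V. \<phi> x \<bullet> g x)"
  shows "(\<integral>\<^sup>+x. ennreal (norm (g x)) \<partial>lebesgue_on V)
    \<le> (\<integral>\<^sup>+t. e2ennreal (total_variation V (level_fun u t)) \<partial>lborel)" (is "_ \<le> ?P")
\<comment> \<open>If the right-hand side is finite it is a real number \<open>C\<close>, as
  \<open>integral_norm_le_test_functions\<close> requires of its bound.\<close>
proof (cases "?P = \<infinity>")
  case False
  then obtain C where C: "0 \<le> C" "?P = ennreal C" by (cases "?P") auto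
  interpret pair_sigma_finite "lebesgue_on V" "lborel :: real measure"
    by (rule pair_sigma_finite_lebesgue_on[OF V])
  have [measurable]: "u \<in> borel_measurable (lebesgue_on V)" using u by simp
  have "(LINT x|lebesgue_on V. norm (g x)) \<le> C"
  proof (rule integral_norm_le_test_functions[OF V g])
    fix \<phi> :: "'a \<Rightarrow> 'a" assume \<phi>: "\<phi> \<in> test_functions V" and le: "\<And>x. norm (\<phi> x) \<le> 1"
    have level1: "\<bar>level_fun u t x\<bar> \<le> 1" for t x by (simp add: level_fun_def)
    have idiv: "integrable (lebesgue_on V) (divergence \<phi>)"
      by (rule integrable_mult_divergence(2)[OF V(1) borel_measurable_level_fun level1 \<phi>]) simp
    then have [measurable]: "divergence \<phi> \<in> borel_measurable (lebesgue_on V)" by simp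
    have div0: "(LINT x|lebesgue_on V. divergence \<phi> x) = 0"
      using integral_divergence_zero[OF \<phi>]
        integral_lebesgue_on_eq_lborel[OF V(1) borel_measurable_continuous_onI[OF continuous_on_divergence[OF \<phi>]]]
        divergence_zero[OF \<phi>] test_function_closure_support[OF \<phi>] by (metis subsetD)
    have iudiv: "integrable (lebesgue_on V) (\<lambda>x. u x * divergence \<phi> x)"
      using integrable_scaleR_continuous[OF continuous_on_divergence[OF \<phi>] divergence_bounded_support[OF \<phi>] u] by simp
    \<comment> \<open>The second step compensates for the first at very negative \<open>t\<close>
      and makes \<open>F x\<close> integrable. For fixed \<open>t\<close> it is constant in
      \<open>x\<close>, so it disappears against the divergence, whose integral is 0.\<close>
    define F where "F = (\<lambda>x t. ((if t < u x then 1 else 0) - (if t < 0 then 1 else 0 :: real)) * divergence \<phi> x)"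
    have F: "has_bochner_integral lborel (F x) (u x * divergence \<phi> x)"
      "has_bochner_integral lborel (\<lambda>t. norm (F x t)) (\<bar>u x\<bar> * \<bar>divergence \<phi> x\<bar>)" for x
      using has_bochner_integral_mult_left[OF has_bochner_integral_level_difference(1)[of "u x" 0], of "divergence \<phi> x"]
        has_bochner_integral_mult_left[OF has_bochner_integral_level_difference(2)[of "u x" 0], of "\<bar>divergence \<phi> x\<bar>"]
      by (simp_all add: F_def abs_mult)
    have intF: "integrable (lebesgue_on V \<Otimes>\<^sub>M lborel) (case_prod F)"
    proof (rule Fubini_integrable)
      show "case_prod F \<in> borel_measurable (lebesgue_on V \<Otimes>\<^sub>M lborel)"
      proof -
        have "(\<lambda>z. divergence \<phi> (fst z)) \<in> borel_measurable (lebesgue_on V \<Otimes>\<^sub>M (lborel :: real measure))"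
          by (rule measurable_compose[OF measurable_fst]) simp
        then show ?thesis
          unfolding F_def split_beta'
          by (intro borel_measurable_times borel_measurable_diff measurable_pair_level
              measurable_pair_level[where u = "\<lambda>_. 0"]) auto
      qed
      have "(LINT t|lborel. norm (case (x, t) of (x, t) \<Rightarrow> F x t)) = \<bar>u x * divergence \<phi> x\<bar>" for x
        using F(2)[of x] by (simp add: has_bochner_integral_integral_eq abs_mult)
      then show "integrable (lebesgue_on V) (\<lambda>x. LINT t|lborel. norm (case (x, t) of (x, t) \<Rightarrow> F x t))"
        using iudiv by simp
      show "AE x in lebesgue_on V. integrable lborel (\<lambda>t. case (x, t) of (x, t) \<Rightarrow> F x t)"
        using F(1) by (intro AE_I2) (auto simp: has_bochner_integral_iff)
    qed
    have inner: "(LINT x|lebesgue_on V. F x t) = - distributional_gradient V (level_fun u t) \<phi>" for t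
    proof -
      have "(LINT x|lebesgue_on V. F x t) = (LINT x|lebesgue_on V. level_fun u t x * divergence \<phi> x - (if t < 0 then 1 else 0) * divergence \<phi> x)"
        by (simp add: F_def level_fun_def left_diff_distrib)
      also have "\<dots> = (LINT x|lebesgue_on V. level_fun u t x * divergence \<phi> x) - (LINT x|lebesgue_on V. (if t < 0 then 1 else 0) * divergence \<phi> x)"
        by (intro Bochner_Integration.integral_diff integrable_mult_divergence[OF V(1) borel_measurable_level_fun level1 \<phi>])
           (use idiv in auto)
      finally show ?thesis by (simp add: div0 distributional_gradient_def)
    qed
    have "(LINT t|lborel. F x t) = u x * divergence \<phi> x" for x
      using has_bochner_integral_integral_eq[OF F(1)] .
    then have "(LINT x|lebesgue_on V. \<phi> x \<bullet> g x) = - (LINT x|lebesgue_on V. (LINT t|lborel. F x t))"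
      using ibp[OF \<phi>] by simp
    also have "\<dots> = - (LINT t|lborel. (LINT x|lebesgue_on V. F x t))"
      using Fubini_integral[OF intF] by simp
    also have "\<dots> = (LINT t|lborel. distributional_gradient V (level_fun u t) \<phi>)"
      by (simp add: inner)
    finally have eq: "(LINT x|lebesgue_on V. \<phi> x \<bullet> g x) = (LINT t|lborel. distributional_gradient V (level_fun u t) \<phi>)" .
    have idg: "integrable lborel (\<lambda>t. distributional_gradient V (level_fun u t) \<phi>)"
      using integrable_snd[OF intF] by (simp add: inner)
    \<comment> \<open>For a fixed field the pairing may be negative at some levels; the positive
      part allows comparison with the total variation under a nonnegative integral.\<close>
    have "ennreal (LINT t|lborel. distributional_gradient V (level_fun u t) \<phi>) \<le> ennreal (LINT t|lborel. max 0 (distributional_gradient V (level_fun u t) \<phi>))"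
      by (intro ennreal_leI integral_mono idg integrable_max) auto
    also have "\<dots> = (\<integral>\<^sup>+t. ennreal (max 0 (distributional_gradient V (level_fun u t) \<phi>)) \<partial>lborel)"
      by (intro nn_integral_eq_integral[symmetric] integrable_max idg) auto
    also have "\<dots> \<le> ?P"
    proof (rule nn_integral_mono)
      fix t
      have "e2ennreal (ereal (distributional_gradient V (level_fun u t) \<phi>)) \<le> e2ennreal (total_variation V (level_fun u t))"
        by (intro e2ennreal_mono total_variation_upper[OF \<phi> le])
      then show "ennreal (max 0 (distributional_gradient V (level_fun u t) \<phi>)) \<le> e2ennreal (total_variation V (level_fun u t))"
        by (simp add: ennreal_max_0)
    qed
    finally show "(LINT x|lebesgue_on V. \<phi> x \<bullet> g x) \<le> C"
      using C by (simp add: eq ennreal_le_iff)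
  qed
  then show ?thesis
    using g C by (subst nn_integral_eq_integral) (auto intro: ennreal_leI)
qed simp

text \<open>The shift by \<open>m\<close> makes the limit for \<open>m \<longlongrightarrow> \<infinity>\<close> vanish at \<open>s = 0\<close> as well.\<close>

definition steep_step :: "real \<Rightarrow> real \<Rightarrow> real" where
  "steep_step m s = 1 / 2 + arctan (m\<^sup>2 * s - m) / pi"

text \<open>For \<open>m > 0\<close> this is the Cauchy density with centre \<open>1 / m\<close> and
  scale \<open>1 / m\<^sup>2\<close>. Its total mass 1 is the reason why the upper bound loses no
  constant.\<close>

definition steep_step_deriv :: "real \<Rightarrow> real \<Rightarrow> real" where
  "steep_step_deriv m s = m\<^sup>2 / pi * inverse (1 + (m\<^sup>2 * s - m)\<^sup>2)"

lemma steep_step_has_derivative: "(steep_step m has_real_derivative steep_step_deriv m s) (at s)"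
proof -
  have "((\<lambda>s. 1 / 2 + arctan (m\<^sup>2 * s - m) / pi) has_real_derivative steep_step_deriv m s) (at s)"
  proof -
    have "((\<lambda>s. m\<^sup>2 * s - m) has_real_derivative m\<^sup>2) (at s)"
      by (rule DERIV_cong, rule derivative_intros, rule DERIV_cmult, rule DERIV_ident, rule DERIV_const) simp
    then have "((\<lambda>s. arctan (m\<^sup>2 * s - m)) has_real_derivative inverse (1 + (m\<^sup>2 * s - m)\<^sup>2) * m\<^sup>2) (at s)"
      by (rule DERIV_chain2[OF DERIV_arctan])
    then have "((\<lambda>s. 1 / 2 + arctan (m\<^sup>2 * s - m) / pi) has_real_derivative
        0 + inverse (1 + (m\<^sup>2 * s - m)\<^sup>2) * m\<^sup>2 / pi) (at s)"
      by (intro DERIV_add DERIV_const DERIV_cdivide)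
    then show ?thesis by (simp add: steep_step_deriv_def mult.commute)
  qed
  then show ?thesis unfolding steep_step_def[abs_def] .
qed

lemma steep_step_deriv_nonneg: "0 \<le> steep_step_deriv m s"
  by (simp add: steep_step_deriv_def add_nonneg_nonneg)

lemma steep_step_deriv_le: "steep_step_deriv m s \<le> m\<^sup>2 / pi"
proof -
  have "inverse (1 + (m\<^sup>2 * s - m)\<^sup>2) \<le> 1"
    by (simp add: inverse_le_1_iff)
  then show ?thesis
    unfolding steep_step_deriv_def using mult_left_mono[of _ 1 "m\<^sup>2 / pi"] by simp
qed

lemma continuous_steep_step_deriv: "continuous_on UNIV (steep_step_deriv m)"
  unfolding steep_step_deriv_def
  by (intro continuous_intros) (simp add: add_nonneg_eq_0_iff)

lemma abs_steep_step_le: "\<bar>steep_step m s\<bar> \<le> 1"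
proof -
  have "\<bar>arctan (m\<^sup>2 * s - m)\<bar> \<le> pi / 2"
    using arctan_bounded[of "m\<^sup>2 * s - m"] by linarith
  then have "\<bar>arctan (m\<^sup>2 * s - m) / pi\<bar> \<le> 1 / 2"
    by (simp add: divide_le_eq)
  then show ?thesis unfolding steep_step_def by linarith
qed

text \<open>With \<open>m = Suc n\<close>, the argument of \<open>arctan\<close> is
  \<open>m * (m * s - 1)\<close>: it tends to infinity for \<open>s > 0\<close> and is at most
  \<open>- m\<close> otherwise. The limit 0 at \<open>s = 0\<close> matches the strict inequality in
  \<open>level_fun\<close>, so convergence holds on the level set too.\<close>

lemma steep_step_tendsto:
  "(\<lambda>n. steep_step (real (Suc n)) s) \<longlonglongrightarrow> (if 0 < s then 1 else 0)"
proof -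
  have m: "filterlim (\<lambda>n. real (Suc n)) at_top sequentially"
    by (rule filterlim_compose[OF filterlim_real_sequentially filterlim_Suc])
  show ?thesis
  proof (cases "0 < s")
    case True
    have "filterlim (\<lambda>n. -1 + s * real (Suc n)) at_top sequentially"
      by (intro filterlim_tendsto_add_at_top[OF tendsto_const] filterlim_tendsto_pos_mult_at_top[OF tendsto_const True m])
    then have "filterlim (\<lambda>n. real (Suc n) * (-1 + s * real (Suc n))) at_top sequentially"
      by (rule filterlim_at_top_mult_at_top[OF m])
    then have "filterlim (\<lambda>n. (real (Suc n))\<^sup>2 * s - real (Suc n)) at_top sequentially"
      by (simp add: power2_eq_square algebra_simps)
    then have "(\<lambda>n. arctan ((real (Suc n))\<^sup>2 * s - real (Suc n))) \<longlonglongrightarrow> pi / 2"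
      by (rule filterlim_compose[OF tendsto_arctan_at_top])
    then have "(\<lambda>n. steep_step (real (Suc n)) s) \<longlonglongrightarrow> 1 / 2 + (pi / 2) / pi"
      unfolding steep_step_def by (intro tendsto_intros) auto
    then show ?thesis using True by simp
  next
    case False
    have "filterlim (\<lambda>n. - real (Suc n)) at_bot sequentially"
      using m by (simp add: filterlim_uminus_at_top)
    then have "filterlim (\<lambda>n. (real (Suc n))\<^sup>2 * s - real (Suc n)) at_bot sequentially"
      by (rule filterlim_at_bot_mono) (use False in \<open>auto intro!: always_eventually mult_nonneg_nonpos\<close>)
    then have "(\<lambda>n. arctan ((real (Suc n))\<^sup>2 * s - real (Suc n))) \<longlonglongrightarrow> - (pi / 2)"
      by (rule filterlim_compose[OF tendsto_arctan_at_bot])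
    then have "(\<lambda>n. steep_step (real (Suc n)) s) \<longlonglongrightarrow> 1 / 2 + - (pi / 2) / pi"
      unfolding steep_step_def by (intro tendsto_intros) auto
    then show ?thesis using False by simp
  qed
qed

lemma nn_integral_steep_step_deriv:
  assumes "0 < m"
  shows "(\<integral>\<^sup>+t. ennreal (steep_step_deriv m (s - t)) \<partial>lborel) = 1"
proof -
  define f where "f = (\<lambda>x::real. inverse (1 + x\<^sup>2))"
  have [measurable]: "f \<in> borel_measurable borel" unfolding f_def by measurable
  have "integrable lborel f"
    using integrable_inverse_1_plus_square by (simp add: set_integrable_def f_def)
  moreover have "(LINT x|lborel. f x) = pi"
    using LBINT_inverse_1_plus_square
    by (simp add: interval_lebesgue_integral_def set_lebesgue_integral_def f_def)
  ultimately have pi: "(\<integral>\<^sup>+x. ennreal (f x) \<partial>lborel) = ennreal pi"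
    by (subst nn_integral_eq_integral) (auto simp: f_def add_nonneg_nonneg)
  have eq: "steep_step_deriv m (s - t) = m\<^sup>2 / pi * f ((m\<^sup>2 * s - m) + (- m\<^sup>2) * t)" for t
    by (simp add: steep_step_deriv_def f_def algebra_simps)
  have "(\<integral>\<^sup>+t. ennreal (steep_step_deriv m (s - t)) \<partial>lborel)
      = (\<integral>\<^sup>+t. ennreal (1 / pi) * (ennreal \<bar>- m\<^sup>2\<bar> * ennreal (f ((m\<^sup>2 * s - m) + (- m\<^sup>2) * t))) \<partial>lborel)"
    unfolding eq by (intro nn_integral_cong) (simp add: ennreal_mult'[symmetric] f_def add_nonneg_nonneg)
  also have "\<dots> = ennreal (1 / pi) * (ennreal \<bar>- m\<^sup>2\<bar> * (\<integral>\<^sup>+t. ennreal (f ((m\<^sup>2 * s - m) + (- m\<^sup>2) * t)) \<partial>lborel))"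
    by (simp add: nn_integral_cmult)
  also have "\<dots> = ennreal (1 / pi) * (\<integral>\<^sup>+x. ennreal (f x) \<partial>lborel)"
    using assms by (subst nn_integral_real_affine[where f = "\<lambda>x. ennreal (f x)" and c = "- m\<^sup>2" and t = "m\<^sup>2 * s - m"]) auto
  finally show ?thesis by (simp add: pi ennreal_mult'[symmetric])
qed

lemma coarea_le:
  fixes u :: "'a::euclidean_space \<Rightarrow> real" and g :: "'a \<Rightarrow> 'a"
  assumes V: "open V" "bounded V" and cont: "continuous_on V u" and g: "integrable (lebesgue_on V) g"
    and u: "u \<in> borel_measurable (lebesgue_on V)"
    and ibp: "\<And>\<phi>. \<phi> \<in> test_functions V \<Longrightarrow>
      (LINT x|lebesgue_on V. u x * divergence \<phi> x) = - (LINT x|lebesgue_on V. \<phi> x \<bullet> g x)"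
  shows "(\<integral>\<^sup>+t. e2ennreal (total_variation V (level_fun u t)) \<partial>lborel)
    \<le> (\<integral>\<^sup>+x. ennreal (norm (g x)) \<partial>lebesgue_on V)"
proof -
  interpret pair_sigma_finite "lebesgue_on V" "lborel :: real measure"
    by (rule pair_sigma_finite_lebesgue_on[OF V])
  note u[measurable]
  have [measurable]: "g \<in> borel_measurable (lebesgue_on V)" using g by simp
  have [measurable]: "steep_step_deriv m \<in> borel_measurable borel" for m
    by (rule borel_measurable_continuous_onI[OF continuous_steep_step_deriv])
  have [measurable]: "steep_step m \<in> borel_measurable borel" for m
    unfolding steep_step_def[abs_def] by measurable
  \<comment> \<open>A bound for the pairing of the steep step with any admissible field that no
    longer contains the field, so that one liminf dominates the whole supremum.\<close>
  define q where "q = (\<lambda>n t. \<integral>\<^sup>+x. ennreal (steep_step_deriv (real (Suc n)) (u x - t) * norm (g x)) \<partial>lebesgue_on V)"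
  have bound: "e2ennreal (total_variation V (level_fun u t)) \<le> liminf (\<lambda>n. q n t)" for t
  proof -
    have "total_variation V (level_fun u t) \<le> enn2ereal (liminf (\<lambda>n. q n t))"
      unfolding total_variation_def
    proof (rule SUP_least)
      fix \<phi> :: "'a \<Rightarrow> 'a" assume "\<phi> \<in> {\<phi> \<in> test_functions V. \<forall>x. norm (\<phi> x) \<le> 1}"
      then have \<phi>: "\<phi> \<in> test_functions V" "\<And>x. norm (\<phi> x) \<le> 1" by auto
      define a where "a = (\<lambda>n. distributional_gradient V (\<lambda>x. steep_step (real (Suc n)) (u x - t)) \<phi>)"
      have "a \<longlonglongrightarrow> distributional_gradient V (level_fun u t) \<phi>"
        unfolding a_def
      proof (rule tendsto_distributional_gradient[OF V(1) \<phi>(1)])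
        show "AE x in lebesgue_on V. (\<lambda>n. steep_step (real (Suc n)) (u x - t)) \<longlonglongrightarrow> level_fun u t x"
          using steep_step_tendsto[of "u x - t" for x] by (intro AE_I2) (simp add: level_fun_def del: of_nat_Suc)
        show "level_fun u t \<in> borel_measurable (lebesgue_on V)" by (rule borel_measurable_level_fun[OF u])
      qed (auto simp: abs_steep_step_le)
      then have "(\<lambda>n. ennreal (a n)) \<longlonglongrightarrow> ennreal (distributional_gradient V (level_fun u t) \<phi>)"
        by (rule tendsto_ennrealI)
      then have "ennreal (distributional_gradient V (level_fun u t) \<phi>) = liminf (\<lambda>n. ennreal (a n))"
        by (metis lim_imp_Liminf trivial_limit_sequentially)
      also have "\<dots> \<le> liminf (\<lambda>n. q n t)"
      proof (intro Liminf_mono always_eventually allI)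
        fix n
        let ?d = "steep_step_deriv (real (Suc n))"
        have i: "integrable (lebesgue_on V) (\<lambda>x. ?d (u x - t) * norm (g x))"
          using integrable_inner_bounded[of "\<lambda>x. ?d (u x - t)" V "\<lambda>x. norm (g x)" "(real (Suc n))\<^sup>2 / pi"] g
            steep_step_deriv_le steep_step_deriv_nonneg
          by (simp del: of_nat_Suc)
        have \<phi>m: "\<phi> \<in> borel_measurable (lebesgue_on V)"
          by (rule borel_measurable_lebesgue_on[OF borel_measurable_continuous_onI[OF smooth_continuous[OF test_function_smooth[OF \<phi>(1)]]]])
        have le: "?d (u x - t) * (\<phi> x \<bullet> g x) \<le> ?d (u x - t) * norm (g x)"
          "\<bar>?d (u x - t) * (\<phi> x \<bullet> g x)\<bar> \<le> ?d (u x - t) * norm (g x)" for x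
        proof -
          have "\<bar>\<phi> x \<bullet> g x\<bar> \<le> norm (g x)"
            using Cauchy_Schwarz_ineq2[of "\<phi> x" "g x"] mult_right_mono[OF \<phi>(2)[of x] norm_ge_zero[of "g x"]] by simp
          then show "\<bar>?d (u x - t) * (\<phi> x \<bullet> g x)\<bar> \<le> ?d (u x - t) * norm (g x)"
            using steep_step_deriv_nonneg by (simp add: abs_mult mult_left_mono)
          then show "?d (u x - t) * (\<phi> x \<bullet> g x) \<le> ?d (u x - t) * norm (g x)" by linarith
        qed
        have i': "integrable (lebesgue_on V) (\<lambda>x. ?d (u x - t) * (\<phi> x \<bullet> g x))"
        proof (rule Bochner_Integration.integrable_bound[OF i])
          show "(\<lambda>x. ?d (u x - t) * (\<phi> x \<bullet> g x)) \<in> borel_measurable (lebesgue_on V)"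
            using \<phi>m by measurable
          show "AE x in lebesgue_on V. norm (?d (u x - t) * (\<phi> x \<bullet> g x)) \<le> norm (?d (u x - t) * norm (g x))"
            using order_trans[OF le(2) abs_ge_self] by (intro AE_I2) (simp only: real_norm_def)
        qed
        have "a n = (LINT x|lebesgue_on V. ?d (u x - t) * (\<phi> x \<bullet> g x))"
        proof -
          have "((\<lambda>s. steep_step (real (Suc n)) (s - t)) has_real_derivative ?d (s - t)) (at s)" for s
            using DERIV_shift[of "steep_step (real (Suc n))" "?d (s - t)" s "- t"] steep_step_has_derivative[of "real (Suc n)" "s - t"] by simp
          moreover have "continuous_on UNIV (\<lambda>s. ?d (s - t))"
            by (intro continuous_on_compose2[OF continuous_steep_step_deriv] continuous_intros) auto
          ultimately show ?thesis
            using weak_chain_rule[OF V(1) cont g ibp, of "\<lambda>s. steep_step (real (Suc n)) (s - t)" "\<lambda>s. ?d (s - t)" \<phi>] \<phi>(1)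
            by (simp add: a_def distributional_gradient_def)
        qed
        also have "\<dots> \<le> (LINT x|lebesgue_on V. ?d (u x - t) * norm (g x))"
          by (intro integral_mono i i' le)
        finally show "ennreal (a n) \<le> q n t"
          unfolding q_def using i steep_step_deriv_nonneg
          by (subst nn_integral_eq_integral) (auto intro: ennreal_leI)
      qed
      finally have "enn2ereal (ennreal (distributional_gradient V (level_fun u t) \<phi>)) \<le> enn2ereal (liminf (\<lambda>n. q n t))"
        by (simp add: less_eq_ennreal.rep_eq)
      \<comment> \<open>\<open>ennreal\<close> truncates negative values to 0, which only weakens
        the upper bound, and the bound is nonnegative.\<close>
      moreover have "ereal r \<le> enn2ereal (ennreal r)" for r
        by (cases "0 \<le> r") (simp_all add: ennreal_neg zero_ennreal.rep_eq)
      ultimately show "ereal (distributional_gradient V (level_fun u t) \<phi>) \<le> enn2ereal (liminf (\<lambda>n. q n t))"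
        by (rule order_trans[rotated])
    qed
    then show ?thesis using e2ennreal_mono by fastforce
  qed
  have "(\<lambda>(x, t). ennreal (steep_step_deriv (real (Suc n)) (u x - t) * norm (g x))) \<in> borel_measurable (lebesgue_on V \<Otimes>\<^sub>M lborel)" for n
    by measurable
  note meas = this
  have "(\<integral>\<^sup>+t. q n t \<partial>lborel) = (\<integral>\<^sup>+x. ennreal (norm (g x)) \<partial>lebesgue_on V)" for n
  proof -
    have "(\<integral>\<^sup>+t. q n t \<partial>lborel)
        = (\<integral>\<^sup>+x. (\<integral>\<^sup>+t. ennreal (steep_step_deriv (real (Suc n)) (u x - t) * norm (g x)) \<partial>lborel) \<partial>lebesgue_on V)"
      unfolding q_def by (rule Fubini'[OF meas])
    \<comment> \<open>The density has mass 1 in \<open>t\<close>, so the integral of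
      \<open>q n\<close> does not depend on \<open>n\<close> and the liminf from Fatou's lemma is
      that of a constant sequence.\<close>
    also have "\<dots> = (\<integral>\<^sup>+x. ennreal (norm (g x)) \<partial>lebesgue_on V)"
      using nn_integral_steep_step_deriv[of "real (Suc n)"]
      by (intro nn_integral_cong) (simp add: ennreal_mult steep_step_deriv_nonneg nn_integral_multc del: of_nat_Suc)
    finally show ?thesis .
  qed
  moreover have "q n \<in> borel_measurable lborel" for n
    unfolding q_def using meas by (intro M1.borel_measurable_nn_integral) (simp add: split_beta')
  then have "(\<integral>\<^sup>+t. liminf (\<lambda>n. q n t) \<partial>lborel) \<le> liminf (\<lambda>n. \<integral>\<^sup>+t. q n t \<partial>lborel)"
    by (rule nn_integral_liminf)
  moreover have "(\<integral>\<^sup>+t. e2ennreal (total_variation V (level_fun u t)) \<partial>lborel) \<le> (\<integral>\<^sup>+t. liminf (\<lambda>n. q n t) \<partial>lborel)"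
    by (intro nn_integral_mono bound)
  ultimately show ?thesis by (simp add: Liminf_const)
qed

section \<open>Convergence in mean\<close>

lemma Lp_norm_one:
  fixes f :: "'a::euclidean_space \<Rightarrow> 'b::euclidean_space"
  shows "Lp_norm 1 V f = (LINT x|lebesgue_on V. norm (f x))"
  by (simp add: Lp_norm_def)

lemma le_one_plus_powr:
  assumes "0 \<le> x" "1 \<le> p" shows "(x::real) \<le> 1 + x powr p"
proof (cases "x \<le> 1")
  case True
  have "0 \<le> x powr p" by simp
  then show ?thesis using True by linarith
next
  case False
  then have "x powr 1 \<le> x powr p" using assms by (intro powr_mono) auto
  then show ?thesis using False by simp
qed

lemma Lp_space_integrable:
  fixes f :: "'a::euclidean_space \<Rightarrow> 'b::euclidean_space"
  assumes "open V" "bounded V" "1 \<le> p" "f \<in> Lp_space p V"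
  shows "integrable (lebesgue_on V) f"
proof -
  interpret finite_measure "lebesgue_on V"
    by (rule finite_measure_lebesgue_on[OF lmeasurable_open[OF assms(2,1)]])
  show ?thesis
  proof (rule Bochner_Integration.integrable_bound)
    show "integrable (lebesgue_on V) (\<lambda>x. 1 + norm (f x) powr p)"
      using assms(4) by (simp add: Lp_space_def)
    show "f \<in> borel_measurable (lebesgue_on V)" using assms(4) by (simp add: Lp_space_def)
    show "AE x in lebesgue_on V. norm (f x) \<le> norm (1 + norm (f x) powr p)"
      using le_one_plus_powr[OF norm_ge_zero assms(3)] by (intro AE_I2) (simp add: abs_of_nonneg)
  qed
qed

lemma norm_diff_powr_le:
  fixes a b :: "'b::real_normed_vector"
  assumes "0 \<le> p"
  shows "norm (a - b) powr p \<le> 2 powr p * (norm a powr p + norm b powr p)"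
proof -
  have "norm (a - b) \<le> 2 * max (norm a) (norm b)"
    using norm_triangle_ineq4[of a b] by linarith
  then have "norm (a - b) powr p \<le> (2 * max (norm a) (norm b)) powr p"
    using assms by (intro powr_mono2) auto
  also have "\<dots> = 2 powr p * (max (norm a) (norm b)) powr p"
    by (simp add: powr_mult)
  also have "\<dots> \<le> 2 powr p * (norm a powr p + norm b powr p)"
    by (intro mult_left_mono) (auto simp: max_def)
  finally show ?thesis .
qed

lemma Lp_space_diff:
  fixes f g :: "'a::euclidean_space \<Rightarrow> 'b::euclidean_space"
  assumes "0 \<le> p" "f \<in> Lp_space p V" "g \<in> Lp_space p V"
  shows "(\<lambda>x. f x - g x) \<in> Lp_space p V"
proof -
  have [measurable]: "f \<in> borel_measurable (lebesgue_on V)" "g \<in> borel_measurable (lebesgue_on V)"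
    and i: "integrable (lebesgue_on V) (\<lambda>x. norm (f x) powr p)" "integrable (lebesgue_on V) (\<lambda>x. norm (g x) powr p)"
    using assms by (auto simp: Lp_space_def)
  have "integrable (lebesgue_on V) (\<lambda>x. norm (f x - g x) powr p)"
  proof (rule Bochner_Integration.integrable_bound)
    show "integrable (lebesgue_on V) (\<lambda>x. 2 powr p * (norm (f x) powr p + norm (g x) powr p))"
      using i by simp
    show "AE x in lebesgue_on V. norm (norm (f x - g x) powr p) \<le> norm (2 powr p * (norm (f x) powr p + norm (g x) powr p))"
      using norm_diff_powr_le[OF assms(1)] by (intro AE_I2) (simp add: abs_of_nonneg)
  qed measurable
  then show ?thesis by (simp add: Lp_space_def)
qed

text \<open>Splitting at height \<open>d\<close>: \<open>norm w \<le> d + d powr (1 - p) * norm w powr p\<close>.\<close>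

lemma tendsto_L1_of_tendsto_Lp:
  fixes w :: "nat \<Rightarrow> 'a::euclidean_space \<Rightarrow> 'b::euclidean_space"
  assumes V: "open V" "bounded V" and p: "1 \<le> p" and w: "\<And>n. w n \<in> Lp_space p V"
    and lim: "(\<lambda>n. LINT x|lebesgue_on V. norm (w n x) powr p) \<longlonglongrightarrow> 0"
  shows "(\<lambda>n. LINT x|lebesgue_on V. norm (w n x)) \<longlonglongrightarrow> 0"
proof (rule tendstoI)
  fix e :: real assume e: "0 < e"
  interpret finite_measure "lebesgue_on V"
    by (rule finite_measure_lebesgue_on[OF lmeasurable_open[OF V(2,1)]])
  define m where "m = measure (lebesgue_on V) (space (lebesgue_on V))"
  have "0 \<le> m" by (simp add: m_def)
  \<comment> \<open>This gives \<open>d * m \<le> e / 2\<close>; the \<open>+ 1\<close> keeps the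
    denominator positive when \<open>m = 0\<close>.\<close>
  define d where "d = e / (2 * (m + 1))"
  have d: "0 < d" using e \<open>0 \<le> m\<close> by (simp add: d_def)
  have pw: "norm (w n x) \<le> d + d powr (1 - p) * norm (w n x) powr p" for n x
  proof (cases "norm (w n x) \<le> d")
    case True
    then show ?thesis by (simp add: add_increasing2)
  next
    case False
    \<comment> \<open>Above height \<open>d\<close>, the exponent \<open>1 - p\<close> being
      nonpositive, the power of the norm is at most that of \<open>d\<close>.\<close>
    then have "norm (w n x) = norm (w n x) powr (1 - p) * norm (w n x) powr p"
      using d by (simp flip: powr_add)
    also have "\<dots> \<le> d powr (1 - p) * norm (w n x) powr p"
      using False d p by (intro mult_right_mono powr_mono2') auto
    finally show ?thesis using d by linarith
  qed
  have le: "(LINT x|lebesgue_on V. norm (w n x))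
      \<le> d * m + d powr (1 - p) * (LINT x|lebesgue_on V. norm (w n x) powr p)" for n
  proof -
    have i: "integrable (lebesgue_on V) (\<lambda>x. norm (w n x) powr p)" using w[of n] by (simp add: Lp_space_def)
    have "(LINT x|lebesgue_on V. norm (w n x)) \<le> (LINT x|lebesgue_on V. d + d powr (1 - p) * norm (w n x) powr p)"
      using Lp_space_integrable[OF V p w] i pw by (intro integral_mono) auto
    also have "\<dots> = d * m + d powr (1 - p) * (LINT x|lebesgue_on V. norm (w n x) powr p)"
      using i by (simp add: m_def)
    finally show ?thesis .
  qed
  have "d * m \<le> e / 2"
    using e \<open>0 \<le> m\<close> by (simp add: d_def divide_simps)
  moreover have "(\<lambda>n. d powr (1 - p) * (LINT x|lebesgue_on V. norm (w n x) powr p)) \<longlonglongrightarrow> d powr (1 - p) * 0"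
    by (intro tendsto_intros lim)
  then have "eventually (\<lambda>n. d powr (1 - p) * (LINT x|lebesgue_on V. norm (w n x) powr p) < e / 2) sequentially"
    using e by (intro order_tendstoD(2)) auto
  ultimately show "eventually (\<lambda>n. dist (LINT x|lebesgue_on V. norm (w n x)) 0 < e) sequentially"
  proof (elim eventually_mono)
    fix n
    assume "d * m \<le> e / 2" "d powr (1 - p) * (LINT x|lebesgue_on V. norm (w n x) powr p) < e / 2"
    moreover have "0 \<le> (LINT x|lebesgue_on V. norm (w n x))" by (intro integral_nonneg_AE) simp
    ultimately show "dist (LINT x|lebesgue_on V. norm (w n x)) 0 < e"
      using le[of n] by (simp add: dist_real_def)
  qed
qed

lemma has_weak_gradient_diff:
  fixes f1 f2 :: "'a::euclidean_space \<Rightarrow> real"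
  assumes "has_weak_gradient \<Omega> f1 g1" "has_weak_gradient \<Omega> f2 g2"
    and f: "integrable (lebesgue_on \<Omega>) f1" "integrable (lebesgue_on \<Omega>) f2"
    and g: "integrable (lebesgue_on \<Omega>) g1" "integrable (lebesgue_on \<Omega>) g2"
  shows "has_weak_gradient \<Omega> (\<lambda>x. f1 x - f2 x) (\<lambda>x. g1 x - g2 x)"
  unfolding has_weak_gradient_def
proof (intro conjI ballI)
  show "locally_integrable \<Omega> (\<lambda>x. f1 x - f2 x)" "locally_integrable \<Omega> (\<lambda>x. g1 x - g2 x)"
    using assms(1,2) by (auto simp: has_weak_gradient_def locally_integrable_def)
  fix \<phi> :: "'a \<Rightarrow> real" assume \<phi>: "\<phi> \<in> test_functions \<Omega>"
  have "integrable (lebesgue_on \<Omega>) (\<lambda>x. f x *\<^sub>R gradient \<phi> x)" if "integrable (lebesgue_on \<Omega>) f" for f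
    by (rule integrable_scaleR_continuous[OF continuous_on_gradient[OF \<phi>] gradient_bounded_support[OF \<phi>] that])
  moreover have "integrable (lebesgue_on \<Omega>) (\<lambda>x. \<phi> x *\<^sub>R g x)" if "integrable (lebesgue_on \<Omega>) g" for g :: "'a \<Rightarrow> 'a"
    by (rule integrable_continuous_scaleR[OF smooth_continuous[OF test_function_smooth[OF \<phi>]] test_function_bounded_support[OF \<phi>] that])
  ultimately show "(LINT x|lebesgue_on \<Omega>. (f1 x - f2 x) *\<^sub>R gradient \<phi> x) = - (LINT x|lebesgue_on \<Omega>. \<phi> x *\<^sub>R (g1 x - g2 x))"
    using assms(1,2) f g \<phi> by (simp add: has_weak_gradient_def scaleR_diff_left scaleR_diff_right)
qed

text \<open>The chosen gradient is only known to be locally integrable. Measurability on all of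
  \<open>\<Omega>\<close> is inherited from \<open>h\<close> through almost everywhere equality, and
  then the integrals agree.\<close>

lemma integral_norm_weak_gradient_powr:
  fixes f :: "'a::euclidean_space \<Rightarrow> real"
  assumes \<Omega>: "open \<Omega>" "bounded \<Omega>" and h: "has_weak_gradient \<Omega> f h" and hm: "h \<in> borel_measurable (lebesgue_on \<Omega>)"
  shows "(LINT x|lebesgue_on \<Omega>. norm (weak_gradient \<Omega> f x) powr p) = (LINT x|lebesgue_on \<Omega>. norm (h x) powr p)"
proof -
  have \<Omega>L: "\<Omega> \<in> sets lebesgue" using \<Omega>(1) by simp
  let ?w = "weak_gradient \<Omega> f"
  have "has_weak_gradient \<Omega> f ?w"
    unfolding weak_gradient_def using someI[of "has_weak_gradient \<Omega> f" h] h by simp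
  then have ae: "AE x in lebesgue_on \<Omega>. h x = ?w x"
    by (rule weak_gradient_unique[OF \<Omega> h])
  then have "AE x in lebesgue. x \<in> \<Omega> \<longrightarrow> h x = ?w x"
    using \<Omega>L by (subst (asm) AE_restrict_space_iff) auto
  then obtain N where N: "{x. \<not> (x \<in> \<Omega> \<longrightarrow> h x = ?w x)} \<subseteq> N" "N \<in> null_sets lebesgue"
    by (auto elim!: AE_E simp: null_setsI)
  have "h measurable_on \<Omega>" using hm measurable_on_iff_borel_measurable[OF \<Omega>L] by blast
  then have "?w measurable_on \<Omega>"
    by (rule measurable_on_spike[where S = N]) (use N in \<open>auto simp: negligible_iff_null_sets\<close>)
  then have wm: "?w \<in> borel_measurable (lebesgue_on \<Omega>)"
    using measurable_on_iff_borel_measurable[OF \<Omega>L] by blast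
  show ?thesis
    using ae hm wm by (intro integral_cong_AE) (auto elim!: eventually_mono)
qed

text \<open>Writing \<open>\<bar>f - F\<bar> = (f - F) + 2 * max 0 (F - f)\<close>, the first term
  is controlled by the integrals. The second is dominated by \<open>F\<close> and tends to 0 as soon
  as the liminf of \<open>f\<close> is at least \<open>F\<close>, so pointwise convergence can be
  replaced by lower semicontinuity.\<close>

lemma scheffe_lsc:
  fixes f :: "nat \<Rightarrow> 'a \<Rightarrow> real"
  assumes f: "\<And>n. integrable M (f n)" and F: "integrable M F" and nn: "\<And>n x. 0 \<le> f n x" "\<And>x. 0 \<le> F x"
    and lsc: "AE x in M. ereal (F x) \<le> liminf (\<lambda>n. ereal (f n x))"
    and lim: "(\<lambda>n. LINT x|M. f n x) \<longlonglongrightarrow> (LINT x|M. F x)"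
  shows "(\<lambda>n. LINT x|M. \<bar>f n x - F x\<bar>) \<longlonglongrightarrow> 0"
proof -
  note [measurable] = borel_measurable_integrable[OF f] borel_measurable_integrable[OF F]
  have "(\<lambda>n. LINT x|M. max 0 (F x - f n x)) \<longlonglongrightarrow> (LINT x|M. 0)"
  proof (rule integral_dominated_convergence)
    show "AE x in M. (\<lambda>n. max 0 (F x - f n x)) \<longlonglongrightarrow> 0"
      using lsc
    proof eventually_elim
      case (elim x)
      show ?case
      proof (rule tendstoI)
        fix e :: real assume "0 < e"
        then have "ereal (F x - e) < liminf (\<lambda>n. ereal (f n x))"
          using elim by (intro less_le_trans[OF _ elim]) simp
        then have "eventually (\<lambda>n. ereal (F x - e) < ereal (f n x)) sequentially"
          by (rule less_LiminfD)
        then show "eventually (\<lambda>n. dist (max 0 (F x - f n x)) 0 < e) sequentially"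
          by eventually_elim (use \<open>0 < e\<close> in \<open>auto simp: dist_real_def\<close>)
      qed
    qed
    show "AE x in M. norm (max 0 (F x - f n x)) \<le> F x" for n
      using nn by (intro AE_I2) auto
  qed (use F in auto)
  moreover have "(LINT x|M. \<bar>f n x - F x\<bar>) = (LINT x|M. f n x) - (LINT x|M. F x) + 2 * (LINT x|M. max 0 (F x - f n x))" for n
  proof -
    have "(LINT x|M. \<bar>f n x - F x\<bar>) = (LINT x|M. (f n x - F x) + 2 * max 0 (F x - f n x))"
      by (intro Bochner_Integration.integral_cong refl) (auto simp: max_def)
    then show ?thesis using f F by simp
  qed
  ultimately show ?thesis
    using tendsto_add[OF tendsto_diff[OF lim tendsto_const[of "LINT x|M. F x"]] tendsto_mult_left[of _ 0 _ 2]] by simp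
qed

text \<open>Passes from extended real perimeters to integrable real functions: a finite integral
  confines the value infinity to a null set, and elsewhere \<open>real_of_ereal\<close> changes
  nothing.\<close>

lemma nn_integral_e2ennreal_finite:
  fixes f :: "'a \<Rightarrow> ereal"
  assumes [measurable]: "f \<in> borel_measurable M" and nn: "\<And>x. 0 \<le> f x"
    and eq: "(\<integral>\<^sup>+x. e2ennreal (f x) \<partial>M) = ennreal c" and "0 \<le> c"
  shows "AE x in M. \<bar>f x\<bar> \<noteq> \<infinity>" and "integrable M (\<lambda>x. real_of_ereal (f x))"
    and "(LINT x|M. real_of_ereal (f x)) = c"
proof -
  have fin: "AE x in M. e2ennreal (f x) \<noteq> \<infinity>"
    by (rule nn_integral_PInf_AE) (use eq in auto)
  then show ae: "AE x in M. \<bar>f x\<bar> \<noteq> \<infinity>"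
  proof eventually_elim
    case (elim x)
    then show ?case using nn[of x] by (cases "f x") auto
  qed
  have "(\<integral>\<^sup>+x. ennreal (real_of_ereal (f x)) \<partial>M) = (\<integral>\<^sup>+x. e2ennreal (f x) \<partial>M)"
    by (rule nn_integral_cong_AE)
       (use ae in eventually_elim, metis e2ennreal_ereal ereal_real')
  then have *: "(\<integral>\<^sup>+x. ennreal (real_of_ereal (f x)) \<partial>M) = ennreal c" by (simp add: eq)
  have nn': "0 \<le> real_of_ereal (f x)" for x using nn by (simp add: real_of_ereal_pos)
  show "integrable M (\<lambda>x. real_of_ereal (f x))"
    by (rule integrableI_nonneg) (use nn' * in auto)
  then show "(LINT x|M. real_of_ereal (f x)) = c"
    using * nn' \<open>0 \<le> c\<close> nn_integral_eq_integral[of M "\<lambda>x. real_of_ereal (f x)"] by (simp add: integral_nonneg_AE)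
qed

section \<open>Convergence of the perimeters\<close>

lemma tendsto_level_fun:
  assumes "(\<lambda>n. f n x) \<longlonglongrightarrow> u x" "u x \<noteq> t"
  shows "(\<lambda>n. level_fun (f n) t x) \<longlonglongrightarrow> level_fun u t x"
proof (rule tendsto_eventually)
  consider "t < u x" | "u x < t" using assms(2) by linarith
  then show "eventually (\<lambda>n. level_fun (f n) t x = level_fun u t x) sequentially"
  proof cases
    case 1
    show ?thesis using order_tendstoD(1)[OF assms(1) 1]
      by eventually_elim (use 1 in \<open>simp add: level_fun_def\<close>)
  next
    case 2
    show ?thesis using order_tendstoD(2)[OF assms(1) 2]
      by eventually_elim (use 2 in \<open>simp add: level_fun_def\<close>)
  qed
qed

text \<open>For fixed \<open>x\<close> the only bad level is \<open>t = u x\<close>, a null set;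
  Fubini exchanges the two almost everywhere quantifiers.\<close>

lemma AE_level_set_null:
  fixes u :: "'a::euclidean_space \<Rightarrow> real"
  assumes V: "open V" "bounded V" and u: "u \<in> borel_measurable (lebesgue_on V)"
  shows "AE t in lborel. AE x in lebesgue_on V. u x \<noteq> t"
proof -
  interpret pair_sigma_finite "lebesgue_on V" "lborel :: real measure"
    by (rule pair_sigma_finite_lebesgue_on[OF V])
  have "(\<lambda>z. u (fst z)) \<in> borel_measurable (lebesgue_on V \<Otimes>\<^sub>M lborel)"
    by (rule measurable_compose[OF measurable_fst u])
  moreover have "snd \<in> borel_measurable (lebesgue_on V \<Otimes>\<^sub>M lborel)"
    using measurable_snd[of "lebesgue_on V" "lborel :: real measure"] by simp
  ultimately have "{z \<in> space (lebesgue_on V \<Otimes>\<^sub>M lborel). u (fst z) \<noteq> snd z} \<in> sets (lebesgue_on V \<Otimes>\<^sub>M lborel)"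
    by (rule borel_measurable_neq)
  moreover have "AE x in lebesgue_on V. AE t in lborel. u x \<noteq> t"
  proof (rule AE_I2)
    fix x show "AE t in lborel. u x \<noteq> t"
      using AE_lborel_singleton[of "u x"] by eventually_elim simp
  qed
  ultimately show ?thesis using AE_commute[of "\<lambda>x t. u x \<noteq> t"] by simp
qed

text \<open>Fubini for the one-variable layer cake identity of \<open>\<bar>u x - v x\<bar>\<close>,
  integrated over \<open>V\<close>.\<close>

lemma has_bochner_integral_level_distance:
  fixes u v :: "'a::euclidean_space \<Rightarrow> real"
  assumes V: "open V" "bounded V" and u: "integrable (lebesgue_on V) u" and v: "integrable (lebesgue_on V) v"
  shows "has_bochner_integral lborel (\<lambda>t. LINT x|lebesgue_on V. \<bar>level_fun u t x - level_fun v t x\<bar>)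
    (LINT x|lebesgue_on V. \<bar>u x - v x\<bar>)"
proof -
  interpret pair_sigma_finite "lebesgue_on V" "lborel :: real measure"
    by (rule pair_sigma_finite_lebesgue_on[OF V])
  define F where "F = (\<lambda>x t. \<bar>level_fun u t x - level_fun v t x\<bar>)"
  have F: "has_bochner_integral lborel (F x) \<bar>u x - v x\<bar>" for x
    using has_bochner_integral_level_difference(2)[of "u x" "v x"] by (simp add: F_def level_fun_def)
  have int: "(LINT t|lborel. F x t) = \<bar>u x - v x\<bar>" for x
    using has_bochner_integral_integral_eq[OF F] .
  have intF: "integrable (lebesgue_on V \<Otimes>\<^sub>M lborel) (case_prod F)"
  proof (rule Fubini_integrable)
    show "case_prod F \<in> borel_measurable (lebesgue_on V \<Otimes>\<^sub>M lborel)"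
      unfolding F_def split_beta' level_fun_def
      by (intro borel_measurable_abs borel_measurable_diff measurable_pair_level) (use u v in auto)
    have "norm (case (x, t) of (x, t) \<Rightarrow> F x t) = F x t" for x t by (simp add: F_def)
    then show "integrable (lebesgue_on V) (\<lambda>x. LINT t|lborel. norm (case (x, t) of (x, t) \<Rightarrow> F x t))"
      using u v by (simp add: int)
    show "AE x in lebesgue_on V. integrable lborel (\<lambda>t. case (x, t) of (x, t) \<Rightarrow> F x t)"
      using F by (intro AE_I2) (auto simp: has_bochner_integral_iff)
  qed
  show ?thesis
    using integrable_snd[OF intF] Fubini_integral[OF intF]
    by (simp add: has_bochner_integral_iff int) (simp add: F_def)
qed

lemma coarea:
  fixes u :: "'a::euclidean_space \<Rightarrow> real" and g :: "'a \<Rightarrow> 'a"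
  assumes V: "open V" "bounded V" and cont: "continuous_on V u"
    and u: "integrable (lebesgue_on V) u" and g: "integrable (lebesgue_on V) g"
    and ibp: "\<And>\<phi>. \<phi> \<in> test_functions V \<Longrightarrow>
      (LINT x|lebesgue_on V. u x * divergence \<phi> x) = - (LINT x|lebesgue_on V. \<phi> x \<bullet> g x)"
  shows "(\<integral>\<^sup>+t. e2ennreal (total_variation V (level_fun u t)) \<partial>lborel)
    = ennreal (LINT x|lebesgue_on V. norm (g x))"
proof -
  have "u \<in> borel_measurable (lebesgue_on V)" using u by simp
  then have "(\<integral>\<^sup>+t. e2ennreal (total_variation V (level_fun u t)) \<partial>lborel)
      = (\<integral>\<^sup>+x. ennreal (norm (g x)) \<partial>lebesgue_on V)"
    by (intro antisym coarea_le[OF V cont g] coarea_ge[OF V u g] ibp)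
  also have "\<dots> = ennreal (LINT x|lebesgue_on V. norm (g x))"
    using g by (intro nn_integral_eq_integral) auto
  finally show ?thesis .
qed

text \<open>Integration by parts on \<open>V\<close> is a hypothesis and the gradients are arbitrary
  integrable fields. This frees the argument from the exponent \<open>p\<close>, from the choice in
  \<open>weak_gradient\<close> and from the ambient set, so it covers open subsets as it
  stands.\<close>

lemma perimeter_convergence:
  fixes V :: "'a::euclidean_space set" and u :: "'a \<Rightarrow> real" and f :: "nat \<Rightarrow> 'a \<Rightarrow> real"
  assumes V: "open V" "bounded V"
    and u: "continuous_on V u" "integrable (lebesgue_on V) u" "integrable (lebesgue_on V) g"
      "\<And>\<phi>. \<phi> \<in> test_functions V \<Longrightarrow> (LINT x|lebesgue_on V. u x * divergence \<phi> x) = - (LINT x|lebesgue_on V. \<phi> x \<bullet> g x)"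
    and f: "\<And>j. continuous_on V (f j)" "\<And>j. integrable (lebesgue_on V) (f j)" "\<And>j. integrable (lebesgue_on V) (gf j)"
      "\<And>j \<phi>. \<phi> \<in> test_functions V \<Longrightarrow> (LINT x|lebesgue_on V. f j x * divergence \<phi> x) = - (LINT x|lebesgue_on V. \<phi> x \<bullet> gf j x)"
    and fu: "\<And>x. x \<in> V \<Longrightarrow> (\<lambda>j. f j x) \<longlonglongrightarrow> u x"
    and grad: "(\<lambda>j. LINT x|lebesgue_on V. norm (gf j x - g x)) \<longlonglongrightarrow> 0"
  defines "P \<equiv> \<lambda>t. total_variation V (level_fun u t)" and "Pf \<equiv> \<lambda>j t. total_variation V (level_fun (f j) t)"
  shows "(\<lambda>j. \<integral>\<^sup>+t. e2ennreal \<bar>Pf j t - P t\<bar> \<partial>lborel) \<longlonglongrightarrow> 0"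
    and "\<exists>r::nat \<Rightarrow> nat. strict_mono r \<and> (AE t in lborel. P t < \<infinity> \<and> (\<forall>j. Pf j t < \<infinity>) \<and>
      (\<lambda>k. Pf (r k) t) \<longlonglongrightarrow> P t \<and> (\<lambda>k. LINT x|lebesgue_on V. \<bar>level_fun (f (r k)) t x - level_fun u t x\<bar>) \<longlonglongrightarrow> 0)"
proof -
  interpret fin: finite_measure "lebesgue_on V"
    by (rule finite_measure_lebesgue_on[OF lmeasurable_open[OF V(2,1)]])
  have um: "u \<in> borel_measurable (lebesgue_on V)" and fm: "f j \<in> borel_measurable (lebesgue_on V)" for j
    using u(2) f(2) by auto
  have [measurable]: "P \<in> borel_measurable lborel" "Pf j \<in> borel_measurable lborel" for j
    using borel_measurable_total_variation_level_fun[OF V(1)] um fm by (auto simp: P_def Pf_def)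
  have nn: "0 \<le> P t" "0 \<le> Pf j t" for j t by (simp_all add: P_def Pf_def total_variation_nonneg)
  define c where "c = (LINT x|lebesgue_on V. norm (g x))"
  define cf where "cf = (\<lambda>j. LINT x|lebesgue_on V. norm (gf j x))"
  have c0: "0 \<le> c" "0 \<le> cf j" for j by (simp_all add: c_def cf_def integral_nonneg_AE)
  have coP: "(\<integral>\<^sup>+t. e2ennreal (P t) \<partial>lborel) = ennreal c"
    unfolding P_def c_def by (rule coarea[OF V u])
  have coPf: "(\<integral>\<^sup>+t. e2ennreal (Pf j t) \<partial>lborel) = ennreal (cf j)" for j
    unfolding Pf_def cf_def by (rule coarea[OF V f])
  define p where "p = (\<lambda>t. real_of_ereal (P t))"
  define pf where "pf = (\<lambda>j t. real_of_ereal (Pf j t))"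
  have p0: "0 \<le> p t" "0 \<le> pf j t" for j t using nn by (simp_all add: p_def pf_def real_of_ereal_pos)
  have finP: "AE t in lborel. \<bar>P t\<bar> \<noteq> \<infinity>" and ip: "integrable lborel p" and Ip: "(LINT t|lborel. p t) = c"
    unfolding p_def by (rule nn_integral_e2ennreal_finite[OF _ nn(1) coP c0(1)]; measurable)+
  have finPf: "AE t in lborel. \<bar>Pf j t\<bar> \<noteq> \<infinity>" and ipf: "integrable lborel (pf j)" and Ipf: "(LINT t|lborel. pf j t) = cf j" for j
    unfolding pf_def by (rule nn_integral_e2ennreal_finite[OF _ nn(2) coPf c0(2)]; measurable)+
  \<comment> \<open>Countably many null sets of levels are discarded, so that one good
    \<open>t\<close> serves all \<open>j\<close> at once.\<close>
  have finPf': "AE t in lborel. \<forall>j. \<bar>Pf j t\<bar> \<noteq> \<infinity>"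
    unfolding AE_all_countable using finPf by blast
  have lev: "AE t in lborel. AE x in lebesgue_on V. (\<lambda>j. level_fun (f j) t x) \<longlonglongrightarrow> level_fun u t x"
    using AE_level_set_null[OF V um]
  proof eventually_elim
    case (elim t)
    then show ?case using AE_space[of "lebesgue_on V"]
    proof eventually_elim
      case (elim x)
      then show ?case using fu by (intro tendsto_level_fun) auto
    qed
  qed
  have lev1: "\<bar>level_fun v t x\<bar> \<le> 1" for v :: "'a \<Rightarrow> real" and t x by (simp add: level_fun_def)
  have "AE t in lborel. P t \<le> liminf (\<lambda>j. Pf j t)"
    using lev
  proof eventually_elim
    case (elim t)
    then show ?case unfolding P_def Pf_def
      by (intro total_variation_lsc V borel_measurable_level_fun um fm lev1)
  qed
  then have lsc: "AE t in lborel. ereal (p t) \<le> liminf (\<lambda>j. ereal (pf j t))"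
    using finP finPf'
  proof eventually_elim
    case (elim t)
    then show ?case by (simp add: p_def pf_def ereal_real')
  qed
  \<comment> \<open>By the coarea formula \<open>cf j\<close> and \<open>c\<close> are the integrals
    of the perimeters over all levels. The reverse triangle inequality bounds their difference by
    the L^1 distance of the gradients, and this supplies the convergence of integrals for
    \<open>scheffe_lsc\<close>.\<close>
  have "(\<lambda>j. cf j - c) \<longlonglongrightarrow> 0"
  proof (rule Lim_null_comparison[OF _ grad])
    have "norm (cf j - c) \<le> (LINT x|lebesgue_on V. norm (gf j x - g x))" for j
    proof -
      have "cf j - c = (LINT x|lebesgue_on V. norm (gf j x) - norm (g x))"
        using u(3) f(3) by (simp add: cf_def c_def)
      also have "norm \<dots> \<le> (LINT x|lebesgue_on V. norm (gf j x - g x))"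
        using u(3) f(3)[of j] by (intro Bochner_Integration.integral_norm_bound_integral) (auto simp: norm_triangle_ineq3)
      finally show ?thesis .
    qed
    then show "eventually (\<lambda>j. norm (cf j - c) \<le> (LINT x|lebesgue_on V. norm (gf j x - g x))) sequentially"
      by simp
  qed
  then have "cf \<longlonglongrightarrow> c" by (simp add: LIM_zero_iff)
  then have L1: "(\<lambda>j. LINT t|lborel. \<bar>pf j t - p t\<bar>) \<longlonglongrightarrow> 0"
    by (intro scheffe_lsc ipf ip p0 lsc) (simp add: Ip Ipf)
  have "(\<integral>\<^sup>+t. e2ennreal \<bar>Pf j t - P t\<bar> \<partial>lborel) = ennreal (LINT t|lborel. \<bar>pf j t - p t\<bar>)" for j
  proof -
    have "(\<integral>\<^sup>+t. e2ennreal \<bar>Pf j t - P t\<bar> \<partial>lborel) = (\<integral>\<^sup>+t. ennreal \<bar>pf j t - p t\<bar> \<partial>lborel)"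
    proof (rule nn_integral_cong_AE)
      show "AE t in lborel. e2ennreal \<bar>Pf j t - P t\<bar> = ennreal \<bar>pf j t - p t\<bar>"
        using finP finPf[of j]
      proof eventually_elim
        case (elim t)
        then obtain a b where "P t = ereal a" "Pf j t = ereal b" by (metis ereal_real')
        then show ?case by (simp add: p_def pf_def)
      qed
    qed
    also have "\<dots> = ennreal (LINT t|lborel. \<bar>pf j t - p t\<bar>)"
      by (rule nn_integral_eq_integral) (use ip ipf in auto)
    finally show ?thesis .
  qed
  then show "(\<lambda>j. \<integral>\<^sup>+t. e2ennreal \<bar>Pf j t - P t\<bar> \<partial>lborel) \<longlonglongrightarrow> 0"
    using tendsto_ennrealI[OF L1] by simp
  \<comment> \<open>L^1 convergence in the level gives almost everywhere convergence only along a
    subsequence; one subsequence serves almost all \<open>t\<close>.\<close>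
  obtain r :: "nat \<Rightarrow> nat" where r: "strict_mono r" "AE t in lborel. (\<lambda>k. pf (r k) t - p t) \<longlonglongrightarrow> 0"
    using tendsto_L1_AE_subseq[of lborel "\<lambda>j t. pf j t - p t"] ip ipf L1 by auto
  have "AE t in lborel. P t < \<infinity> \<and> (\<forall>j. Pf j t < \<infinity>) \<and>
      (\<lambda>k. Pf (r k) t) \<longlonglongrightarrow> P t \<and> (\<lambda>k. LINT x|lebesgue_on V. \<bar>level_fun (f (r k)) t x - level_fun u t x\<bar>) \<longlonglongrightarrow> 0"
    using finP finPf' r(2) lev
  proof eventually_elim
    case (elim t)
    have eP: "P t = ereal (p t)" "Pf j t = ereal (pf j t)" for j
      using elim by (simp_all add: p_def pf_def ereal_real')
    have "(\<lambda>k. pf (r k) t) \<longlonglongrightarrow> p t" using elim(3) by (simp add: LIM_zero_iff)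
    \<comment> \<open>The superlevel sets themselves converge along the full sequence at almost
      every level, by domination with the constant 1 on a set of finite measure.\<close>
    moreover have "(\<lambda>j. LINT x|lebesgue_on V. \<bar>level_fun (f j) t x - level_fun u t x\<bar>) \<longlonglongrightarrow> (LINT x|lebesgue_on V. 0)"
    proof (rule integral_dominated_convergence)
      show "AE x in lebesgue_on V. (\<lambda>j. \<bar>level_fun (f j) t x - level_fun u t x\<bar>) \<longlonglongrightarrow> 0"
        using elim(4)
      proof eventually_elim
        case (elim x)
        then show ?case by (intro tendsto_rabs_zero) (simp add: LIM_zero_iff)
      qed
      show "(\<lambda>x. \<bar>level_fun (f j) t x - level_fun u t x\<bar>) \<in> borel_measurable (lebesgue_on V)" for j
        by (intro borel_measurable_abs borel_measurable_diff borel_measurable_level_fun um fm)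
      show "AE x in lebesgue_on V. norm \<bar>level_fun (f j) t x - level_fun u t x\<bar> \<le> 1" for j
        by (intro AE_I2) (simp add: level_fun_def)
    qed auto
    then have "(\<lambda>k. LINT x|lebesgue_on V. \<bar>level_fun (f (r k)) t x - level_fun u t x\<bar>) \<longlonglongrightarrow> 0"
      using LIMSEQ_subseq_LIMSEQ[OF _ r(1)] by (fastforce simp: o_def)
    ultimately show ?case by (simp add: eP)
  qed
  then show "\<exists>r::nat \<Rightarrow> nat. strict_mono r \<and> (AE t in lborel. P t < \<infinity> \<and> (\<forall>j. Pf j t < \<infinity>) \<and>
      (\<lambda>k. Pf (r k) t) \<longlonglongrightarrow> P t \<and> (\<lambda>k. LINT x|lebesgue_on V. \<bar>level_fun (f (r k)) t x - level_fun u t x\<bar>) \<longlonglongrightarrow> 0)"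
    using r(1) by blast
qed

section \<open>Unpacking the Sobolev norm and returning to superlevel sets\<close>

lemma W1p_norm_tendsto_zero:
  fixes f :: "nat \<Rightarrow> 'a::euclidean_space \<Rightarrow> real"
  assumes "0 < p" and lim: "(\<lambda>j. W1p_norm p \<Omega> (f j)) \<longlonglongrightarrow> 0"
  shows "(\<lambda>j. LINT x|lebesgue_on \<Omega>. norm (weak_gradient \<Omega> (f j) x) powr p) \<longlonglongrightarrow> 0"
proof (rule Lim_null_comparison)
  have pow: "(x powr (1 / p)) powr p = x" if "0 \<le> x" for x :: real
    using that \<open>0 < p\<close> by (simp add: powr_powr)
  have I: "Lp_norm p \<Omega> h powr p = (LINT x|lebesgue_on \<Omega>. norm (h x) powr p)" for h :: "'a \<Rightarrow> 'a"
    unfolding Lp_norm_def by (rule pow) (simp add: integral_nonneg_AE)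
  have "norm (LINT x|lebesgue_on \<Omega>. norm (weak_gradient \<Omega> (f j) x) powr p) \<le> W1p_norm p \<Omega> (f j) powr p" for j
    unfolding W1p_norm_def I by (subst pow) (simp_all add: integral_nonneg_AE add_nonneg_nonneg)
  then show "eventually (\<lambda>j. norm (LINT x|lebesgue_on \<Omega>. norm (weak_gradient \<Omega> (f j) x) powr p)
      \<le> W1p_norm p \<Omega> (f j) powr p) sequentially"
    by simp
  show "(\<lambda>j. W1p_norm p \<Omega> (f j) powr p) \<longlonglongrightarrow> 0"
    by (rule tendsto_zero_powrI[OF lim tendsto_const]) (use \<open>0 < p\<close> in \<open>auto simp: W1p_norm_def\<close>)
qed

lemma integral_norm_subset_le:
  fixes f :: "'a::euclidean_space \<Rightarrow> 'b::euclidean_space"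
  assumes "open V" "open W" "V \<subseteq> W" "integrable (lebesgue_on W) f"
  shows "(LINT x|lebesgue_on V. norm (f x)) \<le> (LINT x|lebesgue_on W. norm (f x))"
proof -
  have i: "integrable lebesgue (\<lambda>x. indicator W x *\<^sub>R norm (f x))"
    using integrable_norm[OF assms(4)] assms(2) by (simp add: integrable_restrict_space)
  have "integrable (lebesgue_on V) (\<lambda>x. norm (f x))"
    using integrable_lebesgue_on_subset[OF integrable_norm[OF assms(4)] assms(3)] assms(1,2) by simp
  then have "integrable lebesgue (\<lambda>x. indicator V x *\<^sub>R norm (f x))"
    using assms(1) by (simp add: integrable_restrict_space)
  then have "(LINT x|lebesgue. indicator V x *\<^sub>R norm (f x)) \<le> (LINT x|lebesgue. indicator W x *\<^sub>R norm (f x))"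
    using i assms(3) by (intro integral_mono) (auto simp: indicator_def)
  then show ?thesis
    using assms(1,2) by (simp add: integral_restrict_space)
qed

lemma Lp_norm_superlevel_diff:
  fixes u v :: "'a::euclidean_space \<Rightarrow> real"
  assumes "V \<subseteq> \<Omega>"
  shows "Lp_norm 1 V (\<lambda>x. indicator (superlevel \<Omega> u t) x - indicator (superlevel \<Omega> v t) x :: real)
    = (LINT x|lebesgue_on V. \<bar>level_fun u t x - level_fun v t x\<bar>)"
  unfolding Lp_norm_one real_norm_def
  by (rule Bochner_Integration.integral_cong) (use assms in \<open>auto simp: superlevel_def level_fun_def indicator_def\<close>)

lemma indicator_superlevel_in_BV_space:
  fixes u :: "'a::euclidean_space \<Rightarrow> real"
  assumes V: "open V" "bounded V" "V \<subseteq> \<Omega>" and u: "u \<in> borel_measurable (lebesgue_on V)"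
    and fin: "total_variation V (level_fun u t) < \<infinity>"
  shows "indicator (superlevel \<Omega> u t) \<in> BV_space V"
proof -
  interpret finite_measure "lebesgue_on V"
    by (rule finite_measure_lebesgue_on[OF lmeasurable_open[OF V(2,1)]])
  have eq: "indicator (superlevel \<Omega> u t) x = level_fun u t x" if "x \<in> V" for x
    using V(3) that by (auto simp: superlevel_def level_fun_def)
  have "(indicator (superlevel \<Omega> u t) :: 'a \<Rightarrow> real) \<in> borel_measurable (lebesgue_on V)
      \<longleftrightarrow> level_fun u t \<in> borel_measurable (lebesgue_on V)"
    by (rule measurable_cong) (simp add: eq)
  then have [measurable]: "(indicator (superlevel \<Omega> u t) :: 'a \<Rightarrow> real) \<in> borel_measurable (lebesgue_on V)"
    using borel_measurable_level_fun[OF u] by simp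
  have "integrable (lebesgue_on V) (\<lambda>x. norm (indicator (superlevel \<Omega> u t) x :: real) powr 1)"
  proof (rule integrable_const_bound[where B = 1])
    show "AE x in lebesgue_on V. norm (norm (indicator (superlevel \<Omega> u t) x :: real) powr 1) \<le> 1"
      by (simp add: indicator_def)
  qed measurable
  moreover have "total_variation V (indicator (superlevel \<Omega> u t)) < \<infinity>"
    using fin perimeter_superlevel[OF V(3), of u t] by (simp add: perimeter_def)
  ultimately show ?thesis by (simp add: BV_space_def Lp_space_def)
qed

theorem corollary12p1:
  fixes \<Omega> :: "'a::euclidean_space set"
    and p :: real
    and u :: "'a \<Rightarrow> real"
    and uj :: "nat \<Rightarrow> 'a \<Rightarrow> real"
  assumes "bounded \<Omega>" and "open \<Omega>"
    and "1 < p"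
    and "continuous_on \<Omega> u" and "u \<in> W1p_space p \<Omega>"
    and "\<And>j. continuous_on \<Omega> (uj j)" and "\<And>j. uj j \<in> W1p_space p \<Omega>"
    and "uniform_limit \<Omega> uj u sequentially"
    and "(\<lambda>j. W1p_norm p \<Omega> (\<lambda>x. uj j x - u x)) \<longlonglongrightarrow> 0"
  shows "\<forall>V. open V \<and> V \<subseteq> \<Omega> \<longrightarrow>
    (\<forall>j. has_bochner_integral lborel
       (\<lambda>t. Lp_norm 1 V (\<lambda>x. indicator (superlevel \<Omega> (uj j) t) x - indicator (superlevel \<Omega> u t) x :: real))
       (Lp_norm 1 V (\<lambda>x. uj j x - u x))) \<and>
    (\<lambda>j. Lp_norm 1 V (\<lambda>x. uj j x - u x)) \<longlonglongrightarrow> 0 \<and>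
    (\<lambda>t. perimeter (superlevel \<Omega> u t) V) \<in> borel_measurable lborel \<and>
    (\<forall>j. (\<lambda>t. perimeter (superlevel \<Omega> (uj j) t) V) \<in> borel_measurable lborel) \<and>
    (\<lambda>j. perimeter_distance \<Omega> V (uj j) u) \<longlonglongrightarrow> 0 \<and>
    (\<exists>r::nat \<Rightarrow> nat. strict_mono r \<and>
       (AE t in lborel. BV_strict_limit V
          (\<lambda>k. indicator (superlevel \<Omega> (uj (r k)) t)) (indicator (superlevel \<Omega> u t))))"
proof (intro allI impI, elim conjE)
  fix V assume V: "open V" "V \<subseteq> \<Omega>"
  have bV: "bounded V" using bounded_subset[OF assms(1) V(2)] .
  note \<Omega> = assms(2,1)
  have p: "1 \<le> p" "0 < p" "0 \<le> p" using assms(3) by auto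
  obtain g where g: "has_weak_gradient \<Omega> u g" "g \<in> Lp_space p \<Omega>" and uLp: "u \<in> Lp_space p \<Omega>"
    using assms(5) by (auto simp: W1p_space_def)
  have "\<exists>h. has_weak_gradient \<Omega> (uj j) h \<and> h \<in> Lp_space p \<Omega>" and ujLp: "uj j \<in> Lp_space p \<Omega>" for j
    using assms(7)[of j] by (auto simp: W1p_space_def)
  then obtain gj where gj: "\<And>j. has_weak_gradient \<Omega> (uj j) (gj j)" "\<And>j. gj j \<in> Lp_space p \<Omega>"
    by metis
  have i\<Omega>: "integrable (lebesgue_on \<Omega>) u" "integrable (lebesgue_on \<Omega>) g"
    "integrable (lebesgue_on \<Omega>) (uj j)" "integrable (lebesgue_on \<Omega>) (gj j)" for j
    using Lp_space_integrable[OF \<Omega> p(1)] g gj uLp ujLp by auto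
  have sub: "integrable (lebesgue_on \<Omega>) h \<Longrightarrow> integrable (lebesgue_on V) h" for h :: "'a \<Rightarrow> 'b::euclidean_space"
    using integrable_lebesgue_on_subset[OF _ V(2)] V(1) \<Omega>(1) by auto
  note iV = i\<Omega>(1)[THEN sub] i\<Omega>(2)[THEN sub] i\<Omega>(3)[THEN sub] i\<Omega>(4)[THEN sub]
  have um: "u \<in> borel_measurable (lebesgue_on V)" and ujm: "uj j \<in> borel_measurable (lebesgue_on V)" for j
    using iV by auto
  interpret finite_measure "lebesgue_on V"
    by (rule finite_measure_lebesgue_on[OF lmeasurable_open[OF bV V(1)]])
  have uL: "\<And>x. x \<in> V \<Longrightarrow> (\<lambda>j. uj j x) \<longlonglongrightarrow> u x"
    using tendsto_uniform_limitI[OF assms(8)] V(2) by blast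
  have gLp: "(\<lambda>x. gj j x - g x) \<in> Lp_space p \<Omega>" for j
    by (rule Lp_space_diff[OF p(3) gj(2) g(2)])
  have wg: "has_weak_gradient \<Omega> (\<lambda>x. uj j x - u x) (\<lambda>x. gj j x - g x)" for j
    by (rule has_weak_gradient_diff[OF gj(1) g(1) i\<Omega>(3,1,4,2)])
  \<comment> \<open>The hypothesis concerns the gradient chosen for \<open>uj j - u\<close>, not
    \<open>gj j - g\<close>; uniqueness identifies the two up to a null set.\<close>
  have "(LINT x|lebesgue_on \<Omega>. norm (weak_gradient \<Omega> (\<lambda>x. uj j x - u x) x) powr p)
      = (LINT x|lebesgue_on \<Omega>. norm (gj j x - g x) powr p)" for j
    using gLp by (intro integral_norm_weak_gradient_powr[OF \<Omega> wg]) (simp add: Lp_space_def)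
  then have "(\<lambda>j. LINT x|lebesgue_on \<Omega>. norm (gj j x - g x) powr p) \<longlonglongrightarrow> 0"
    using W1p_norm_tendsto_zero[OF p(2) assms(9)] by simp
  then have g\<Omega>: "(\<lambda>j. LINT x|lebesgue_on \<Omega>. norm (gj j x - g x)) \<longlonglongrightarrow> 0"
    by (intro tendsto_L1_of_tendsto_Lp[OF \<Omega> p(1) gLp])
  have grad: "(\<lambda>j. LINT x|lebesgue_on V. norm (gj j x - g x)) \<longlonglongrightarrow> 0"
  proof (rule Lim_null_comparison[OF _ g\<Omega>])
    have "norm (LINT x|lebesgue_on V. norm (gj j x - g x)) \<le> (LINT x|lebesgue_on \<Omega>. norm (gj j x - g x))" for j
      using integral_norm_subset_le[OF V(1) \<Omega>(1) V(2), of "\<lambda>x. gj j x - g x"] i\<Omega>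
      by (simp add: integral_nonneg_AE)
    then show "eventually (\<lambda>j. norm (LINT x|lebesgue_on V. norm (gj j x - g x))
        \<le> (LINT x|lebesgue_on \<Omega>. norm (gj j x - g x))) sequentially" by simp
  qed
  have cont: "continuous_on V u" "continuous_on V (uj j)" for j
    using assms(4,6) V(2) by (auto intro: continuous_on_subset)
  have ibp: "(LINT x|lebesgue_on V. u x * divergence \<phi> x) = - (LINT x|lebesgue_on V. \<phi> x \<bullet> g x)"
    "(LINT x|lebesgue_on V. uj j x * divergence \<phi> x) = - (LINT x|lebesgue_on V. \<phi> x \<bullet> gj j x)"
    if "\<phi> \<in> test_functions V" for \<phi> j
    using weak_gradient_test_field[OF V(1) \<Omega>(1) V(2) g(1) iV(1,2) that]
      weak_gradient_test_field[OF V(1) \<Omega>(1) V(2) gj(1) iV(3,4) that] by auto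
  \<comment> \<open>Continuity, integrability and integration by parts have been restricted from
    \<open>\<Omega>\<close> to \<open>V\<close>, and the convergence argument is run on
    \<open>V\<close> itself.\<close>
  note conv = perimeter_convergence[OF V(1) bV cont(1) iV(1,2) ibp(1) cont(2) iV(3,4) ibp(2) uL grad]
  have per: "perimeter (superlevel \<Omega> v t) V = total_variation V (level_fun v t)" for v t
    by (rule perimeter_superlevel[OF V(2)])
  have 1: "\<forall>j. has_bochner_integral lborel
       (\<lambda>t. Lp_norm 1 V (\<lambda>x. indicator (superlevel \<Omega> (uj j) t) x - indicator (superlevel \<Omega> u t) x :: real))
       (Lp_norm 1 V (\<lambda>x. uj j x - u x))"
    unfolding Lp_norm_superlevel_diff[OF V(2)] unfolding Lp_norm_one real_norm_def
    by (intro allI has_bochner_integral_level_distance V(1) bV iV)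
  have 2: "(\<lambda>j. Lp_norm 1 V (\<lambda>x. uj j x - u x)) \<longlonglongrightarrow> 0"
    unfolding Lp_norm_one
  proof (rule tendstoI)
    fix e :: real assume "0 < e"
    define m where "m = measure (lebesgue_on V) (space (lebesgue_on V))"
    have "0 \<le> m" by (simp add: m_def)
    \<comment> \<open>Uniform distance below \<open>d\<close> contributes at most
      \<open>d * m\<close> to the integral, and this choice gives \<open>d * m < e\<close> even when
      \<open>m = 0\<close>.\<close>
    define d where "d = e / (2 * (m + 1))"
    have "0 < d" "d * m < e" using \<open>0 < e\<close> \<open>0 \<le> m\<close> by (auto simp: d_def field_simps add_strict_increasing)
    have "eventually (\<lambda>j. \<forall>x\<in>\<Omega>. dist (uj j x) (u x) < d) sequentially"
      using uniform_limitD[OF assms(8) \<open>0 < d\<close>] .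
    then show "eventually (\<lambda>j. dist (LINT x|lebesgue_on V. norm (uj j x - u x)) 0 < e) sequentially"
    proof eventually_elim
      case (elim j)
      have "(LINT x|lebesgue_on V. norm (uj j x - u x)) \<le> (LINT x|lebesgue_on V. d)"
        using elim V(2) iV by (intro integral_mono) (auto simp: dist_real_def less_imp_le)
      also have "\<dots> = d * m" by (simp add: m_def)
      finally show ?case using \<open>d * m < e\<close> by (simp add: dist_real_def integral_nonneg_AE)
    qed
  qed
  have 3: "(\<lambda>t. perimeter (superlevel \<Omega> u t) V) \<in> borel_measurable lborel"
    "\<forall>j. (\<lambda>t. perimeter (superlevel \<Omega> (uj j) t) V) \<in> borel_measurable lborel"
    using borel_measurable_total_variation_level_fun[OF V(1)] um ujm by (simp_all add: per)
  have 4: "(\<lambda>j. perimeter_distance \<Omega> V (uj j) u) \<longlonglongrightarrow> 0"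
    using conv(1) by (simp add: perimeter_distance_def per)
  obtain r :: "nat \<Rightarrow> nat" where r: "strict_mono r"
    "AE t in lborel. total_variation V (level_fun u t) < \<infinity> \<and> (\<forall>j. total_variation V (level_fun (uj j) t) < \<infinity>) \<and>
      (\<lambda>k. total_variation V (level_fun (uj (r k)) t)) \<longlonglongrightarrow> total_variation V (level_fun u t) \<and>
      (\<lambda>k. LINT x|lebesgue_on V. \<bar>level_fun (uj (r k)) t x - level_fun u t x\<bar>) \<longlonglongrightarrow> 0"
    using conv(2) by blast
  have "AE t in lborel. BV_strict_limit V
          (\<lambda>k. indicator (superlevel \<Omega> (uj (r k)) t)) (indicator (superlevel \<Omega> u t))"
    using r(2)
  proof eventually_elim
    case (elim t)
    then show ?case
      unfolding BV_strict_limit_def Lp_norm_superlevel_diff[OF V(2)]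
      using indicator_superlevel_in_BV_space[OF V(1) bV V(2)] um ujm per
      by (simp add: perimeter_def)
  qed
  with 1 2 3 4 r(1) show "(\<forall>j. has_bochner_integral lborel
       (\<lambda>t. Lp_norm 1 V (\<lambda>x. indicator (superlevel \<Omega> (uj j) t) x - indicator (superlevel \<Omega> u t) x :: real))
       (Lp_norm 1 V (\<lambda>x. uj j x - u x))) \<and>
    (\<lambda>j. Lp_norm 1 V (\<lambda>x. uj j x - u x)) \<longlonglongrightarrow> 0 \<and>
    (\<lambda>t. perimeter (superlevel \<Omega> u t) V) \<in> borel_measurable lborel \<and>
    (\<forall>j. (\<lambda>t. perimeter (superlevel \<Omega> (uj j) t) V) \<in> borel_measurable lborel) \<and>
    (\<lambda>j. perimeter_distance \<Omega> V (uj j) u) \<longlonglongrightarrow> 0 \<and>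
    (\<exists>r::nat \<Rightarrow> nat. strict_mono r \<and>
       (AE t in lborel. BV_strict_limit V
          (\<lambda>k. indicator (superlevel \<Omega> (uj (r k)) t)) (indicator (superlevel \<Omega> u t))))"
    by blast
qed

end
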